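(* Let $s>0$. For every $f\in\mathcal V^{\mathrm{spec}}_s(M)$ and every $\Lambda\ge0$, $$\|f-\Pi_{\le\Lambda}f\|_{L^2(M)}\le\|f\|_{\mathcal V^{\mathrm{spec}}_s(M)}(1+\Lambda)^{-s/2}.$$ Consequently, for every $f$ with $\|f\|_{\mathcal V^{\mathrm{spec}}_s(M)}\le R$ (where $R>0$), $$\|f-\Pi_{\le\Lambda}f\|_{L^2(M)}^2\le R^2(1+\Lambda)^{-s}.$$ For $0<\varepsilon<R$, choosing $\Lambda_\varepsilon=(R/\varepsilon)^{2/s}-1$ gives $\|f-\Pi_{\le\Lambda_\varepsilon}f\|_{L^2(M)}\le\varepsilon$ for every such $f$, using at most $$D(\Lambda_\varepsilon)\le C_W(R/\varepsilon)^{m/s}$$ Laplace–Beltrami degrees of freedom.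
   Context: $(M,g)$ is a compact connected smooth Riemannian manifold without boundary of dimension $m$, $\nu$ is Riemannian volume normalized so that $\nu(M)=1$, $L^2(M)=L^2(M,\nu)$ (real-valued). $L=-\Delta_M$ is the nonnegative Laplace–Beltrami operator with distinct eigenvalues $0=\mu_0<\mu_1<\cdots$; $E_j=\ker(L-\mu_jI)$, $d_j=\dim E_j$, and $P_j:L^2(M)\to E_j$ is the orthogonal projector. For $s\ge0$, $\|f\|_{\mathcal V^{\mathrm{spec}}_s(M)}=\sum_{j\ge0}(1+\mu_j)^{s/2}\|P_jf\|_{L^2(M)}$ and $\mathcal V^{\mathrm{spec}}_s(M)=\{f\in L^2(M):\|f\|_{\mathcal V^{\mathrm{spec}}_s(M)}<\infty\}$. $\Pi_{\le\Lambda}=\sum_{\mu_j\le\Lambda}P_j$ and $D(\Lambda)=\sum_{\mu_j\le\Lambda}d_j$. $C_W=C_W(M,g)$ is a constant (from Weyl's law) with $D(\Lambda)\le C_W(1+\Lambda)^{m/2}$ for all $\Lambda\ge0$. *)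

theory Defs
  imports "HOL-Probability.Probability"
begin

section \<open>Smooth functions on open subsets of Euclidean space\<close>

definition partial_deriv :: "'n \<Rightarrow> (real^'n \<Rightarrow> real) \<Rightarrow> real^'n \<Rightarrow> real" where
  "partial_deriv i f x = frechet_derivative f (at x) (axis i 1)"

text \<open>Meaningful for open sets only.\<close>

primrec Ck_on :: "nat \<Rightarrow> (real^'n) set \<Rightarrow> (real^'n \<Rightarrow> real) \<Rightarrow> bool" where
  "Ck_on 0 S f \<longleftrightarrow> continuous_on S f"
| "Ck_on (Suc k) S f \<longleftrightarrow>
     (\<forall>x\<in>S. f differentiable (at x)) \<and> (\<forall>i. Ck_on k S (partial_deriv i f))"

definition smooth_on :: "(real^'n) set \<Rightarrow> (real^'n \<Rightarrow> real) \<Rightarrow> bool" where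
  "smooth_on S f \<longleftrightarrow> (\<forall>k. Ck_on k S f)"


section \<open>Compact connected Riemannian manifolds\<close>

text \<open>
  The manifold is a whole (Hausdorff, compact, connected) topological type \<^typ>\<open>'a\<close>. A chart is
  a pair of its domain and its coordinate map; all charts take values in the same Euclidean space,
  whose dimension is the dimension of the manifold. Images of charts are open in the full Euclidean
  space, so there is no boundary. Second countability is automatic for compact spaces.
\<close>

type_synonym ('a, 'n) chart = "'a set \<times> ('a \<Rightarrow> (real, 'n) vec)"

abbreviation chart_dom :: "('a, 'n) chart \<Rightarrow> 'a set" where
  "chart_dom c \<equiv> fst c"

abbreviation chart_map :: "('a, 'n) chart \<Rightarrow> 'a \<Rightarrow> (real, 'n) vec" where
  "chart_map c \<equiv> snd c"

definition chart_image :: "('a, 'n) chart \<Rightarrow> (real, 'n) vec set" where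
  "chart_image c = chart_map c ` chart_dom c"

definition chart_inv :: "('a, 'n) chart \<Rightarrow> (real, 'n) vec \<Rightarrow> 'a" where
  "chart_inv c = inv_into (chart_dom c) (chart_map c)"

definition is_chart :: "('a::topological_space, 'n::finite) chart \<Rightarrow> bool" where
  "is_chart c \<longleftrightarrow> open (chart_dom c) \<and> open (chart_image c) \<and>
     homeomorphism (chart_dom c) (chart_image c) (chart_map c) (chart_inv c)"

definition transition :: "('a, 'n) chart \<Rightarrow> ('a, 'n) chart \<Rightarrow> (real, 'n) vec \<Rightarrow> (real, 'n) vec" where
  "transition c d = chart_map d \<circ> chart_inv c"

definition smooth_atlas :: "('a::topological_space, 'n::finite) chart set \<Rightarrow> bool" where
  "smooth_atlas A \<longleftrightarrow>
     (\<forall>c\<in>A. is_chart c) \<and> (\<Union>c\<in>A. chart_dom c) = UNIV \<and>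
     (\<forall>c\<in>A. \<forall>d\<in>A. \<forall>i.
        smooth_on (chart_map c ` (chart_dom c \<inter> chart_dom d)) (\<lambda>x. transition c d x $ i))"

text \<open>
  A Riemannian metric is given by its component matrices \<open>G c x\<close> at the point with coordinates
  \<open>x\<close> in the chart \<open>c\<close>, subject to the transformation law of a covariant 2-tensor.
\<close>

type_synonym ('a, 'n) metric = "('a, 'n) chart \<Rightarrow> (real, 'n) vec \<Rightarrow> ((real, 'n) vec, 'n) vec"

definition riemannian_metric ::
    "('a::topological_space, 'n::finite) chart set \<Rightarrow> ('a, 'n) metric \<Rightarrow> bool" where
  "riemannian_metric A G \<longleftrightarrow>
     (\<forall>c\<in>A. (\<forall>i j. smooth_on (chart_image c) (\<lambda>x. G c x $ i $ j)) \<and>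
        (\<forall>x\<in>chart_image c. transpose (G c x) = G c x \<and> (\<forall>v. v \<noteq> 0 \<longrightarrow> v \<bullet> (G c x *v v) > 0))) \<and>
     (\<forall>c\<in>A. \<forall>d\<in>A. \<forall>p\<in>chart_dom c \<inter> chart_dom d.
        let J = matrix (frechet_derivative (transition c d) (at (chart_map c p)))
        in G c (chart_map c p) = transpose J ** G d (chart_map d p) ** J)"

definition compact_connected_riemannian_manifold ::
    "('a::t2_space, 'n::finite) chart set \<Rightarrow> ('a, 'n) metric \<Rightarrow> bool" where
  "compact_connected_riemannian_manifold A G \<longleftrightarrow>
     compact (UNIV :: 'a set) \<and> connected (UNIV :: 'a set) \<and>
     smooth_atlas A \<and> riemannian_metric A G"

text \<open>The unique Borel measure with density \<open>sqrt (det G)\<close> in every chart.\<close>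

definition riemannian_volume ::
    "('a::topological_space, 'n::finite) chart set \<Rightarrow> ('a, 'n) metric \<Rightarrow> 'a measure \<Rightarrow> bool" where
  "riemannian_volume A G vol \<longleftrightarrow> sets vol = sets borel \<and>
     (\<forall>c\<in>A. \<forall>B\<in>sets borel. B \<subseteq> chart_dom c \<longrightarrow>
        emeasure vol B = (\<integral>\<^sup>+x\<in>chart_map c ` B. ennreal (sqrt (det (G c x))) \<partial>lborel))"

definition normalized_riemannian_volume ::
    "('a::topological_space, 'n::finite) chart set \<Rightarrow> ('a, 'n) metric \<Rightarrow> 'a measure \<Rightarrow> bool" where
  "normalized_riemannian_volume A G \<nu> \<longleftrightarrow>
     (\<exists>vol. riemannian_volume A G vol \<and> \<nu> = uniform_measure vol UNIV)"

definition smooth_functions :: "('a, 'n::finite) chart set \<Rightarrow> ('a \<Rightarrow> real) set" where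
  "smooth_functions A = {u. \<forall>c\<in>A. smooth_on (chart_image c) (u \<circ> chart_inv c)}"


section \<open>Real square-integrable functions\<close>

text \<open>
  Elements of \<open>L\<^sup>2\<close> are represented by functions; two of them represent the same element if they
  agree almost everywhere, and all notions below respect this identification. In particular,
  linear independence is modulo null functions.
\<close>

definition L2_space :: "'a measure \<Rightarrow> ('a \<Rightarrow> real) set" where
  "L2_space M = {f \<in> borel_measurable M. integrable M (\<lambda>x. (f x)\<^sup>2)}"

definition L2_inner :: "'a measure \<Rightarrow> ('a \<Rightarrow> real) \<Rightarrow> ('a \<Rightarrow> real) \<Rightarrow> real" where
  "L2_inner M f g = (LINT x|M. f x * g x)"

definition L2_norm :: "'a measure \<Rightarrow> ('a \<Rightarrow> real) \<Rightarrow> real" where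
  "L2_norm M f = sqrt (L2_inner M f f)"

definition L2_independent :: "'a measure \<Rightarrow> ('a \<Rightarrow> real) set \<Rightarrow> bool" where
  "L2_independent M B \<longleftrightarrow>
     (\<forall>a. (AE x in M. (\<Sum>b\<in>B. a b * b x) = 0) \<longrightarrow> (\<forall>b\<in>B. a b = 0))"

definition L2_dim :: "'a measure \<Rightarrow> ('a \<Rightarrow> real) set \<Rightarrow> enat" where
  "L2_dim M E = (SUP B\<in>{B. finite B \<and> B \<subseteq> E \<and> L2_independent M B}. enat (card B))"

text \<open>Orthogonal projection onto a subspace; determined almost everywhere.\<close>

definition L2_proj :: "'a measure \<Rightarrow> ('a \<Rightarrow> real) set \<Rightarrow> ('a \<Rightarrow> real) \<Rightarrow> ('a \<Rightarrow> real)" where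
  "L2_proj M E f = (SOME g. g \<in> E \<and> (\<forall>h\<in>E. L2_inner M (\<lambda>x. f x - g x) h = 0))"


section \<open>The Laplace--Beltrami operator\<close>

text \<open>\<open>\<Delta> u = (det G)\<^bsup>-1/2\<^esup> \<Sum>\<^sub>i \<partial>\<^sub>i ((det G)\<^bsup>1/2\<^esup> \<Sum>\<^sub>j G\<^bsup>ij\<^esup> \<partial>\<^sub>j u)\<close> for a function \<open>u\<close> of the coordinates.\<close>

definition laplace_coord ::
    "(real^'n \<Rightarrow> real^'n^'n) \<Rightarrow> (real^'n \<Rightarrow> real) \<Rightarrow> real^'n \<Rightarrow> real" where
  "laplace_coord g u x =
     (\<Sum>i\<in>UNIV. partial_deriv i
        (\<lambda>y. sqrt (det (g y)) * (\<Sum>j\<in>UNIV. matrix_inv (g y) $ i $ j * partial_deriv j u y)) x)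
     / sqrt (det (g x))"

text \<open>For smooth \<open>u\<close>, the value does not depend on the chart chosen around \<open>p\<close>.\<close>

definition laplace_beltrami ::
    "('a, 'n::finite) chart set \<Rightarrow> ('a, 'n) metric \<Rightarrow> ('a \<Rightarrow> real) \<Rightarrow> 'a \<Rightarrow> real" where
  "laplace_beltrami A G u p =
     (let c = (SOME c. c \<in> A \<and> p \<in> chart_dom c)
      in laplace_coord (G c) (u \<circ> chart_inv c) (chart_map c p))"

text \<open>
  The nonnegative self-adjoint operator \<open>L = -\<Delta>\<close> on \<open>L\<^sup>2\<close>, as a graph: the Friedrichs extension of
  \<open>-\<Delta>\<close> on smooth functions. Thus \<open>u\<close> must lie in the form domain, i.e.\ be an \<open>L\<^sup>2\<close>-limit of smooth
  functions \<open>w n\<close> that are Cauchy for the form \<open>\<langle>w, -\<Delta> w\<rangle>\<close>, and \<open>-\<Delta> u = h\<close> must hold when tested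
  against smooth functions. On a compact manifold \<open>-\<Delta>\<close> is essentially self-adjoint on smooth
  functions, so this is its only self-adjoint extension.
\<close>

definition laplace_graph ::
    "('a, 'n::finite) chart set \<Rightarrow> ('a, 'n) metric \<Rightarrow> 'a measure \<Rightarrow> ('a \<Rightarrow> real) \<Rightarrow> ('a \<Rightarrow> real) \<Rightarrow> bool"
  where
  "laplace_graph A G \<nu> u h \<longleftrightarrow> u \<in> L2_space \<nu> \<and> h \<in> L2_space \<nu> \<and>
     (\<exists>w. (\<forall>n::nat. w n \<in> smooth_functions A) \<and>
        (\<lambda>n. L2_norm \<nu> (\<lambda>x. w n x - u x)) \<longlonglongrightarrow> 0 \<and>
        (\<forall>e>0. \<exists>N. \<forall>m\<ge>N. \<forall>n\<ge>N.
           L2_inner \<nu> (\<lambda>x. w m x - w n x)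
             (\<lambda>x. - laplace_beltrami A G (\<lambda>y. w m y - w n y) x) < e)) \<and>
     (\<forall>v\<in>smooth_functions A.
        L2_inner \<nu> u (\<lambda>x. - laplace_beltrami A G v x) = L2_inner \<nu> h v)"

definition laplace_eigenspace ::
    "('a, 'n::finite) chart set \<Rightarrow> ('a, 'n) metric \<Rightarrow> 'a measure \<Rightarrow> real \<Rightarrow> ('a \<Rightarrow> real) set" where
  "laplace_eigenspace A G \<nu> l = {u. laplace_graph A G \<nu> u (\<lambda>x. l * u x)}"

definition laplace_eigenvalue ::
    "('a, 'n::finite) chart set \<Rightarrow> ('a, 'n) metric \<Rightarrow> 'a measure \<Rightarrow> real \<Rightarrow> bool" where
  "laplace_eigenvalue A G \<nu> l \<longleftrightarrow> (\<exists>u\<in>laplace_eigenspace A G \<nu> l. L2_norm \<nu> u \<noteq> 0)"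

text \<open>\<open>0 = \<mu> 0 < \<mu> 1 < \<dots>\<close> are the distinct eigenvalues.\<close>

definition laplace_eigenvalues ::
    "('a, 'n::finite) chart set \<Rightarrow> ('a, 'n) metric \<Rightarrow> 'a measure \<Rightarrow> (nat \<Rightarrow> real) \<Rightarrow> bool" where
  "laplace_eigenvalues A G \<nu> \<mu> \<longleftrightarrow>
     \<mu> 0 = 0 \<and> strict_mono \<mu> \<and> range \<mu> = Collect (laplace_eigenvalue A G \<nu>)"


section \<open>Spectral spaces and truncation\<close>

definition eig_proj ::
    "('a, 'n::finite) chart set \<Rightarrow> ('a, 'n) metric \<Rightarrow> 'a measure \<Rightarrow> (nat \<Rightarrow> real) \<Rightarrow>
      nat \<Rightarrow> ('a \<Rightarrow> real) \<Rightarrow> ('a \<Rightarrow> real)" where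
  "eig_proj A G \<nu> \<mu> j = L2_proj \<nu> (laplace_eigenspace A G \<nu> (\<mu> j))"

definition spec_norm ::
    "('a, 'n::finite) chart set \<Rightarrow> ('a, 'n) metric \<Rightarrow> 'a measure \<Rightarrow> (nat \<Rightarrow> real) \<Rightarrow>
      real \<Rightarrow> ('a \<Rightarrow> real) \<Rightarrow> ennreal" where
  "spec_norm A G \<nu> \<mu> s f =
     (\<Sum>j. ennreal ((1 + \<mu> j) powr (s / 2) * L2_norm \<nu> (eig_proj A G \<nu> \<mu> j f)))"

definition spec_space ::
    "('a, 'n::finite) chart set \<Rightarrow> ('a, 'n) metric \<Rightarrow> 'a measure \<Rightarrow> (nat \<Rightarrow> real) \<Rightarrow>
      real \<Rightarrow> ('a \<Rightarrow> real) set" where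
  "spec_space A G \<nu> \<mu> s = {f \<in> L2_space \<nu>. spec_norm A G \<nu> \<mu> s f < \<infinity>}"

text \<open>
  The index set \<open>{j. \<mu> j \<le> \<Lambda>}\<close> in the next two sums is finite, since the Laplacian of a compact
  manifold has discrete spectrum.
\<close>

definition spec_trunc ::
    "('a, 'n::finite) chart set \<Rightarrow> ('a, 'n) metric \<Rightarrow> 'a measure \<Rightarrow> (nat \<Rightarrow> real) \<Rightarrow>
      real \<Rightarrow> ('a \<Rightarrow> real) \<Rightarrow> ('a \<Rightarrow> real)" where
  "spec_trunc A G \<nu> \<mu> \<Lambda> f = (\<lambda>x. \<Sum>j | \<mu> j \<le> \<Lambda>. eig_proj A G \<nu> \<mu> j f x)"

definition spec_count ::
    "('a, 'n::finite) chart set \<Rightarrow> ('a, 'n) metric \<Rightarrow> 'a measure \<Rightarrow> (nat \<Rightarrow> real) \<Rightarrow> real \<Rightarrow> enat"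
  where
  "spec_count A G \<nu> \<mu> \<Lambda> = (\<Sum>j | \<mu> j \<le> \<Lambda>. L2_dim \<nu> (laplace_eigenspace A G \<nu> (\<mu> j)))"

end

theory Submission
  imports Defs "HOL-Library.Function_Algebras"
begin

text \<open>
  If the eigenfunctions of \<open>L\<close> span a dense subspace of \<open>L\<^sup>2\<close>, then \<open>f\<close> is the sum of its
  projections \<open>P\<^sub>j f\<close>, and the triangle inequality bounds the truncation error by
  \<open>\<Sum> \<parallel>P\<^sub>j f\<parallel>\<close> over \<open>\<mu>\<^sub>j > \<Lambda>\<close>. There \<open>1 \<le> (1 + \<Lambda>)\<^bsup>-s/2\<^esup> (1 + \<mu>\<^sub>j)\<^bsup>s/2\<^esup>\<close>, which gives the error bound;
  the squared bound and the choice of \<open>\<Lambda>\<^sub>\<epsilon>\<close> are arithmetic, and the dimension of the truncated space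
  is at most the sum of the dimensions of the eigenspaces involved. The substance is the spectral
  theorem: eigenfunctions are complete, and below any \<open>\<Lambda>\<close> there are finitely many eigenvalues with
  finite-dimensional eigenspaces.

  The spectral theorem holds for the Friedrichs extension of any nonnegative symmetric operator
  whose form domain is compactly embedded. Here compactness is the statement that for every \<open>\<epsilon> > 0\<close>
  there are finitely many \<open>\<phi>\<close> with
  \<open>\<langle>v, v\<rangle> \<le> \<epsilon> \<langle>v, L v\<rangle> + \<Sum> \<langle>\<phi>, v\<rangle>\<^sup>2\<close> on the domain (locale \<open>form_operator\<close>). The resolvent \<open>(1 + L)\<^sup>-\<^sup>1\<close>
  comes from minimizing \<open>\<langle>v, L v\<rangle> + \<langle>v, v\<rangle> - 2 \<langle>f, v\<rangle>\<close> (\<open>resolvent_exists\<close>) and maps bounded sequences to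
  precompact ones (\<open>graph_precompact\<close>). On the orthogonal complement of the eigenvectors it would have a
  further eigenvector, unless the complement is null (\<open>eigenvectors_complete\<close>). Compactness and Bessel's
  inequality together bound the number of orthonormal eigenvectors with eigenvalue at most \<open>\<Lambda>\<close>
  (\<open>orthonormal_eigenvectors_bound\<close>).

  For the Laplacian on smooth functions the assumptions of that locale are verified as follows.
  Symmetry and nonnegativity are Green's formula \<open>\<langle>v, -\<Delta> w\<rangle> = \<integral> \<langle>\<nabla>v, \<nabla>w\<rangle>\<close> (\<open>green_formula\<close>), obtained in
  charts by integration by parts and globally by a partition of unity. The domain is dense because
  a function orthogonal to all bumps in a chart integrates to zero over all boxes
  (\<open>orthogonal_smooth_AE_0\<close>). Compactness is the Poincare inequality on the pieces of a fine
  subdivision of finitely many coordinate boxes: up to the mean values on the pieces, which are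
  finitely many functionals, \<open>\<integral> v\<^sup>2\<close> is a small multiple of \<open>\<integral> |\<nabla>v|\<^sup>2\<close> (\<open>smooth_compactness\<close>).
\<close>

section \<open>Semi-inner products\<close>

text \<open>
  Functions that agree almost everywhere are not identified, so \<open>L\<^sup>2\<close> carries only a semi-inner product:
  non-zero vectors may have norm zero. The carrier is an explicit subspace because not all functions
  are square-integrable.
\<close>

locale semi_inner =
  fixes H :: "'v::real_vector set" and ip :: "'v \<Rightarrow> 'v \<Rightarrow> real"
  assumes subspace_H: "subspace H"
    and ip_add: "x \<in> H \<Longrightarrow> y \<in> H \<Longrightarrow> z \<in> H \<Longrightarrow> ip (x + y) z = ip x z + ip y z"
    and ip_scale: "x \<in> H \<Longrightarrow> y \<in> H \<Longrightarrow> ip (c *\<^sub>R x) y = c * ip x y"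
    and ip_sym: "x \<in> H \<Longrightarrow> y \<in> H \<Longrightarrow> ip x y = ip y x"
    and ip_nonneg: "x \<in> H \<Longrightarrow> 0 \<le> ip x x"
begin

definition nrm :: "'v \<Rightarrow> real" where
  "nrm x = sqrt (ip x x)"

lemma H_closed [simp]:
  "0 \<in> H" "x \<in> H \<Longrightarrow> y \<in> H \<Longrightarrow> x + y \<in> H" "x \<in> H \<Longrightarrow> y \<in> H \<Longrightarrow> x - y \<in> H"
  "x \<in> H \<Longrightarrow> c *\<^sub>R x \<in> H" "(\<And>i. i \<in> I \<Longrightarrow> f i \<in> H) \<Longrightarrow> (\<Sum>i\<in>I. f i) \<in> H"
  using subspace_H by (auto intro: subspace_0 subspace_add subspace_diff subspace_scale subspace_sum)

lemma ip_add_right: "x \<in> H \<Longrightarrow> y \<in> H \<Longrightarrow> z \<in> H \<Longrightarrow> ip z (x + y) = ip z x + ip z y"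
  using ip_add[of x y z] by (simp add: ip_sym)

lemma ip_scale_right: "x \<in> H \<Longrightarrow> y \<in> H \<Longrightarrow> ip x (c *\<^sub>R y) = c * ip x y"
  using ip_scale[of y x c] by (simp add: ip_sym)

lemma ip_diff: "x \<in> H \<Longrightarrow> y \<in> H \<Longrightarrow> z \<in> H \<Longrightarrow> ip (x - y) z = ip x z - ip y z"
  using ip_add[of x "(-1) *\<^sub>R y" z] ip_scale[of y z "-1"] subspace_scale[OF subspace_H, of y "-1"] by simp

lemma ip_diff_right: "x \<in> H \<Longrightarrow> y \<in> H \<Longrightarrow> z \<in> H \<Longrightarrow> ip z (x - y) = ip z x - ip z y"
  using ip_diff[of x y z] by (simp add: ip_sym)

lemma ip_zero [simp]: "x \<in> H \<Longrightarrow> ip 0 x = 0" "x \<in> H \<Longrightarrow> ip x 0 = 0"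
  using ip_scale[of 0 x 0] ip_scale_right[of x 0 0] by auto

lemma ip_sum: "(\<And>i. i \<in> I \<Longrightarrow> f i \<in> H) \<Longrightarrow> z \<in> H \<Longrightarrow> ip (\<Sum>i\<in>I. f i) z = (\<Sum>i\<in>I. ip (f i) z)"
  by (induction I rule: infinite_finite_induct) (auto simp: ip_add)

lemmas ip_simps = ip_add ip_add_right ip_diff ip_diff_right ip_scale ip_scale_right

lemma nrm_sq: "x \<in> H \<Longrightarrow> (nrm x)\<^sup>2 = ip x x"
  by (simp add: nrm_def ip_nonneg)

lemma nrm_nonneg [simp]: "x \<in> H \<Longrightarrow> 0 \<le> nrm x"
  by (simp add: nrm_def ip_nonneg)

lemma cauchy_schwarz_sq:
  assumes "x \<in> H" "y \<in> H"
  shows "(ip x y)\<^sup>2 \<le> ip x x * ip y y"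
proof -
  \<comment> \<open>the usual discriminant argument; if \<open>y\<close> is null, the polynomial is affine and nonnegative, hence constant\<close>
  have *: "0 \<le> ip x x + 2 * t * ip x y + t\<^sup>2 * ip y y" for t
    using ip_nonneg[of "x + t *\<^sub>R y"] assms
    by (simp add: ip_simps ip_sym[of y x] power2_eq_square algebra_simps)
  show ?thesis
  proof (cases "ip y y = 0")
    case True
    have "ip x y = 0"
    proof (rule ccontr)
      assume n: "ip x y \<noteq> 0"
      have "2 * ((- ip x x - 1) / (2 * ip x y)) * ip x y = - ip x x - 1"
        using n by simp
      then show False using *[of "(- ip x x - 1) / (2 * ip x y)"] True by simp
    qed
    then show ?thesis using True by simp
  next
    case False
    then have pos: "ip y y > 0" using ip_nonneg[OF assms(2)] by simp
    have "0 \<le> ip x x + 2 * (- ip x y / ip y y) * ip x y + (- ip x y / ip y y)\<^sup>2 * ip y y"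
      by (rule *)
    also have "\<dots> = ip x x - (ip x y)\<^sup>2 / ip y y"
      using pos by (simp add: field_simps power2_eq_square)
    finally show ?thesis using pos by (simp add: field_simps)
  qed
qed

lemma cauchy_schwarz:
  assumes "x \<in> H" "y \<in> H"
  shows "\<bar>ip x y\<bar> \<le> nrm x * nrm y"
  using real_sqrt_le_mono[OF cauchy_schwarz_sq[OF assms]]
  by (simp add: nrm_def real_sqrt_mult)

lemma nrm_triangle:
  assumes "x \<in> H" "y \<in> H"
  shows "nrm (x + y) \<le> nrm x + nrm y"
proof (rule power2_le_imp_le)
  have "(nrm (x + y))\<^sup>2 = ip x x + 2 * ip x y + ip y y"
    using assms by (simp add: nrm_sq ip_simps ip_sym[of y x])
  also have "\<dots> \<le> (nrm x)\<^sup>2 + 2 * (nrm x * nrm y) + (nrm y)\<^sup>2"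
    using cauchy_schwarz[OF assms] by (simp add: nrm_sq assms)
  finally show "(nrm (x + y))\<^sup>2 \<le> (nrm x + nrm y)\<^sup>2"
    by (simp add: power2_sum algebra_simps)
qed (use assms in simp)

lemma nrm_scale: "x \<in> H \<Longrightarrow> nrm (c *\<^sub>R x) = \<bar>c\<bar> * nrm x"
  by (simp add: nrm_def ip_simps real_sqrt_mult flip: mult.assoc power2_eq_square)

lemma nrm_minus_commute: "x \<in> H \<Longrightarrow> y \<in> H \<Longrightarrow> nrm (x - y) = nrm (y - x)"
  by (simp add: nrm_def ip_simps)

lemma nrm_zero [simp]: "nrm 0 = 0"
  by (simp add: nrm_def)

lemma nrm_sum_le: "(\<And>i. i \<in> I \<Longrightarrow> f i \<in> H) \<Longrightarrow> nrm (\<Sum>i\<in>I. f i) \<le> (\<Sum>i\<in>I. nrm (f i))"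
proof (induction I rule: infinite_finite_induct)
  case (insert i I)
  then show ?case using nrm_triangle[of "f i" "\<Sum>i\<in>I. f i"] by fastforce
qed auto

lemma nrm_triangle_diff:
  assumes "x \<in> H" "y \<in> H" "z \<in> H"
  shows "nrm (x - z) \<le> nrm (x - y) + nrm (y - z)"
  using nrm_triangle[of "x - y" "y - z"] assms by simp

lemma nrm_eq_0_iff: "x \<in> H \<Longrightarrow> nrm x = 0 \<longleftrightarrow> ip x x = 0"
  by (simp add: nrm_def)

lemma ip_null: "x \<in> H \<Longrightarrow> y \<in> H \<Longrightarrow> nrm x = 0 \<Longrightarrow> ip x y = 0"
  using cauchy_schwarz[of x y] by simp

lemma ip_tendsto:
  assumes "\<And>n. x n \<in> H" "y \<in> H" "z \<in> H" "(\<lambda>n. nrm (x n - y)) \<longlonglongrightarrow> 0"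
  shows "(\<lambda>n. ip (x n) z) \<longlonglongrightarrow> ip y z"
proof -
  have "(\<lambda>n. nrm (x n - y) * nrm z) \<longlonglongrightarrow> 0"
    using tendsto_mult[OF assms(4) tendsto_const[of "nrm z"]] by simp
  moreover have "\<forall>n. norm (ip (x n) z - ip y z) \<le> nrm (x n - y) * nrm z"
    using cauchy_schwarz[of "x _ - y" z] assms by (auto simp: ip_simps)
  ultimately have "(\<lambda>n. ip (x n) z - ip y z) \<longlonglongrightarrow> 0"
    by (rule Lim_null_comparison[OF always_eventually, rotated])
  then show ?thesis by (simp add: LIM_zero_iff)
qed

lemma ip_tendsto_right:
  assumes "\<And>n. x n \<in> H" "y \<in> H" "z \<in> H" "(\<lambda>n. nrm (x n - y)) \<longlonglongrightarrow> 0"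
  shows "(\<lambda>n. ip z (x n)) \<longlonglongrightarrow> ip z y"
  using ip_tendsto[OF assms] assms(1-3) by (simp add: ip_sym)

lemma nrm_tendsto:
  assumes "\<And>n. x n \<in> H" "y \<in> H" "(\<lambda>n. nrm (x n - y)) \<longlonglongrightarrow> 0"
  shows "(\<lambda>n. nrm (x n)) \<longlonglongrightarrow> nrm y"
proof -
  have "norm (nrm (x n) - nrm y) \<le> nrm (x n - y)" for n
    using nrm_triangle_diff[of "x n" y 0] nrm_triangle_diff[of y "x n" 0] assms(1,2)
      nrm_minus_commute[of "x n" y] by (auto simp: abs_le_iff)
  then have "(\<lambda>n. nrm (x n) - nrm y) \<longlonglongrightarrow> 0"
    by (intro Lim_null_comparison[OF _ assms(3)] always_eventually) auto
  then show ?thesis by (simp add: LIM_zero_iff)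
qed

definition orthonormal :: "'v set \<Rightarrow> bool" where
  "orthonormal B \<longleftrightarrow> (\<forall>b\<in>B. \<forall>c\<in>B. ip b c = (if b = c then 1 else 0))"

text \<open>
  The difference between \<open>x\<close> and its expansion \<open>y\<close> has nonnegative square, and \<open>\<langle>y, y\<rangle> = \<langle>y, x\<rangle>\<close>.
\<close>

lemma bessel:
  assumes "finite B" "B \<subseteq> H" "orthonormal B" "x \<in> H"
  shows "(\<Sum>b\<in>B. (ip x b)\<^sup>2) \<le> ip x x"
proof -
  define y where "y = (\<Sum>b\<in>B. ip x b *\<^sub>R b)"
  have y: "y \<in> H" using assms(2) by (auto simp: y_def intro!: H_closed(4,5))
  have yz: "ip y z = (\<Sum>b\<in>B. ip x b * ip b z)" if "z \<in> H" for z
  proof -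
    have "ip y z = (\<Sum>b\<in>B. ip (ip x b *\<^sub>R b) z)"
      unfolding y_def by (rule ip_sum) (use assms(2) that in auto)
    also have "\<dots> = (\<Sum>b\<in>B. ip x b * ip b z)"
      by (rule sum.cong) (use assms(2) that in \<open>auto simp: ip_scale\<close>)
    finally show ?thesis .
  qed
  have xy: "ip y x = (\<Sum>b\<in>B. (ip x b)\<^sup>2)"
    unfolding yz[OF assms(4)] power2_eq_square
    by (rule sum.cong) (use assms(2,4) ip_sym in auto)
  have yb: "ip y b = ip x b" if "b \<in> B" for b
  proof -
    have "ip y b = (\<Sum>c\<in>B. if c = b then ip x b else 0)"
      using that assms(2,3) by (subst yz) (auto intro!: sum.cong simp: orthonormal_def)
    then show ?thesis using that assms(1) by simp
  qed
  have "ip y y = (\<Sum>b\<in>B. (ip x b)\<^sup>2)"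
    unfolding yz[OF y] power2_eq_square
  proof (rule sum.cong)
    fix b assume b: "b \<in> B"
    then have "ip b y = ip x b" using yb[OF b] ip_sym[of b y] assms(2) y by auto
    then show "ip x b * ip b y = ip x b * ip x b" by simp
  qed simp
  then show ?thesis
    using ip_nonneg[of "x - y"] xy y assms(4) by (simp add: ip_simps ip_sym[of x y])
qed

end

text \<open>
  A diagonal argument in the form of the sequential compactness of a countable product of compact intervals.
\<close>

lemma convergent_subsequence_coordinatewise:
  fixes X :: "nat \<Rightarrow> nat \<Rightarrow> real"
  assumes "\<And>n i. \<bar>X n i\<bar> \<le> b i"
  obtains r :: "nat \<Rightarrow> nat" where "strict_mono r" "\<And>i. convergent (\<lambda>n. X (r n) i)"
proof -
  let ?S = "PiE UNIV (\<lambda>i. {- b i .. b i})"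
  have "compactin (product_topology (\<lambda>i. euclidean) UNIV) ?S"
    by (subst compactin_PiE) auto
  then have "compact ?S"
    by (simp add: euclidean_product_topology)
  then have "seq_compact ?S"
    by (rule compact_imp_seq_compact)
  moreover have "\<forall>n. X n \<in> ?S"
    using assms by (auto simp: abs_le_iff) (smt (verit) assms)
  ultimately obtain l r where lr: "strict_mono r" "(X \<circ> r) \<longlonglongrightarrow> l"
    by (rule seq_compactE)
  have "(\<lambda>n. X (r n) i) \<longlonglongrightarrow> l i" for i
    using continuous_on_tendsto_compose[OF continuous_on_product_coordinates[of i] lr(2)] by (simp add: o_def)
  then show ?thesis
    using that lr(1) unfolding convergent_def by blast
qed

section \<open>The Friedrichs extension of a nonnegative symmetric operator\<close>

text \<open>
  \<open>D\<close> is a domain on which the symmetric operator \<open>L\<close> is explicitly given, such as the smooth functions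
  for the Laplacian. The assumption \<open>compact_D\<close> expresses, without mentioning a completion of \<open>D\<close>, that
  the form domain is compactly embedded in \<open>H\<close>: outside finitely many directions, the norm is
  arbitrarily small compared to the form.
\<close>

locale form_operator = semi_inner H ip
  for H :: "'v::real_vector set" and ip :: "'v \<Rightarrow> 'v \<Rightarrow> real" +
  fixes D :: "'v set" and L :: "'v \<Rightarrow> 'v"
  assumes subspace_D: "subspace D" and D_H: "D \<subseteq> H"
    and L_H: "v \<in> D \<Longrightarrow> L v \<in> H"
    and L_add: "u \<in> D \<Longrightarrow> v \<in> D \<Longrightarrow> L (u + v) = L u + L v"
    and L_scale: "v \<in> D \<Longrightarrow> L (c *\<^sub>R v) = c *\<^sub>R L v"
    and L_sym: "u \<in> D \<Longrightarrow> v \<in> D \<Longrightarrow> ip u (L v) = ip v (L u)"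
    and L_nonneg: "v \<in> D \<Longrightarrow> 0 \<le> ip v (L v)"
    and complete_H: "(\<And>n. x n \<in> H) \<Longrightarrow> (\<And>e. e > 0 \<Longrightarrow> \<exists>N. \<forall>m\<ge>N. \<forall>n\<ge>N. nrm (x m - x n) < e)
      \<Longrightarrow> \<exists>y\<in>H. (\<lambda>n. nrm (x n - y)) \<longlonglongrightarrow> 0"
    and dense_D: "f \<in> H \<Longrightarrow> (\<And>v. v \<in> D \<Longrightarrow> ip f v = 0) \<Longrightarrow> ip f f = 0"
    and compact_D: "\<epsilon> > 0 \<Longrightarrow> \<exists>\<Phi>. finite \<Phi> \<and> \<Phi> \<subseteq> H \<and>
      (\<forall>v\<in>D. ip v v \<le> \<epsilon> * ip v (L v) + (\<Sum>\<phi>\<in>\<Phi>. (ip \<phi> v)\<^sup>2))"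
begin

lemma D_closed [simp]:
  "0 \<in> D" "x \<in> D \<Longrightarrow> y \<in> D \<Longrightarrow> x + y \<in> D" "x \<in> D \<Longrightarrow> y \<in> D \<Longrightarrow> x - y \<in> D"
  "x \<in> D \<Longrightarrow> c *\<^sub>R x \<in> D"
  using subspace_D by (auto intro: subspace_0 subspace_add subspace_diff subspace_scale)

lemma DH [simp]: "x \<in> D \<Longrightarrow> x \<in> H"
  using D_H by auto

declare L_H [simp]

lemma L_diff: "u \<in> D \<Longrightarrow> v \<in> D \<Longrightarrow> L (u - v) = L u - L v"
  using L_add[of u "(-1) *\<^sub>R v"] L_scale[of v "-1"] subspace_scale[OF subspace_D, of v "-1"] by simp

sublocale form: semi_inner D "\<lambda>u v. ip u (L v)"
proof
  show "subspace D" by (rule subspace_D)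
  show "ip (x + y) (L z) = ip x (L z) + ip y (L z)" if "x \<in> D" "y \<in> D" "z \<in> D" for x y z
    using that by (simp add: ip_add)
  show "ip (c *\<^sub>R x) (L y) = c * ip x (L y)" if "x \<in> D" "y \<in> D" for x y c
    using that by (simp add: ip_scale)
qed (auto simp: L_sym L_nonneg)

text \<open>
  \<open>graph u h\<close> says that \<open>u\<close> belongs to the domain of the Friedrichs extension, which sends it to \<open>h\<close>:
  \<open>u\<close> is a limit of vectors of \<open>D\<close> that are Cauchy for the form, and \<open>h\<close> is the weak image of \<open>u\<close>. It is a
  relation because \<open>h\<close> is determined only up to null vectors.
\<close>

definition graph :: "'v \<Rightarrow> 'v \<Rightarrow> bool" where
  "graph u h \<longleftrightarrow> u \<in> H \<and> h \<in> H \<and>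
     (\<exists>w. (\<forall>n::nat. w n \<in> D) \<and> (\<lambda>n. nrm (w n - u)) \<longlonglongrightarrow> 0 \<and>
        (\<forall>e>0. \<exists>N. \<forall>m\<ge>N. \<forall>n\<ge>N. ip (w m - w n) (L (w m - w n)) < e)) \<and>
     (\<forall>v\<in>D. ip u (L v) = ip h v)"

lemma graph_H [simp]: "graph u h \<Longrightarrow> u \<in> H" "graph u h \<Longrightarrow> h \<in> H"
  unfolding graph_def by blast+

lemma graph_test: "graph u h \<Longrightarrow> v \<in> D \<Longrightarrow> ip u (L v) = ip h v"
  unfolding graph_def by blast+

lemma graph_null_cong:
  assumes "graph u h" "h' \<in> H" "nrm (h - h') = 0"
  shows "graph u h'"
proof -
  have "ip h v = ip h' v" if "v \<in> D" for v
    using ip_null[of "h - h'" v] assms that by (simp add: ip_simps)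
  then have "\<forall>v\<in>D. ip u (L v) = ip h' v"
    using graph_test[OF assms(1)] by metis
  then show ?thesis using assms(1,2) unfolding graph_def by blast
qed

lemma graph_zero: "graph 0 0"
  unfolding graph_def by (auto intro!: exI[of _ "\<lambda>_. 0"])

lemma graph_scale:
  assumes "graph u h" shows "graph (c *\<^sub>R u) (c *\<^sub>R h)"
proof (cases "c = 0")
  case True then show ?thesis by (simp add: graph_zero)
next
  case False
  obtain w where w: "\<And>n::nat. w n \<in> D" "(\<lambda>n. nrm (w n - u)) \<longlonglongrightarrow> 0"
    and c: "\<And>e. e>0 \<Longrightarrow> \<exists>N. \<forall>m\<ge>N. \<forall>n\<ge>N. ip (w m - w n) (L (w m - w n)) < e"
    using assms unfolding graph_def by auto
  have u: "u \<in> H" "h \<in> H" using assms by auto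
  have "(\<lambda>n. \<bar>c\<bar> * nrm (w n - u)) \<longlonglongrightarrow> 0"
    using tendsto_mult[OF tendsto_const w(2)] by simp
  then have 1: "(\<lambda>n. nrm (c *\<^sub>R w n - c *\<^sub>R u)) \<longlonglongrightarrow> 0"
    using w(1) u by (simp flip: scaleR_diff_right add: nrm_scale)
  have 2: "\<exists>N. \<forall>m\<ge>N. \<forall>n\<ge>N. ip (c *\<^sub>R w m - c *\<^sub>R w n) (L (c *\<^sub>R w m - c *\<^sub>R w n)) < e" if e: "e > 0" for e
  proof -
    have "ip (c *\<^sub>R w m - c *\<^sub>R w n) (L (c *\<^sub>R w m - c *\<^sub>R w n)) = c\<^sup>2 * ip (w m - w n) (L (w m - w n))" for m n
      using w(1) by (simp flip: scaleR_diff_right add: L_scale ip_simps power2_eq_square)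
    then show ?thesis using c[of "e / c\<^sup>2"] e False by (simp add: field_simps)
  qed
  show ?thesis
    unfolding graph_def
  proof (intro conjI exI[of _ "\<lambda>n. c *\<^sub>R w n"] allI impI 1 2 ballI)
    show "ip (c *\<^sub>R u) (L v) = ip (c *\<^sub>R h) v" if "v \<in> D" for v
      using that u graph_test[OF assms that] by (simp add: ip_scale)
  qed (use u w(1) in auto)
qed

lemma graph_add:
  assumes "graph u h" "graph u' h'" shows "graph (u + u') (h + h')"
proof -
  obtain w where w: "\<And>n::nat. w n \<in> D" "(\<lambda>n. nrm (w n - u)) \<longlonglongrightarrow> 0"
    and c: "\<And>e. e>0 \<Longrightarrow> \<exists>N. \<forall>m\<ge>N. \<forall>n\<ge>N. ip (w m - w n) (L (w m - w n)) < e"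
    using assms(1) unfolding graph_def by auto
  obtain w' where w': "\<And>n::nat. w' n \<in> D" "(\<lambda>n. nrm (w' n - u')) \<longlonglongrightarrow> 0"
    and c': "\<And>e. e>0 \<Longrightarrow> \<exists>N. \<forall>m\<ge>N. \<forall>n\<ge>N. ip (w' m - w' n) (L (w' m - w' n)) < e"
    using assms(2) unfolding graph_def by auto
  have u: "u \<in> H" "h \<in> H" "u' \<in> H" "h' \<in> H" using assms by auto
  have 1: "(\<lambda>n. nrm ((w n + w' n) - (u + u'))) \<longlonglongrightarrow> 0"
  proof (rule Lim_null_comparison[OF _ tendsto_add_zero[OF w(2) w'(2)]], intro always_eventually allI)
    fix n
    show "norm (nrm ((w n + w' n) - (u + u'))) \<le> nrm (w n - u) + nrm (w' n - u')"
      using nrm_triangle[of "w n - u" "w' n - u'"] w(1) w'(1) u by (simp add: algebra_simps)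
  qed
  have 2: "\<exists>N. \<forall>m\<ge>N. \<forall>n\<ge>N. ip ((w m + w' m) - (w n + w' n)) (L ((w m + w' m) - (w n + w' n))) < e"
    if e: "e > 0" for e
  proof -
    obtain N where N: "\<forall>m\<ge>N. \<forall>n\<ge>N. ip (w m - w n) (L (w m - w n)) < e / 4"
      using c[of "e/4"] e by auto
    obtain N' where N': "\<forall>m\<ge>N'. \<forall>n\<ge>N'. ip (w' m - w' n) (L (w' m - w' n)) < e / 4"
      using c'[of "e/4"] e by auto
    show ?thesis
    proof (intro exI[of _ "max N N'"] allI impI)
      fix m n assume mn: "max N N' \<le> m" "max N N' \<le> n"
      have e: "(w m + w' m) - (w n + w' n) = (w m - w n) + (w' m - w' n)" by simp
      let ?x = "w m - w n" and ?y = "w' m - w' n"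
      have D: "?x \<in> D" "?y \<in> D" using w(1) w'(1) by auto
      have "0 \<le> ip (?x - ?y) (L (?x - ?y))"
        using D by (intro L_nonneg) auto
      then have "ip (?x + ?y) (L (?x + ?y)) \<le> 2 * ip ?x (L ?x) + 2 * ip ?y (L ?y)"
        using D by (simp add: L_add[OF D] L_diff[OF D] ip_simps)
      then show "ip ((w m + w' m) - (w n + w' n)) (L ((w m + w' m) - (w n + w' n))) < e"
        unfolding e using N[rule_format, of m n] N'[rule_format, of m n] mn by simp
    qed
  qed
  show ?thesis
    unfolding graph_def
  proof (intro conjI exI[of _ "\<lambda>n. w n + w' n"] allI impI 1 2 ballI)
    show "ip (u + u') (L v) = ip (h + h') v" if "v \<in> D" for v
      using that u graph_test[OF assms(1) that] graph_test[OF assms(2) that] by (simp add: ip_add)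
  qed (use u w(1) w'(1) in auto)
qed

lemma graph_diff:
  assumes "graph u h" "graph u' h'" shows "graph (u - u') (h - h')"
  using graph_add[OF assms(1) graph_scale[OF assms(2), of "-1"]] by simp

text \<open>
  The boundedness of the form along a Cauchy sequence is included because passing to the limit in the
  form needs it.
\<close>

definition form_approx :: "(nat \<Rightarrow> 'v) \<Rightarrow> 'v \<Rightarrow> bool" where
  "form_approx w u \<longleftrightarrow> (\<forall>n. w n \<in> D) \<and> (\<lambda>n. nrm (w n - u)) \<longlonglongrightarrow> 0 \<and>
     (\<forall>e>0. \<exists>N. \<forall>m\<ge>N. \<forall>n\<ge>N. form.nrm (w m - w n) < e) \<and> (\<exists>B. \<forall>n. form.nrm (w n) \<le> B)"

lemma graph_approx:
  assumes "graph u h"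
  shows "\<exists>w. form_approx w u"
proof -
  obtain w where w: "\<And>n::nat. w n \<in> D" "(\<lambda>n. nrm (w n - u)) \<longlonglongrightarrow> 0"
    and c: "\<And>e. e>0 \<Longrightarrow> \<exists>N. \<forall>m\<ge>N. \<forall>n\<ge>N. ip (w m - w n) (L (w m - w n)) < e"
    using assms(1) unfolding graph_def by auto
  have c': "\<exists>N. \<forall>m\<ge>N. \<forall>n\<ge>N. form.nrm (w m - w n) < e" if e: "e > 0" for e
  proof -
    have "form.nrm (w m - w n) < e" if "ip (w m - w n) (L (w m - w n)) < e\<^sup>2" for m n
      using real_sqrt_less_mono[OF that] e by (simp add: form.nrm_def)
    moreover obtain N where "\<forall>m\<ge>N. \<forall>n\<ge>N. ip (w m - w n) (L (w m - w n)) < e\<^sup>2"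
      using c[of "e\<^sup>2"] e by auto
    ultimately show ?thesis by blast
  qed
  obtain N where N: "\<forall>m\<ge>N. \<forall>n\<ge>N. form.nrm (w m - w n) < 1" using c'[of 1] by auto
  have "form.nrm (w n) \<le> Max ((\<lambda>n. form.nrm (w n)) ` {..N}) + 1" for n
  proof (cases "n \<le> N")
    case True
    then have "form.nrm (w n) \<le> Max ((\<lambda>n. form.nrm (w n)) ` {..N})" by (intro Max_ge) auto
    then show ?thesis by simp
  next
    case False
    have "form.nrm (w n) \<le> form.nrm (w n - w N) + form.nrm (w N)"
      using form.nrm_triangle_diff[of "w n" "w N" 0] w(1) by simp
    moreover have "form.nrm (w N) \<le> Max ((\<lambda>n. form.nrm (w n)) ` {..N})" by (intro Max_ge) auto
    moreover have "form.nrm (w n - w N) < 1" using N False by simp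
    ultimately show ?thesis by linarith
  qed
  then have "\<exists>B. \<forall>n. form.nrm (w n) \<le> B" by blast
  then show ?thesis
    unfolding form_approx_def by (intro exI[of _ w] conjI allI impI c' w)
qed

text \<open>
  \<open>\<langle>h, w' n\<rangle> - \<langle>w n, L (w' n)\<rangle>\<close> is the limit in \<open>m\<close> of the form between \<open>w m - w n\<close> and \<open>w' n\<close>, which by
  Cauchy--Schwarz for the form is small uniformly in \<open>m\<close>.
\<close>

lemma graph_form_limit:
  assumes g: "graph u h" and a: "form_approx w u" and a': "form_approx w' u'" and u': "u' \<in> H"
  shows "(\<lambda>n. ip (w n) (L (w' n))) \<longlonglongrightarrow> ip h u'"
proof -
  note w = a[unfolded form_approx_def] and w' = a'[unfolded form_approx_def]
  have D: "w n \<in> D" "w' n \<in> D" for n using w w' by auto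
  obtain B where B: "\<And>n. form.nrm (w' n) \<le> B" using w' by auto
  have B0: "0 \<le> B" using B[of 0] form.nrm_nonneg[OF D(2)[of 0]] by linarith
  have 1: "(\<lambda>n. ip h (w' n)) \<longlonglongrightarrow> ip h u'"
    using g u' D w' by (intro ip_tendsto_right) auto
  have "(\<lambda>n. ip h (w' n) - ip (w n) (L (w' n))) \<longlonglongrightarrow> 0"
  proof (rule LIMSEQ_I)
    fix r :: real assume r: "r > 0"
    obtain N where N: "\<And>m n. m \<ge> N \<Longrightarrow> n \<ge> N \<Longrightarrow> form.nrm (w m - w n) < r / (2 * (B + 1))"
      using w[THEN conjunct2, THEN conjunct2, THEN conjunct1, rule_format, of "r / (2 * (B + 1))"] r B0 by auto
    have "norm (ip h (w' n) - ip (w n) (L (w' n)) - 0) < r" if n: "n \<ge> N" for n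
    proof -
      have "(\<lambda>m. ip (w m - w n) (L (w' n))) \<longlonglongrightarrow> ip u (L (w' n)) - ip (w n) (L (w' n))"
        using tendsto_diff[OF ip_tendsto[of w u "L (w' n)"] tendsto_const] w g D by (simp add: ip_simps)
      then have lim: "(\<lambda>m. \<bar>ip (w m - w n) (L (w' n))\<bar>) \<longlonglongrightarrow> \<bar>ip h (w' n) - ip (w n) (L (w' n))\<bar>"
        using graph_test[OF g D(2)] by (intro tendsto_rabs) simp
      have "\<bar>ip (w m - w n) (L (w' n))\<bar> \<le> r / 2" if "m \<ge> N" for m
      proof -
        have "\<bar>ip (w m - w n) (L (w' n))\<bar> \<le> form.nrm (w m - w n) * form.nrm (w' n)"
          using D by (intro form.cauchy_schwarz) auto
        also have "\<dots> \<le> r / (2 * (B + 1)) * B"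
          using N[OF that n] B[of n] B0 r D by (intro mult_mono) auto
        also have "\<dots> \<le> r / 2" using B0 r by (simp add: field_simps)
        finally show ?thesis .
      qed
      then have "\<bar>ip h (w' n) - ip (w n) (L (w' n))\<bar> \<le> r / 2"
        by (intro tendsto_upperbound[OF lim]) (auto simp: eventually_at_top_linorder)
      then show ?thesis using r by simp
    qed
    then show "\<exists>no. \<forall>n\<ge>no. norm (ip h (w' n) - ip (w n) (L (w' n)) - 0) < r" by blast
  qed
  from tendsto_diff[OF 1 this] show ?thesis by simp
qed

text \<open>
  The symmetry of \<open>L\<close> on \<open>D\<close> passes to the extension because both sides are limits of the form.
\<close>

lemma graph_sym:
  assumes "graph u h" "graph u' h'"
  shows "ip h u' = ip h' u"
proof -
  obtain w where w: "form_approx w u" using graph_approx[OF assms(1)] by blast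
  have wD: "w n \<in> D" for n using w by (simp add: form_approx_def)
  obtain w' where w': "form_approx w' u'" using graph_approx[OF assms(2)] by blast
  have w'D: "w' n \<in> D" for n using w' by (simp add: form_approx_def)
  have "(\<lambda>n. ip (w n) (L (w' n))) \<longlonglongrightarrow> ip h u'"
    using assms by (intro graph_form_limit[OF assms(1) w w']) auto
  moreover have "(\<lambda>n. ip (w' n) (L (w n))) \<longlonglongrightarrow> ip h' u"
    using assms by (intro graph_form_limit[OF assms(2) w' w]) auto
  ultimately show ?thesis
    using L_sym[OF wD w'D] LIMSEQ_unique by simp
qed

text \<open>
  The compactness inequality passes to limits that converge in the form, hence to the extension.
\<close>

lemma graph_compact:
  assumes "\<epsilon> > 0"
  shows "\<exists>\<Phi>. finite \<Phi> \<and> \<Phi> \<subseteq> H \<and>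
      (\<forall>u h. graph u h \<longrightarrow> ip u u \<le> \<epsilon> * ip h u + (\<Sum>\<phi>\<in>\<Phi>. (ip \<phi> u)\<^sup>2))"
proof -
  obtain \<Phi> where \<Phi>: "finite \<Phi>" "\<Phi> \<subseteq> H"
    "\<And>v. v \<in> D \<Longrightarrow> ip v v \<le> \<epsilon> * ip v (L v) + (\<Sum>\<phi>\<in>\<Phi>. (ip \<phi> v)\<^sup>2)"
    using compact_D[OF assms] by auto
  have "ip u u \<le> \<epsilon> * ip h u + (\<Sum>\<phi>\<in>\<Phi>. (ip \<phi> u)\<^sup>2)" if g: "graph u h" for u h
  proof -
    obtain w where w: "form_approx w u" using graph_approx[OF g] by blast
    have wD: "w n \<in> D" for n using w by (simp add: form_approx_def)
    have u: "u \<in> H" using g by simp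
    have "(\<lambda>n. (nrm (w n))\<^sup>2) \<longlonglongrightarrow> (nrm u)\<^sup>2"
      using w[unfolded form_approx_def] u by (intro tendsto_power nrm_tendsto) auto
    then have 1: "(\<lambda>n. ip (w n) (w n)) \<longlonglongrightarrow> ip u u"
      using wD u by (simp add: nrm_sq)
    have 2: "(\<lambda>n. \<epsilon> * ip (w n) (L (w n)) + (\<Sum>\<phi>\<in>\<Phi>. (ip \<phi> (w n))\<^sup>2)) \<longlonglongrightarrow> \<epsilon> * ip h u + (\<Sum>\<phi>\<in>\<Phi>. (ip \<phi> u)\<^sup>2)"
      using \<Phi>(2) u wD w[unfolded form_approx_def] by (intro tendsto_intros ip_tendsto_right graph_form_limit[OF g w w]) auto
    show ?thesis
      using \<Phi>(3) wD by (intro LIMSEQ_le[OF 1 2]) auto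
  qed
  then show ?thesis using \<Phi>(1,2) by blast
qed

lemma graph_nonneg:
  assumes "graph u h" shows "0 \<le> ip h u"
proof -
  obtain w where w: "form_approx w u" using graph_approx[OF assms] by blast
  have wD: "w n \<in> D" for n using w by (simp add: form_approx_def)
  have "(\<lambda>n. ip (w n) (L (w n))) \<longlonglongrightarrow> ip h u"
    using assms by (intro graph_form_limit[OF assms w w]) auto
  then show ?thesis using wD L_nonneg by (intro LIMSEQ_le_const) auto
qed

section \<open>The resolvent\<close>

text \<open>
  The solution of \<open>(1 + L) u = f\<close> is the minimizer of the functional \<open>J\<close> on the form domain; it is a
  limit of a minimizing sequence in \<open>D\<close>.
\<close>

lemma resolvent_exists:
  assumes f: "f \<in> H"
  shows "\<exists>u. graph u (f - u)"
proof -
  define J where "J v = ip v (L v) + ip v v - 2 * ip f v" for v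
  have J_lower: "J v \<ge> - ip f f" if "v \<in> D" for v
  proof -
    have "0 \<le> ip (v - f) (v - f)" using that f by (intro ip_nonneg) simp
    then have "0 \<le> ip v v - 2 * ip f v + ip f f"
      using that f by (simp add: ip_simps ip_sym[of v f])
    then show ?thesis using L_nonneg[OF that] by (simp add: J_def)
  qed
  define m where "m = Inf (J ` D)"
  have bdd: "bdd_below (J ` D)" using J_lower by (auto intro!: bdd_belowI[of _ "- ip f f"])
  have m_le: "m \<le> J v" if "v \<in> D" for v
    unfolding m_def using that bdd by (intro cInf_lower) auto
  have "\<exists>v\<in>D. J v < m + 1 / (real n + 1)" for n :: nat
  proof -
    have "Inf (J ` D) < m + 1 / (real n + 1)" by (simp add: m_def)
    then show ?thesis
      using cInf_lessD[of "J ` D" "m + 1 / (real n + 1)"] D_closed(1) by blast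
  qed
  then obtain w where w: "\<And>n::nat. w n \<in> D" "\<And>n. J (w n) < m + 1 / (real n + 1)"
    by metis
  have J_var: "J (v + t *\<^sub>R z) = J v + 2 * t * (ip v (L z) + ip v z - ip f z) + t\<^sup>2 * (ip z (L z) + ip z z)"
    if "v \<in> D" "z \<in> D" for v z t
    using that f by (simp add: J_def ip_simps L_add L_scale L_sym[of z v] ip_sym[of z v]
        algebra_simps power2_eq_square)
  \<comment> \<open>the parallelogram identity turns a minimizing sequence into a Cauchy sequence\<close>
  have para: "ip (w k - w l) (L (w k - w l)) + ip (w k - w l) (w k - w l)
       \<le> 2 / (real k + 1) + 2 / (real l + 1)" for k l
  proof -
    let ?z = "w k - w l"
    have z: "?z \<in> D" using w(1) by simp
    define b where "b = ip (w l) (L ?z) + ip (w l) ?z - ip f ?z"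
    define c where "c = ip ?z (L ?z) + ip ?z ?z"
    have "m \<le> J (w l) + b + c / 4"
      using m_le[of "w l + (1/2) *\<^sub>R ?z"] J_var[OF w(1)[of l] z, of "1/2"] w(1)[of l] z
      by (simp add: b_def c_def power2_eq_square)
    moreover have "J (w k) = J (w l) + 2 * b + c"
      using J_var[OF w(1)[of l] z, of 1] by (simp add: b_def c_def)
    ultimately have "c \<le> 2 * (1 / (real k + 1)) + 2 * (1 / (real l + 1))"
      using w(2)[of k] w(2)[of l] by linarith
    then show ?thesis by (simp add: c_def)
  qed
  have small: "\<exists>N. \<forall>k\<ge>N. \<forall>l\<ge>N. ip (w k - w l) (L (w k - w l)) + ip (w k - w l) (w k - w l) < e"
    if e: "e > 0" for e
  proof -
    obtain N :: nat where N: "4 / e < real N" using reals_Archimedean2 by blast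
    have "ip (w k - w l) (L (w k - w l)) + ip (w k - w l) (w k - w l) < e" if "k \<ge> N" "l \<ge> N" for k l
    proof -
      have *: "2 / (real j + 1) < e / 2" if "j \<ge> N" for j
      proof -
        have "4 / e < real j + 1" using N that by linarith
        then show ?thesis using e by (simp add: field_simps)
      qed
      show ?thesis using para[of k l] *[of k] *[of l] that by linarith
    qed
    then show ?thesis by blast
  qed
  have "\<exists>u\<in>H. (\<lambda>n. nrm (w n - u)) \<longlonglongrightarrow> 0"
  proof (rule complete_H)
    fix e :: real assume e: "e > 0"
    obtain N where N: "\<forall>k\<ge>N. \<forall>l\<ge>N. ip (w k - w l) (L (w k - w l)) + ip (w k - w l) (w k - w l) < e\<^sup>2"
      using small[of "e\<^sup>2"] e by auto
    have "nrm (w k - w l) < e" if "k \<ge> N" "l \<ge> N" for k l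
    proof -
      have "ip (w k - w l) (w k - w l) < e\<^sup>2"
        using N[rule_format, OF that] L_nonneg[of "w k - w l"] w(1) by simp
      from real_sqrt_less_mono[OF this] show ?thesis using e by (simp add: nrm_def)
    qed
    then show "\<exists>N. \<forall>k\<ge>N. \<forall>l\<ge>N. nrm (w k - w l) < e" by blast
  qed (use w(1) in simp)
  then obtain u where u: "u \<in> H" "(\<lambda>n. nrm (w n - u)) \<longlonglongrightarrow> 0" by blast
  have form_cauchy: "\<exists>N. \<forall>k\<ge>N. \<forall>l\<ge>N. ip (w k - w l) (L (w k - w l)) < e" if e: "e > 0" for e
  proof -
    obtain N where N: "\<forall>k\<ge>N. \<forall>l\<ge>N. ip (w k - w l) (L (w k - w l)) + ip (w k - w l) (w k - w l) < e"
      using small[OF e] by blast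
    have "ip (w k - w l) (L (w k - w l)) < e" if "k \<ge> N" "l \<ge> N" for k l
      using N[rule_format, OF that] ip_nonneg[of "w k - w l"] w(1) by simp
    then show ?thesis by blast
  qed
  \<comment> \<open>the first variation of \<open>J\<close> at the minimizer vanishes\<close>
  have test: "ip u (L z) = ip (f - u) z" if z: "z \<in> D" for z
  proof -
    define b where "b = ip u (L z) + ip u z - ip f z"
    define c where "c = ip z (L z) + ip z z"
    have c: "c \<ge> 0" using L_nonneg[OF z] ip_nonneg[of z] z by (simp add: c_def)
    have ge: "0 \<le> 2 * t * b + t\<^sup>2 * c" for t
    proof -
      have lim: "(\<lambda>n. ip (w n) (L z) + ip (w n) z - ip f z) \<longlonglongrightarrow> b"
        unfolding b_def using w(1) z u by (intro tendsto_intros ip_tendsto) auto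
      have "(\<lambda>n. 1 / (real n + 1) + 2 * t * (ip (w n) (L z) + ip (w n) z - ip f z) + t\<^sup>2 * c)
          \<longlonglongrightarrow> 0 + 2 * t * b + t\<^sup>2 * c"
        using LIMSEQ_inverse_real_of_nat
        by (intro tendsto_intros lim) (simp add: inverse_eq_divide add.commute)
      moreover have "0 \<le> 1 / (real n + 1) + 2 * t * (ip (w n) (L z) + ip (w n) z - ip f z) + t\<^sup>2 * c" for n
      proof -
        have "m \<le> J (w n + t *\<^sub>R z)" using w(1) z by (intro m_le) simp
        then show ?thesis using w(2)[of n] J_var[OF w(1)[of n] z, of t] unfolding c_def by linarith
      qed
      ultimately show ?thesis by (intro LIMSEQ_le_const) auto
    qed
    have "b = 0"
    proof (rule ccontr)
      assume b: "b \<noteq> 0"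
      define t where "t = - b / (c + 1)"
      have tb: "b = - t * (c + 1)" using c by (simp add: t_def)
      have "2 * t * b + t\<^sup>2 * c = - (t\<^sup>2 * (c + 2))"
        unfolding tb by (simp add: power2_eq_square algebra_simps)
      moreover have "t\<^sup>2 * (c + 2) > 0" using b c by (auto simp: t_def)
      ultimately show False using ge[of t] by linarith
    qed
    then show ?thesis using u(1) f z by (simp add: b_def ip_diff)
  qed
  have "graph u (f - u)"
    unfolding graph_def
    by (intro conjI exI[of _ w] allI impI ballI test form_cauchy w(1) u H_closed f)
  then show ?thesis by blast
qed

text \<open>
  The resolvent \<open>(1 + L)\<^sup>-\<^sup>1\<close>; the choice is among solutions that differ by null vectors.
\<close>

definition K :: "'v \<Rightarrow> 'v" where
  "K f = (SOME u. graph u (f - u))"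

lemma graph_K: "f \<in> H \<Longrightarrow> graph (K f) (f - K f)"
  unfolding K_def using resolvent_exists by (rule someI_ex)

lemma K_H [simp]: "f \<in> H \<Longrightarrow> K f \<in> H"
  using graph_K graph_H(1) by blast

lemma K_sym:
  assumes "f \<in> H" "g \<in> H" shows "ip (K f) g = ip (K g) f"
  using graph_sym[OF graph_K[OF assms(1)] graph_K[OF assms(2)]] assms
  by (simp add: ip_diff ip_sym[of f] ip_sym[of g] ip_sym[of "K f" "K g"])

text \<open>
  \<open>\<langle>K f, f\<rangle> - \<langle>K f, K f\<rangle>\<close> is the form at \<open>K f\<close>.
\<close>

lemma K_nonneg:
  assumes "f \<in> H" shows "ip (K f) (K f) \<le> ip (K f) f"
  using graph_nonneg[OF graph_K[OF assms]] assms by (simp add: ip_diff ip_sym[of f])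

text \<open>
  Provides Cauchy--Schwarz for the form of \<open>K\<close>, which turns bounds on the quadratic form \<open>\<langle>K g, g\<rangle>\<close> into
  bounds on \<open>K g\<close>.
\<close>

sublocale K: semi_inner H "\<lambda>f g. ip (K f) g"
proof
  show "subspace H" by (rule subspace_H)
  show "ip (K (x + y)) z = ip (K x) z + ip (K y) z" if "x \<in> H" "y \<in> H" "z \<in> H" for x y z
    using that by (simp add: K_sym[of _ z] ip_add_right)
  show "ip (K (c *\<^sub>R x)) y = c * ip (K x) y" if "x \<in> H" "y \<in> H" for x y c
    using that by (simp add: K_sym[of _ y] ip_scale_right)
  show "ip (K x) y = ip (K y) x" if "x \<in> H" "y \<in> H" for x y using that by (rule K_sym)
  show "0 \<le> ip (K x) x" if "x \<in> H" for x
    using K_nonneg[OF that] ip_nonneg[of "K x"] that by simp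
qed

lemma K_contraction: "f \<in> H \<Longrightarrow> nrm (K f) \<le> nrm f"
proof -
  assume f: "f \<in> H"
  have "(nrm (K f))\<^sup>2 \<le> nrm (K f) * nrm f"
    using K_nonneg[OF f] cauchy_schwarz[of "K f" f] f by (simp add: nrm_sq)
  then show ?thesis
    using nrm_nonneg[of f] nrm_nonneg[of "K f"] f mult_left_le_imp_le[of "nrm (K f)" "nrm (K f)" "nrm f"]
    by (cases "nrm (K f) = 0") (simp_all add: power2_eq_square del: nrm_nonneg)
qed

text \<open>
  All functionals \<open>\<phi>\<close> occurring in the compactness inequalities for \<open>\<epsilon> = 1, 1/2, 1/3, \<dots>\<close> form a countable
  family. Along a subsequence on which all of them converge, these inequalities, applied to
  differences, make the sequence Cauchy.
\<close>

lemma graph_precompact: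
  assumes g: "\<And>n::nat. graph (u n) (h n)" and bu: "\<And>n. nrm (u n) \<le> B" and bh: "\<And>n. nrm (h n) \<le> B"
  shows "\<exists>r y. strict_mono (r :: nat \<Rightarrow> nat) \<and> y \<in> H \<and> (\<lambda>n. nrm (u (r n) - y)) \<longlonglongrightarrow> 0"
proof -
  have uh: "u n \<in> H" "h n \<in> H" for n using graph_H[OF g] by blast+
  have B0: "B \<ge> 0" using bu[of 0] nrm_nonneg[OF uh(1), of 0] by linarith
  have "\<forall>k::nat. \<exists>\<Phi>. finite \<Phi> \<and> \<Phi> \<subseteq> H \<and>
      (\<forall>u h. graph u h \<longrightarrow> ip u u \<le> (1 / (real k + 1)) * ip h u + (\<Sum>\<phi>\<in>\<Phi>. (ip \<phi> u)\<^sup>2))"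
    using graph_compact[of "1 / (real _ + 1)"] by (auto simp del: One_nat_def)
  then obtain \<Phi> where \<Phi>: "\<And>k::nat. finite (\<Phi> k)" "\<And>k. \<Phi> k \<subseteq> H"
     "\<And>k u h. graph u h \<Longrightarrow> ip u u \<le> (1 / (real k + 1)) * ip h u + (\<Sum>\<phi>\<in>\<Phi> k. (ip \<phi> u)\<^sup>2)"
    by metis
  \<comment> \<open>the inserted 0 keeps the enumerated set nonempty\<close>
  define \<psi> where "\<psi> = from_nat_into (insert 0 (\<Union>k. \<Phi> k))"
  have "range \<psi> = insert 0 (\<Union>k. \<Phi> k)"
    unfolding \<psi>_def using \<Phi>(1) by (intro range_from_nat_into countable_insert countable_UN) (auto intro: countable_finite)
  then have ran: "\<And>x. x \<in> range \<psi> \<longleftrightarrow> x = 0 \<or> (\<exists>k. x \<in> \<Phi> k)" by auto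
  have \<psi>H: "\<psi> i \<in> H" for i
    using ran[of "\<psi> i"] \<Phi>(2) H_closed(1) rangeI[of \<psi> i] by (metis subsetD)
  have \<psi>_cov: "\<exists>i. \<phi> = \<psi> i" if "\<phi> \<in> \<Phi> k" for \<phi> k
    using ran[of \<phi>] that by (metis imageE)
  have bnd: "\<bar>ip (\<psi> i) (u n)\<bar> \<le> nrm (\<psi> i) * B" for n i
    using cauchy_schwarz[OF \<psi>H uh(1), of i n] mult_left_mono[OF bu[of n], of "nrm (\<psi> i)"] \<psi>H
    by (meson nrm_nonneg order_trans)
  obtain r :: "nat \<Rightarrow> nat" where r: "strict_mono r" "\<And>i. convergent (\<lambda>n. ip (\<psi> i) (u (r n)))"
    using convergent_subsequence_coordinatewise[of "\<lambda>n i. ip (\<psi> i) (u n)", OF bnd] by metis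
  have "\<exists>y\<in>H. (\<lambda>n. nrm (u (r n) - y)) \<longlonglongrightarrow> 0"
  proof (rule complete_H)
    fix e :: real assume e: "e > 0"
    obtain k :: nat where k: "8 * B\<^sup>2 / e\<^sup>2 < real k" using reals_Archimedean2 by blast
    \<comment> \<open>\<open>4 * B\<^sup>2\<close> bounds the form at any difference of two members of the sequence\<close>
    have small: "(1 / (real k + 1)) * (4 * B\<^sup>2) < e\<^sup>2 / 2"
    proof -
      have "8 * B\<^sup>2 / e\<^sup>2 < real k + 1" using k by linarith
      then show ?thesis using e by (simp add: field_simps)
    qed
    have "\<forall>\<phi>\<in>\<Phi> k. \<exists>N. \<forall>m\<ge>N. \<forall>n\<ge>N. (ip \<phi> (u (r m)) - ip \<phi> (u (r n)))\<^sup>2 < e\<^sup>2 / (2 * (real (card (\<Phi> k)) + 1))"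
    proof
      fix \<phi> assume "\<phi> \<in> \<Phi> k"
      then obtain i where "\<phi> = \<psi> i" using \<psi>_cov by blast
      then have "Cauchy (\<lambda>n. ip \<phi> (u (r n)))" using r(2)[of i] by (simp add: Cauchy_convergent_iff)
      moreover define d where "d = sqrt (e\<^sup>2 / (2 * (real (card (\<Phi> k)) + 1)))"
      moreover have d: "d > 0" using e by (simp add: d_def)
      ultimately obtain N where N: "\<forall>m\<ge>N. \<forall>n\<ge>N. norm (ip \<phi> (u (r m)) - ip \<phi> (u (r n))) < d"
        by (meson CauchyD)
      have "(ip \<phi> (u (r m)) - ip \<phi> (u (r n)))\<^sup>2 < e\<^sup>2 / (2 * (real (card (\<Phi> k)) + 1))" if "m \<ge> N" "n \<ge> N" for m n
      proof -
        have "\<bar>ip \<phi> (u (r m)) - ip \<phi> (u (r n))\<bar>\<^sup>2 < d\<^sup>2"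
          using N that d by (intro power_strict_mono) auto
        then show ?thesis using e by (simp add: d_def)
      qed
      then show "\<exists>N. \<forall>m\<ge>N. \<forall>n\<ge>N. (ip \<phi> (u (r m)) - ip \<phi> (u (r n)))\<^sup>2 < e\<^sup>2 / (2 * (real (card (\<Phi> k)) + 1))"
        by blast
    qed
    then obtain N where N: "\<And>\<phi> m n. \<phi> \<in> \<Phi> k \<Longrightarrow> m \<ge> N \<phi> \<Longrightarrow> n \<ge> N \<phi> \<Longrightarrow>
        (ip \<phi> (u (r m)) - ip \<phi> (u (r n)))\<^sup>2 < e\<^sup>2 / (2 * (real (card (\<Phi> k)) + 1))"
      by metis
    define M where "M = Max (insert 0 (N ` \<Phi> k))"
    have M: "N \<phi> \<le> M" if "\<phi> \<in> \<Phi> k" for \<phi>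
      unfolding M_def using that \<Phi>(1) by (intro Max_ge) auto
    have "nrm (u (r m) - u (r n)) < e" if mn: "m \<ge> M" "n \<ge> M" for m n
    proof -
      let ?d = "u (r m) - u (r n)" and ?h = "h (r m) - h (r n)"
      have gd: "graph ?d ?h" by (intro graph_diff g)
      have "ip ?h ?d \<le> nrm ?h * nrm ?d" using cauchy_schwarz[of ?h ?d] uh by simp
      also have "\<dots> \<le> (2 * B) * (2 * B)"
      proof (rule mult_mono)
        show "nrm ?h \<le> 2 * B"
          using nrm_triangle_diff[of "h (r m)" 0 "h (r n)"] nrm_minus_commute[of 0 "h (r n)"] bh[of "r m"] bh[of "r n"] uh by simp
        show "nrm ?d \<le> 2 * B"
          using nrm_triangle_diff[of "u (r m)" 0 "u (r n)"] nrm_minus_commute[of 0 "u (r n)"] bu[of "r m"] bu[of "r n"] uh by simp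
      qed (use uh B0 in auto)
      finally have 1: "ip ?h ?d \<le> 4 * B\<^sup>2" by (simp add: power2_eq_square)
      have "(\<Sum>\<phi>\<in>\<Phi> k. (ip \<phi> ?d)\<^sup>2) \<le> (\<Sum>\<phi>\<in>\<Phi> k. e\<^sup>2 / (2 * (real (card (\<Phi> k)) + 1)))"
      proof (rule sum_mono)
        fix \<phi> assume p: "\<phi> \<in> \<Phi> k"
        have "ip \<phi> ?d = ip \<phi> (u (r m)) - ip \<phi> (u (r n))"
          using p \<Phi>(2) uh by (intro ip_diff_right) auto
        then show "(ip \<phi> ?d)\<^sup>2 \<le> e\<^sup>2 / (2 * (real (card (\<Phi> k)) + 1))"
          using N[OF p, of m n] M[OF p] mn by simp
      qed
      also have "\<dots> = real (card (\<Phi> k)) * (e\<^sup>2 / (2 * (real (card (\<Phi> k)) + 1)))" by simp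
      also have "\<dots> \<le> e\<^sup>2 / 2" by (simp add: field_simps)
      finally have 2: "(\<Sum>\<phi>\<in>\<Phi> k. (ip \<phi> ?d)\<^sup>2) \<le> e\<^sup>2 / 2" .
      have "(1 / (real k + 1)) * ip ?h ?d \<le> (1 / (real k + 1)) * (4 * B\<^sup>2)"
        using 1 by (intro mult_left_mono) auto
      then have "ip ?d ?d < e\<^sup>2"
        using \<Phi>(3)[OF gd, of k] small 2 by linarith
      from real_sqrt_less_mono[OF this] show ?thesis using e by (simp add: nrm_def)
    qed
    then show "\<exists>N. \<forall>m\<ge>N. \<forall>n\<ge>N. nrm (u (r m) - u (r n)) < e" by blast
  qed (use uh in simp)
  then show ?thesis using r(1) by blast
qed

section \<open>Completeness and discreteness of the eigenvectors\<close>

definition espace :: "real \<Rightarrow> 'v set" where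
  "espace l = {u. graph u (l *\<^sub>R u)}"

lemma espace_H [simp]: "u \<in> espace l \<Longrightarrow> u \<in> H"
  unfolding espace_def using graph_H(1) by blast

lemma subspace_espace: "subspace (espace l)"
proof (rule subspaceI)
  show "0 \<in> espace l" using graph_zero by (simp add: espace_def)
  show "x + y \<in> espace l" if "x \<in> espace l" "y \<in> espace l" for x y
    using graph_add[of x "l *\<^sub>R x" y "l *\<^sub>R y"] that by (simp add: espace_def scaleR_add_right)
  show "c *\<^sub>R x \<in> espace l" if "x \<in> espace l" for c x
    using graph_scale[of x "l *\<^sub>R x" c] that by (simp add: espace_def mult.commute)
qed

lemma espace_orthogonal:
  assumes "u \<in> espace l" "v \<in> espace k" "l \<noteq> k"
  shows "ip u v = 0"
proof -
  have H: "u \<in> H" "v \<in> H" using assms by auto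
  have "ip (l *\<^sub>R u) v = ip (k *\<^sub>R v) u"
    using assms by (intro graph_sym) (auto simp: espace_def)
  then have "(l - k) * ip u v = 0"
    using H ip_sym[of v u] by (simp add: ip_scale algebra_simps)
  then show ?thesis using assms(3) by simp
qed

text \<open>
  Let \<open>F\<close> be the orthogonal complement of the eigenvectors, which \<open>K\<close> maps into itself. If \<open>f \<in> F\<close> is not
  null, the supremum \<open>\<kappa>\<close> of \<open>\<langle>K g, g\<rangle>\<close> over the unit ball of \<open>F\<close> is positive. By compactness, \<open>K g n\<close>
  converges for a maximizing sequence; its limit is an eigenvector of \<open>K\<close> with eigenvalue \<open>\<kappa>\<close>,
  hence an eigenvector of \<open>L\<close> with eigenvalue \<open>1 / \<kappa> - 1\<close>, lying in \<open>F\<close>.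
\<close>

lemma eigenvectors_complete:
  assumes f: "f \<in> H" and orth: "\<And>l u. u \<in> espace l \<Longrightarrow> ip f u = 0"
  shows "nrm f = 0"
proof (rule ccontr)
  assume nf: "nrm f \<noteq> 0"
  define F where "F = {g \<in> H. \<forall>l. \<forall>u\<in>espace l. ip g u = 0}"
  have FH: "g \<in> H" if "g \<in> F" for g using that by (simp add: F_def)
  have fF: "f \<in> F" using assms by (auto simp: F_def)
  have F_scale: "c *\<^sub>R g \<in> F" if "g \<in> F" for c g
    using that by (simp add: F_def ip_scale)
  have KF: "K g \<in> F" if g: "g \<in> F" for g
  proof -
    have gH: "g \<in> H" using g by (simp add: F_def)
    have "ip (K g) u = 0" if u: "u \<in> espace l" for l u
    proof -
      have gu: "graph u (l *\<^sub>R u)" using u by (simp add: espace_def)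
      have uH: "u \<in> H" using u by simp
      have "ip (g - K g) u = ip (l *\<^sub>R u) (K g)" by (rule graph_sym[OF graph_K[OF gH] gu])
      moreover have "ip g u = 0" using g u by (simp add: F_def)
      ultimately have "(1 + l) * ip (K g) u = 0"
        using gH uH ip_sym[of u "K g"] by (simp add: ip_diff ip_scale algebra_simps)
      \<comment> \<open>so that \<open>1 + l\<close> cannot vanish, unless \<open>u\<close> is null\<close>
      moreover have "l * ip u u \<ge> 0" using graph_nonneg[OF gu] uH by (simp add: ip_scale)
      then have "l \<ge> 0 \<or> nrm u = 0"
        using ip_nonneg[OF uH] by (auto simp: nrm_def zero_le_mult_iff)
      moreover have "ip (K g) u = 0" if "nrm u = 0"
        using ip_null[OF uH _ that, of "K g"] ip_sym[of u "K g"] uH gH by simp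
      ultimately show ?thesis by fastforce
    qed
    then show ?thesis using gH by (simp add: F_def)
  qed
  define S where "S = {ip (K g) g | g. g \<in> F \<and> nrm g \<le> 1}"
  have S1: "x \<le> 1" if "x \<in> S" for x
  proof -
    obtain g where g: "g \<in> F" "nrm g \<le> 1" "x = ip (K g) g" using \<open>x \<in> S\<close> by (auto simp: S_def)
    have gH: "g \<in> H" using g(1) by (rule FH)
    have "x \<le> nrm (K g) * nrm g" using cauchy_schwarz[of "K g" g] g gH by simp
    also have "\<dots> \<le> 1 * 1" using K_contraction[OF gH] g(2) gH by (intro mult_mono) auto
    finally show ?thesis by simp
  qed
  have S_ne: "0 \<in> S" unfolding S_def using F_scale[OF fF, of 0] by (auto intro!: exI[of _ 0])
  have bdd: "bdd_above S" using S1 by (rule bdd_aboveI)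
  define \<kappa> where "\<kappa> = Sup S"
  have \<kappa>0: "0 \<le> \<kappa>" unfolding \<kappa>_def using S_ne bdd by (rule cSup_upper)
  have K_le: "ip (K g) g \<le> \<kappa> * ip g g" if g: "g \<in> F" for g
  proof (cases "nrm g = 0")
    case True
    then show ?thesis
      using ip_null[OF FH[OF g], of "K g"] ip_sym[of g "K g"] FH[OF g] by (simp add: nrm_eq_0_iff)
  next
    case False
    have gH: "g \<in> H" using g by (rule FH)
    define c where "c = 1 / nrm g"
    have "nrm (c *\<^sub>R g) = 1" using False gH nrm_nonneg[OF gH] by (simp add: nrm_scale c_def)
    then have "ip (K (c *\<^sub>R g)) (c *\<^sub>R g) \<in> S"
      unfolding S_def using F_scale[OF g, of c] by (auto intro!: exI[of _ "c *\<^sub>R g"])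
    then have "ip (K (c *\<^sub>R g)) (c *\<^sub>R g) \<le> \<kappa>" unfolding \<kappa>_def using bdd by (rule cSup_upper)
    moreover have "ip (K (c *\<^sub>R g)) (c *\<^sub>R g) = c\<^sup>2 * ip (K g) g"
      using gH by (subst K.ip_scale) (simp_all add: ip_scale_right power2_eq_square)
    ultimately have "c\<^sup>2 * ip (K g) g \<le> \<kappa>" by simp
    moreover have "c\<^sup>2 = 1 / ip g g" by (simp add: c_def power_divide nrm_sq[OF gH])
    moreover have "ip g g > 0" using False ip_nonneg[OF gH] by (simp add: nrm_eq_0_iff[OF gH])
    ultimately show ?thesis by (simp add: field_simps)
  qed
  \<comment> \<open>Cauchy--Schwarz for the form of \<open>K\<close> between \<open>g\<close> and \<open>K g\<close>\<close>
  have K_sq: "ip (K g) (K g) \<le> \<kappa> * ip (K g) g" if g: "g \<in> F" for g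
  proof -
    have gH: "g \<in> H" using g by (rule FH)
    let ?a = "ip (K g) (K g)"
    have a0: "?a \<ge> 0" using gH by (simp add: ip_nonneg)
    have "?a\<^sup>2 \<le> ip (K g) g * ip (K (K g)) (K g)"
      using K.cauchy_schwarz_sq[of g "K g"] gH by simp
    also have "\<dots> \<le> ip (K g) g * (\<kappa> * ?a)"
      using K_le[OF KF[OF g]] K.ip_nonneg[OF gH] by (intro mult_left_mono)
    finally have *: "?a * ?a \<le> ?a * (\<kappa> * ip (K g) g)" by (simp add: power2_eq_square algebra_simps)
    show ?thesis
    proof (cases "?a = 0")
      case True
      then show ?thesis using \<kappa>0 K.ip_nonneg[OF gH] by simp
    next
      case False
      then show ?thesis using * a0 by (intro mult_left_le_imp_le[OF *]) simp
    qed
  qed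
  have \<kappa>_pos: "0 < \<kappa>"
  proof (rule ccontr)
    assume "\<not> 0 < \<kappa>"
    then have "\<kappa> = 0" using \<kappa>0 by simp
    then have "nrm (K f) = 0" using K_sq[OF fF] f ip_nonneg[of "K f"] by (simp add: nrm_def)
    \<comment> \<open>if \<open>K f\<close> is null, then so is its image \<open>f\<close>, because \<open>D\<close> is dense\<close>
    then have "ip f v = 0" if "v \<in> D" for v
      using graph_test[OF graph_K[OF f] that] ip_null[of "K f"] f that by (simp add: ip_diff)
    then have "ip f f = 0" using f by (rule dense_D[rotated])
    then show False using nf by (simp add: nrm_def)
  qed
  have "\<exists>g. g \<in> F \<and> nrm g \<le> 1 \<and> \<kappa> - 1 / (real n + 1) < ip (K g) g" for n :: nat
  proof -
    have "\<kappa> - 1 / (real n + 1) < Sup S" by (simp add: \<kappa>_def)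
    then show ?thesis using less_cSupD[of S "\<kappa> - 1 / (real n + 1)"] S_ne by (auto simp: S_def)
  qed
  then obtain g where g: "\<And>n::nat. g n \<in> F" "\<And>n. nrm (g n) \<le> 1"
      "\<And>n. \<kappa> - 1 / (real n + 1) < ip (K (g n)) (g n)" by metis
  have gH: "g n \<in> H" for n using g(1) by (rule FH)
  have Kg1: "nrm (K (g n)) \<le> 1" for n using K_contraction[OF gH] g(2) order_trans by blast
  have "\<exists>r y. strict_mono (r :: nat \<Rightarrow> nat) \<and> y \<in> H \<and> (\<lambda>n. nrm (K (g (r n)) - y)) \<longlonglongrightarrow> 0"
  proof (rule graph_precompact)
    show "graph (K (g n)) (g n - K (g n))" for n using gH by (rule graph_K)
    show "nrm (K (g n)) \<le> 2" for n using Kg1[of n] by simp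
    show "nrm (g n - K (g n)) \<le> 2" for n
      using nrm_triangle_diff[of "g n" 0 "K (g n)"] nrm_minus_commute[of 0 "K (g n)"] gH[of n] Kg1[of n] g(2)[of n]
      by simp
  qed
  then obtain r y where r: "strict_mono (r :: nat \<Rightarrow> nat)" and y: "y \<in> H"
    and lim: "(\<lambda>n. nrm (K (g (r n)) - y)) \<longlonglongrightarrow> 0" by blast
  define G where "G n = g (r n)" for n
  have G: "G n \<in> F" "G n \<in> H" "nrm (G n) \<le> 1" for n using g gH by (auto simp: G_def)
  \<comment> \<open>almost maximizers are almost eigenvectors of \<open>K\<close>\<close>
  have G_sq: "(nrm (K (G n) - \<kappa> *\<^sub>R G n))\<^sup>2 \<le> \<kappa> * (1 / (real n + 1))" for n
  proof -
    have "ip (G n) (G n) \<le> 1" using G(3)[of n] nrm_sq[OF G(2), of n] nrm_nonneg[OF G(2), of n]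
      by (metis one_power2 power_mono)
    then have "\<kappa>\<^sup>2 * ip (G n) (G n) \<le> \<kappa>\<^sup>2" by (simp add: mult_left_le)
    moreover have "(nrm (K (G n) - \<kappa> *\<^sub>R G n))\<^sup>2
        = ip (K (G n)) (K (G n)) - 2 * \<kappa> * ip (K (G n)) (G n) + \<kappa>\<^sup>2 * ip (G n) (G n)"
      using G(2)[of n] by (subst nrm_sq) (simp_all add: ip_simps ip_sym[of "G n" "K (G n)"] power2_eq_square algebra_simps)
    ultimately have "(nrm (K (G n) - \<kappa> *\<^sub>R G n))\<^sup>2 \<le> \<kappa> * (\<kappa> - ip (K (G n)) (G n))"
      using K_sq[OF G(1), of n] by (simp add: power2_eq_square algebra_simps)
    also have "\<kappa> - ip (K (G n)) (G n) \<le> 1 / (real (r n) + 1)"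
      using g(3)[of "r n"] by (simp add: G_def)
    also have "1 / (real (r n) + 1) \<le> 1 / (real n + 1)"
      using seq_suble[OF r, of n] by (simp add: frac_le)
    finally show ?thesis using \<kappa>0 by (simp add: mult_left_mono)
  qed
  have "(\<lambda>n. sqrt (\<kappa> * (1 / (real n + 1)))) \<longlonglongrightarrow> sqrt (\<kappa> * 0)"
    using LIMSEQ_inverse_real_of_nat
    by (intro tendsto_intros) (simp add: inverse_eq_divide add.commute)
  then have sqrt0: "(\<lambda>n. sqrt (\<kappa> * (1 / (real n + 1)))) \<longlonglongrightarrow> 0" by simp
  have diff0: "(\<lambda>n. nrm (K (G n) - \<kappa> *\<^sub>R G n)) \<longlonglongrightarrow> 0"
  proof (rule Lim_null_comparison[OF _ sqrt0], intro always_eventually allI)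
    fix n
    show "norm (nrm (K (G n) - \<kappa> *\<^sub>R G n)) \<le> sqrt (\<kappa> * (1 / (real n + 1)))"
      using real_sqrt_le_mono[OF G_sq[of n]] G(2)[of n] by simp
  qed
  have limK: "(\<lambda>n. nrm (K (G n) - y)) \<longlonglongrightarrow> 0" using lim by (simp add: G_def)
  have limG: "(\<lambda>n. nrm (\<kappa> *\<^sub>R G n - y)) \<longlonglongrightarrow> 0"
  proof (rule Lim_null_comparison[OF _ tendsto_add_zero[OF diff0 limK]], intro always_eventually allI)
    fix n
    show "norm (nrm (\<kappa> *\<^sub>R G n - y)) \<le> nrm (K (G n) - \<kappa> *\<^sub>R G n) + nrm (K (G n) - y)"
      using nrm_triangle_diff[of "\<kappa> *\<^sub>R G n" "K (G n)" y] nrm_minus_commute[of "\<kappa> *\<^sub>R G n" "K (G n)"]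
        G(2)[of n] y by simp
  qed
  have "ip y u = 0" if "u \<in> espace l" for l u
  proof -
    have "(\<lambda>n. ip (K (G n)) u) \<longlonglongrightarrow> ip y u" using limK that G(2) y by (intro ip_tendsto) auto
    moreover have "ip (K (G n)) u = 0" for n using KF[OF G(1)] that by (simp add: F_def)
    ultimately show ?thesis by (simp add: LIMSEQ_const_iff)
  qed
  then have yF: "y \<in> F" using y by (simp add: F_def)
  have K_y: "ip (K y) z = ip (\<kappa> *\<^sub>R y) z" if z: "z \<in> H" for z
  proof -
    have "(\<lambda>n. ip (\<kappa> *\<^sub>R G n) (K z)) \<longlonglongrightarrow> ip y (K z)"
      using limG z G(2) y by (intro ip_tendsto) auto
    moreover have "ip (\<kappa> *\<^sub>R G n) (K z) = \<kappa> * ip (K (G n)) z" for n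
      using K_sym[OF z G(2), of n] z G(2)[of n] ip_sym[of "G n" "K z"] by (simp add: ip_scale)
    moreover have "(\<lambda>n. \<kappa> * ip (K (G n)) z) \<longlonglongrightarrow> \<kappa> * ip y z"
      using limK z G(2) y by (intro tendsto_intros ip_tendsto) auto
    ultimately have "ip y (K z) = \<kappa> * ip y z" using LIMSEQ_unique by simp
    then show ?thesis using K_sym[OF y z] ip_sym[of y "K z"] y z by (simp add: ip_scale)
  qed
  define l where "l = 1 / \<kappa> - 1"
  have null: "nrm (K y - \<kappa> *\<^sub>R y) = 0"
    using K_y[of "K y - \<kappa> *\<^sub>R y"] y by (simp add: nrm_def ip_diff)
  \<comment> \<open>\<open>K y\<close> itself, being in the domain, is the eigenvector; \<open>y\<close> is only equal to a multiple of it up to a null vector\<close>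
  have e: "K y \<in> espace l"
  proof -
    have "graph (K y) (l *\<^sub>R K y)"
    proof (rule graph_null_cong[OF graph_K[OF y]])
      have eq: "y - K y - l *\<^sub>R K y = (- 1 / \<kappa>) *\<^sub>R (K y - \<kappa> *\<^sub>R y)"
        using \<kappa>_pos by (simp add: l_def algebra_simps)
      show "nrm (y - K y - l *\<^sub>R K y) = 0" unfolding eq by (subst nrm_scale) (use null y in simp_all)
    qed (use y in simp)
    then show ?thesis by (simp add: espace_def)
  qed
  \<comment> \<open>being both an eigenvector and orthogonal to all eigenvectors, the limit is null; this contradicts \<open>\<langle>K g, g\<rangle> \<rightarrow> \<kappa> > 0\<close>\<close>
  have "ip (K y) (K y) = 0" using KF[OF yF] e by (simp add: F_def)
  moreover have "ip (K y) (K y) = \<kappa>\<^sup>2 * ip y y"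
    using K_y[of "K y"] K_y[of y] y ip_sym[of y "K y"] by (simp add: ip_scale power2_eq_square)
  ultimately have ny: "nrm y = 0" using \<kappa>_pos by (simp add: nrm_def)
  have "(\<lambda>n. ip (K (G n)) (G n)) \<longlonglongrightarrow> 0"
  proof (rule Lim_null_comparison[OF _ nrm_tendsto[OF _ y limK, unfolded ny]], intro always_eventually allI)
    fix n
    have "\<bar>ip (K (G n)) (G n)\<bar> \<le> nrm (K (G n)) * nrm (G n)" using G(2) by (intro cauchy_schwarz) auto
    also have "\<dots> \<le> nrm (K (G n)) * 1" using G(2,3) by (intro mult_left_mono) auto
    finally show "norm (ip (K (G n)) (G n)) \<le> nrm (K (G n))" by simp
  qed (use G(2) in simp)
  moreover have "(\<lambda>n. \<kappa> - 1 / (real n + 1)) \<longlonglongrightarrow> \<kappa> - 0"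
    using LIMSEQ_inverse_real_of_nat
    by (intro tendsto_intros) (simp add: inverse_eq_divide add.commute)
  moreover have "\<kappa> - 1 / (real n + 1) \<le> ip (K (G n)) (G n)" for n
  proof -
    have "1 / (real (r n) + 1) \<le> 1 / (real n + 1)"
      using seq_suble[OF r, of n] by (simp add: frac_le)
    then show ?thesis using g(3)[of "r n"] by (simp add: G_def)
  qed
  ultimately have "\<kappa> \<le> 0" by (intro LIMSEQ_le) auto
  then show False using \<kappa>_pos by simp
qed

text \<open>
  For a unit eigenvector \<open>b\<close> with eigenvalue at most \<open>\<Lambda>\<close>, the compactness inequality with \<open>\<epsilon> \<Lambda> \<le> 1/2\<close> gives
  \<open>1/2 \<le> \<Sum> \<langle>\<phi>, b\<rangle>\<^sup>2\<close>. Summing over \<open>b\<close>, Bessel's inequality bounds the right-hand side by \<open>\<Sum> \<langle>\<phi>, \<phi>\<rangle>\<close>.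
\<close>

lemma orthonormal_eigenvectors_bound:
  "\<exists>N. \<forall>B. finite B \<longrightarrow> orthonormal B \<longrightarrow> (\<forall>b\<in>B. \<exists>l\<le>\<Lambda>. b \<in> espace l) \<longrightarrow> card B \<le> N"
proof -
  define \<epsilon> where "\<epsilon> = 1 / (2 * (\<bar>\<Lambda>\<bar> + 1))"
  have e: "\<epsilon> > 0" by (simp add: \<epsilon>_def)
  obtain \<Phi> where \<Phi>: "finite \<Phi>" "\<Phi> \<subseteq> H"
      "\<And>u h. graph u h \<Longrightarrow> ip u u \<le> \<epsilon> * ip h u + (\<Sum>\<phi>\<in>\<Phi>. (ip \<phi> u)\<^sup>2)"
    using graph_compact[OF e] by blast
  have "real (card B) \<le> 2 * (\<Sum>\<phi>\<in>\<Phi>. ip \<phi> \<phi>)"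
    if B: "finite B" "orthonormal B" "\<forall>b\<in>B. \<exists>l\<le>\<Lambda>. b \<in> espace l" for B
  proof -
    have BH: "B \<subseteq> H" using B(3) by auto
    have "1 / 2 \<le> (\<Sum>\<phi>\<in>\<Phi>. (ip \<phi> b)\<^sup>2)" if b: "b \<in> B" for b
    proof -
      obtain l where l: "l \<le> \<Lambda>" "b \<in> espace l" using B(3) b by auto
      have bb: "ip b b = 1" using B(2) b by (simp add: orthonormal_def)
      have "1 \<le> \<epsilon> * l + (\<Sum>\<phi>\<in>\<Phi>. (ip \<phi> b)\<^sup>2)"
        using \<Phi>(3)[of b "l *\<^sub>R b"] l(2) bb BH b by (auto simp: espace_def ip_scale)
      moreover have "\<epsilon> * l \<le> \<epsilon> * (\<bar>\<Lambda>\<bar> + 1)" using l(1) e by (intro mult_left_mono) auto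
      moreover have "\<epsilon> * (\<bar>\<Lambda>\<bar> + 1) = 1 / 2" by (simp add: \<epsilon>_def field_simps)
      ultimately show ?thesis by linarith
    qed
    then have "(\<Sum>b\<in>B. 1 / 2) \<le> (\<Sum>b\<in>B. \<Sum>\<phi>\<in>\<Phi>. (ip \<phi> b)\<^sup>2)" by (rule sum_mono)
    also have "\<dots> = (\<Sum>\<phi>\<in>\<Phi>. \<Sum>b\<in>B. (ip \<phi> b)\<^sup>2)" by (rule sum.swap)
    also have "\<dots> \<le> (\<Sum>\<phi>\<in>\<Phi>. ip \<phi> \<phi>)"
      using B BH \<Phi>(2) by (intro sum_mono bessel) (auto simp: orthonormal_def)
    finally show ?thesis by simp
  qed
  then have "card B \<le> nat \<lceil>2 * (\<Sum>\<phi>\<in>\<Phi>. ip \<phi> \<phi>)\<rceil>"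
    if "finite B" "orthonormal B" "\<forall>b\<in>B. \<exists>l\<le>\<Lambda>. b \<in> espace l" for B
    using order_trans[OF _ of_nat_ceiling] that by (subst of_nat_le_iff[where 'a = real, symmetric]) blast
  then show ?thesis by blast
qed

lemma ip_normalize:
  assumes "u \<in> H" "nrm u \<noteq> 0" shows "ip ((1 / nrm u) *\<^sub>R u) ((1 / nrm u) *\<^sub>R u) = 1"
proof -
  have "ip u u \<noteq> 0" using assms by (simp add: nrm_eq_0_iff)
  then show ?thesis
    using assms nrm_sq[OF assms(1)] by (simp add: ip_simps flip: power2_eq_square)
qed

lemma orthonormal_expansion:
  assumes "finite B" "B \<subseteq> H" "orthonormal B" "x \<in> H" "b \<in> B"
  shows "ip (\<Sum>c\<in>B. ip x c *\<^sub>R c) b = ip x b"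
proof -
  have "ip (\<Sum>c\<in>B. ip x c *\<^sub>R c) b = (\<Sum>c\<in>B. ip (ip x c *\<^sub>R c) b)"
    using assms by (intro ip_sum) auto
  also have "\<dots> = (\<Sum>c\<in>B. if c = b then ip x b else 0)"
    using assms by (intro sum.cong) (auto simp: ip_scale orthonormal_def subset_iff)
  finally show ?thesis using assms by simp
qed

text \<open>
  An orthonormal set of maximal cardinality; the cardinalities are bounded by the previous bound.
\<close>

lemma espace_basis:
  "\<exists>B. finite B \<and> B \<subseteq> espace l \<and> orthonormal B \<and>
     (\<forall>u\<in>espace l. nrm (u - (\<Sum>b\<in>B. ip u b *\<^sub>R b)) = 0)"
proof -
  define \<B> where "\<B> = {B. finite B \<and> B \<subseteq> espace l \<and> orthonormal B}"
  obtain N where N: "\<And>B. finite B \<Longrightarrow> orthonormal B \<Longrightarrow> (\<forall>b\<in>B. \<exists>k\<le>l. b \<in> espace k) \<Longrightarrow> card B \<le> N"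
    using orthonormal_eigenvectors_bound[of l] by blast
  have bound: "card B \<le> N" if "B \<in> \<B>" for B
    using that by (intro N) (auto simp: \<B>_def)
  have "{} \<in> \<B>" by (simp add: \<B>_def orthonormal_def)
  then obtain B where B: "B \<in> \<B>" "\<And>C. C \<in> \<B> \<Longrightarrow> card C \<le> card B"
    using ex_has_greatest_nat[of "\<lambda>B. B \<in> \<B>" "{}" card "Suc N"] bound le_imp_less_Suc by blast
  have Bp: "finite B" "B \<subseteq> espace l" "orthonormal B" using B(1) by (auto simp: \<B>_def)
  have BH: "B \<subseteq> H" using Bp(2) by auto
  have "nrm (u - (\<Sum>b\<in>B. ip u b *\<^sub>R b)) = 0" if u: "u \<in> espace l" for u
  proof (rule ccontr)
    define v where "v = u - (\<Sum>b\<in>B. ip u b *\<^sub>R b)"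
    define e where "e = (1 / nrm v) *\<^sub>R v"
    assume "nrm (u - (\<Sum>b\<in>B. ip u b *\<^sub>R b)) \<noteq> 0"
    then have nz: "nrm v \<noteq> 0" by (simp add: v_def)
    have vE: "v \<in> espace l" unfolding v_def
      using u Bp(2) by (intro subspace_diff subspace_sum subspace_scale subspace_espace) auto
    then have eE: "e \<in> espace l" unfolding e_def by (intro subspace_scale subspace_espace)
    have vH: "v \<in> H" using vE by simp
    have ee: "ip e e = 1" unfolding e_def by (rule ip_normalize[OF vH nz])
    have vb: "ip v b = 0" if "b \<in> B" for b
      unfolding v_def using that u BH orthonormal_expansion[OF Bp(1) BH Bp(3) _ that, of u]
      by (subst ip_diff) (auto intro!: H_closed(4,5))
    have eb: "ip e b = 0" "ip b e = 0" if "b \<in> B" for b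
    proof -
      show "ip e b = 0" using vb[OF that] vH BH that by (auto simp: e_def ip_scale)
      then show "ip b e = 0" using ip_sym[of b e] eE BH that by auto
    qed
    have "e \<notin> B" using eb(1)[of e] ee by auto
    moreover have "insert e B \<in> \<B>"
      using Bp eE ee eb by (auto simp: \<B>_def orthonormal_def)
    ultimately show False using B(2)[of "insert e B"] Bp(1) by simp
  qed
  then show ?thesis using Bp by blast
qed

text \<open>
  Finite-dimensionality makes the orthogonal projection an explicit finite sum.
\<close>

lemma espace_projection:
  assumes f: "f \<in> H"
  shows "\<exists>g\<in>espace l. \<forall>h\<in>espace l. ip (f - g) h = 0"
proof -
  obtain B where B: "finite B" "B \<subseteq> espace l" "orthonormal B"
     "\<forall>u\<in>espace l. nrm (u - (\<Sum>b\<in>B. ip u b *\<^sub>R b)) = 0"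
    using espace_basis[of l] by (elim exE conjE) (rule that)
  have BH: "B \<subseteq> H" using B(2) by auto
  define g where "g = (\<Sum>b\<in>B. ip f b *\<^sub>R b)"
  have gE: "g \<in> espace l" unfolding g_def
    using B(2) by (intro subspace_sum subspace_scale subspace_espace) auto
  then have gH: "g \<in> H" by simp
  have "ip (f - g) h = 0" if h: "h \<in> espace l" for h
  proof -
    have hH: "h \<in> H" using h by simp
    define p where "p = (\<Sum>b\<in>B. ip h b *\<^sub>R b)"
    have pH: "p \<in> H" unfolding p_def using BH by (auto intro!: H_closed(4,5))
    have "ip p (f - g) = (\<Sum>b\<in>B. ip (ip h b *\<^sub>R b) (f - g))"
      unfolding p_def using BH f gH by (intro ip_sum) auto
    also have "\<dots> = 0"
    proof (rule sum.neutral, intro ballI)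
      fix b assume b: "b \<in> B"
      have "ip (f - g) b = 0"
        using orthonormal_expansion[OF B(1) BH B(3) f b] f gH BH b by (simp add: ip_diff g_def subset_iff)
      then show "ip (ip h b *\<^sub>R b) (f - g) = 0"
        using BH b f gH ip_sym[of b "f - g"] by (auto simp: ip_scale)
    qed
    finally have "ip p (f - g) = 0" .
    moreover have "ip (h - p) (f - g) = 0"
      using B(4)[rule_format, OF h] hH pH f gH by (intro ip_null) (auto simp: p_def)
    ultimately have "ip h (f - g) = 0" using hH pH f gH by (simp add: ip_diff)
    then show ?thesis using ip_sym[of h "f - g"] hH f gH by simp
  qed
  then show ?thesis using gE by blast
qed

text \<open>
  Eigenvectors to different eigenvalues are orthogonal, so unit eigenvectors \<open>e l\<close> obey the bound on orthonormal sets.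
\<close>

lemma finite_eigenvalues_le: "finite {l. l \<le> \<Lambda> \<and> (\<exists>u\<in>espace l. nrm u \<noteq> 0)}"
proof -
  define T where "T = {l. l \<le> \<Lambda> \<and> (\<exists>u\<in>espace l. nrm u \<noteq> 0)}"
  obtain N where N: "\<And>B. finite B \<Longrightarrow> orthonormal B \<Longrightarrow> (\<forall>b\<in>B. \<exists>k\<le>\<Lambda>. b \<in> espace k) \<Longrightarrow> card B \<le> N"
    using orthonormal_eigenvectors_bound[of \<Lambda>] by blast
  have "\<exists>u. u \<in> espace l \<and> ip u u = 1" if "l \<in> T" for l
  proof -
    obtain u where u: "u \<in> espace l" "nrm u \<noteq> 0" using \<open>l \<in> T\<close> by (auto simp: T_def)
    then show ?thesis
      using ip_normalize[of u] subspace_scale[OF subspace_espace u(1)] by (metis espace_H)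
  qed
  then obtain e where e: "\<And>l. l \<in> T \<Longrightarrow> e l \<in> espace l" "\<And>l. l \<in> T \<Longrightarrow> ip (e l) (e l) = 1" by metis
  have orth: "ip (e l) (e k) = (if l = k then 1 else 0)" if "l \<in> T" "k \<in> T" for l k
    using espace_orthogonal[OF e(1) e(1), of l k] e(2) that by auto
  have inj: "inj_on e T" using orth by (intro inj_onI) (metis zero_neq_one)
  have "card U \<le> N" if "finite U" "U \<subseteq> T" for U
  proof -
    have "card (e ` U) \<le> N"
    proof (rule N)
      show "orthonormal (e ` U)"
        unfolding orthonormal_def using orth that(2) by (auto simp: subset_iff inj_on_eq_iff[OF inj])
      show "\<forall>b\<in>e ` U. \<exists>k\<le>\<Lambda>. b \<in> espace k" using e(1) that(2) by (force simp: T_def)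
    qed (use that in simp)
    then show ?thesis using card_image[OF inj_on_subset[OF inj that(2)]] by simp
  qed
  then have "finite T" by (metis finite_if_finite_subsets_card_bdd)
  then show ?thesis by (simp add: T_def)
qed

lemma finite_spectrum_le:
  assumes mono: "strict_mono (\<mu> :: nat \<Rightarrow> real)"
    and ran: "range \<mu> = {l. \<exists>u\<in>espace l. nrm u \<noteq> 0}"
  shows "finite {j. \<mu> j \<le> \<Lambda>}"
proof (rule finite_imageD)
  have "\<mu> ` {j. \<mu> j \<le> \<Lambda>} \<subseteq> {l. l \<le> \<Lambda> \<and> (\<exists>u\<in>espace l. nrm u \<noteq> 0)}"
    using ran by auto
  then show "finite (\<mu> ` {j. \<mu> j \<le> \<Lambda>})" using finite_eigenvalues_le finite_subset by blast
  show "inj_on \<mu> {j. \<mu> j \<le> \<Lambda>}" using mono strict_mono_imp_inj_on inj_on_subset by blast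
qed

text \<open>
  The partial sums of the projections converge absolutely; \<open>f\<close> minus their limit is orthogonal to all
  eigenvectors, hence null. The estimate is the triangle inequality for the remaining series.
\<close>

lemma spectral_tail:
  assumes f: "f \<in> H" and mono: "strict_mono \<mu>"
    and ran: "range \<mu> = {l. \<exists>u\<in>espace l. nrm u \<noteq> 0}"
    and P: "\<And>j. P j \<in> espace (\<mu> j)" "\<And>j h. h \<in> espace (\<mu> j) \<Longrightarrow> ip (f - P j) h = 0"
    and sm: "summable (\<lambda>j::nat. nrm (P j))"
  shows "nrm (f - (\<Sum>j | \<mu> j \<le> \<Lambda>. P j)) \<le> (\<Sum>j. if \<mu> j \<le> \<Lambda> then 0 else nrm (P j))"
proof -
  have PH: "P j \<in> H" for j using P(1)[of j] by simp
  define S where "S N = (\<Sum>j<N. P j)" for N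
  have SH: "S N \<in> H" for N unfolding S_def by (intro H_closed(5) PH)
  have "\<exists>y\<in>H. (\<lambda>n. nrm (S n - y)) \<longlonglongrightarrow> 0"
  proof (rule complete_H)
    fix e :: real assume e: "e > 0"
    have "Cauchy (\<lambda>n. \<Sum>j<n. nrm (P j))" using sm by (simp add: summable_iff_convergent Cauchy_convergent_iff)
    then obtain M where M: "\<forall>m\<ge>M. \<forall>n\<ge>M. norm ((\<Sum>j<m. nrm (P j)) - (\<Sum>j<n. nrm (P j))) < e"
      using e by (meson CauchyD)
    have *: "nrm (S m - S n) < e" if "n \<le> m" "n \<ge> M" for m n
    proof -
      have eq: "S m - S n = (\<Sum>j\<in>{n..<m}. P j)"
        unfolding S_def using that(1) by (metis lessThan_atLeast0 sum_diff_nat_ivl zero_le)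
      have "nrm (S m - S n) \<le> (\<Sum>j\<in>{n..<m}. nrm (P j))"
        unfolding eq using PH by (intro nrm_sum_le)
      also have "\<dots> = (\<Sum>j<m. nrm (P j)) - (\<Sum>j<n. nrm (P j))"
        using that(1) by (metis lessThan_atLeast0 sum_diff_nat_ivl zero_le)
      also have "\<dots> < e" using M[rule_format, of m n] that by simp
      finally show ?thesis .
    qed
    have "nrm (S m - S n) < e" if "m \<ge> M" "n \<ge> M" for m n
      using *[of n m] *[of m n] nrm_minus_commute[OF SH SH, of m n] that by (cases "n \<le> m") auto
    then show "\<exists>N. \<forall>m\<ge>N. \<forall>n\<ge>N. nrm (S m - S n) < e" by blast
  qed (rule SH)
  then obtain y where y: "y \<in> H" and lim: "(\<lambda>n. nrm (S n - y)) \<longlonglongrightarrow> 0" by blast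
  have "nrm (f - y) = 0"
  proof (rule eigenvectors_complete)
    fix l u assume u: "u \<in> espace l"
    have uH: "u \<in> H" using u by simp
    show "ip (f - y) u = 0"
    proof (cases "nrm u = 0")
      case True
      then show ?thesis using ip_null[OF uH _ True, of "f - y"] ip_sym[of u "f - y"] f y uH by simp
    next
      case False
      then have "l \<in> range \<mu>" unfolding ran using u by blast
      then obtain i where i: "l = \<mu> i" by blast
      have ne: "\<mu> j \<noteq> \<mu> i" if "j \<noteq> i" for j using mono that by (simp add: strict_mono_eq)
      have "ip (S N) u = ip f u" if N: "i < N" for N
      proof -
        have "ip (S N) u = (\<Sum>j<N. ip (P j) u)" unfolding S_def using PH uH by (intro ip_sum)
        also have "\<dots> = (\<Sum>j<N. if j = i then ip (P i) u else 0)"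
          using espace_orthogonal[OF P(1) u] ne i by (intro sum.cong) auto
        also have "\<dots> = ip (P i) u" using N by simp
        also have "\<dots> = ip f u" using P(2)[of u i] u i f uH PH by (simp add: ip_diff)
        finally show ?thesis .
      qed
      then have "eventually (\<lambda>N. ip (S N) u = ip f u) sequentially"
        by (auto simp: eventually_at_top_dense)
      then have "(\<lambda>N. ip (S N) u) \<longlonglongrightarrow> ip f u" by (rule tendsto_eventually)
      moreover have "(\<lambda>N. ip (S N) u) \<longlonglongrightarrow> ip y u" using lim SH y uH by (intro ip_tendsto) auto
      ultimately have "ip f u = ip y u" by (rule LIMSEQ_unique)
      then show ?thesis using f y uH by (simp add: ip_diff)
    qed
  qed (use f y in simp)
  then have limf: "(\<lambda>n. nrm (f - S n)) \<longlonglongrightarrow> 0"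
  proof -
    have "norm (nrm (f - S n)) \<le> nrm (S n - y)" for n
      using nrm_triangle_diff[of f y "S n"] nrm_minus_commute[of y "S n"] f y SH[of n] \<open>nrm (f - y) = 0\<close> by simp
    then show ?thesis by (intro Lim_null_comparison[OF _ lim] always_eventually) auto
  qed
  define J where "J = {j. \<mu> j \<le> \<Lambda>}"
  have finJ: "finite J" unfolding J_def by (rule finite_spectrum_le[OF mono ran])
  define t where "t j = (if \<mu> j \<le> \<Lambda> then 0 else nrm (P j))" for j
  have t0: "0 \<le> t j" for j using PH by (simp add: t_def)
  have sumt: "summable t"
    using PH by (intro summable_comparison_test'[OF sm, of 0]) (auto simp: t_def)
  obtain M where M: "J \<subseteq> {..<M}" using finJ by (metis finite_nat_iff_bounded)
  have "nrm (f - (\<Sum>j\<in>J. P j)) \<le> nrm (f - S N) + suminf t" if N: "N \<ge> M" for N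
  proof -
    have JN: "J \<subseteq> {..<N}" using M N by auto
    have SJ: "S N - (\<Sum>j\<in>J. P j) = (\<Sum>j\<in>{..<N} - J. P j)"
      unfolding S_def using JN by (simp add: sum_diff)
    have "nrm (S N - (\<Sum>j\<in>J. P j)) \<le> (\<Sum>j\<in>{..<N} - J. nrm (P j))"
      unfolding SJ using PH by (intro nrm_sum_le)
    also have "\<dots> = (\<Sum>j\<in>{..<N} - J. t j)" by (intro sum.cong) (auto simp: t_def J_def)
    also have "\<dots> \<le> suminf t" using sumt t0 by (intro sum_le_suminf) auto
    finally show ?thesis
      using nrm_triangle_diff[OF f SH[of N] H_closed(5)[of J P, OF PH]] by linarith
  qed
  then have "eventually (\<lambda>N. nrm (f - (\<Sum>j\<in>J. P j)) \<le> nrm (f - S N) + suminf t) sequentially"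
    unfolding eventually_at_top_linorder by blast
  moreover have "(\<lambda>N. nrm (f - S N) + suminf t) \<longlonglongrightarrow> 0 + suminf t"
    using limf by (intro tendsto_intros)
  ultimately have "nrm (f - (\<Sum>j\<in>J. P j)) \<le> 0 + suminf t"
    by (intro tendsto_lowerbound[of _ _ sequentially]) auto
  then show ?thesis by (simp add: J_def t_def[abs_def])
qed

end

section \<open>Dimension modulo null vectors\<close>

context semi_inner
begin

text \<open>Linear independence modulo null vectors.\<close>

definition indep :: "'v set \<Rightarrow> bool" where
  "indep B \<longleftrightarrow> (\<forall>a. nrm (\<Sum>b\<in>B. a b *\<^sub>R b) = 0 \<longrightarrow> (\<forall>b\<in>B. a b = 0))"

text \<open>
  Replacing the elements of \<open>C\<close> by vectors of \<open>span B\<close> at distance zero keeps them linearly independent, so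
  the exchange lemma of linear algebra applies.
\<close>

lemma indep_card_le:
  assumes C: "finite C" "C \<subseteq> H" "indep C" and B: "finite B" "B \<subseteq> H"
    and span: "\<And>c. c \<in> C \<Longrightarrow> \<exists>y\<in>span B. nrm (c - y) = 0"
  shows "card C \<le> card B"
proof -
  obtain p where p: "\<And>c. c \<in> C \<Longrightarrow> p c \<in> span B" "\<And>c. c \<in> C \<Longrightarrow> nrm (c - p c) = 0"
    using span by metis
  have BH: "span B \<subseteq> H" using B(2) subspace_H by (rule span_minimal)
  have pH: "p c \<in> H" if "c \<in> C" for c using p(1)[OF that] BH by blast
  have zero: "\<forall>c\<in>C. a c = 0" if a: "(\<Sum>c\<in>C. a c *\<^sub>R p c) = 0" for a
  proof -
    have "(\<Sum>c\<in>C. a c *\<^sub>R c) = (\<Sum>c\<in>C. a c *\<^sub>R (c - p c)) + (\<Sum>c\<in>C. a c *\<^sub>R p c)"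
      by (simp add: algebra_simps sum.distrib sum_subtractf)
    also have "\<dots> = (\<Sum>c\<in>C. a c *\<^sub>R (c - p c))" using a by simp
    finally have eq: "(\<Sum>c\<in>C. a c *\<^sub>R c) = (\<Sum>c\<in>C. a c *\<^sub>R (c - p c))" .
    have "nrm (\<Sum>c\<in>C. a c *\<^sub>R (c - p c)) \<le> (\<Sum>c\<in>C. nrm (a c *\<^sub>R (c - p c)))"
      using C(2) pH by (intro nrm_sum_le) auto
    also have "\<dots> = 0"
    proof (rule sum.neutral, intro ballI)
      fix c assume c: "c \<in> C"
      then have "c - p c \<in> H" using C(2) pH by auto
      then show "nrm (a c *\<^sub>R (c - p c)) = 0" using p(2)[OF c] by (simp add: nrm_scale)
    qed
    finally have "nrm (\<Sum>c\<in>C. a c *\<^sub>R c) \<le> 0" by (simp only: eq)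
    moreover have "(\<Sum>c\<in>C. a c *\<^sub>R c) \<in> H" using C(2) by (intro H_closed(4,5)) auto
    ultimately have "nrm (\<Sum>c\<in>C. a c *\<^sub>R c) = 0" using nrm_nonneg[of "\<Sum>c\<in>C. a c *\<^sub>R c"] by linarith
    then show ?thesis using C(3) by (simp add: indep_def)
  qed
  have inj: "inj_on p C"
  proof (rule inj_onI, rule ccontr)
    fix c d assume cd: "c \<in> C" "d \<in> C" "p c = p d" "c \<noteq> d"
    define a where "a x = (if x = c then 1 else if x = d then - 1 else (0::real))" for x
    have "(\<Sum>x\<in>C. a x *\<^sub>R p x) = (\<Sum>x\<in>{c, d}. a x *\<^sub>R p x)"
      using C(1) cd(1,2) by (intro sum.mono_neutral_right) (auto simp: a_def)
    also have "\<dots> = 0" using cd(3,4) by (simp add: a_def)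
    finally have "a c = 0" using zero cd(1) by blast
    then show False by (simp add: a_def)
  qed
  have "independent (p ` C)"
  proof (rule independent_if_scalars_zero)
    fix f x assume f: "(\<Sum>x\<in>p ` C. f x *\<^sub>R x) = 0" and x: "x \<in> p ` C"
    have "(\<Sum>c\<in>C. f (p c) *\<^sub>R p c) = 0" using f by (simp add: sum.reindex[OF inj])
    from zero[OF this] show "f x = 0" using x by auto
  qed (use C(1) in simp)
  then have "card (p ` C) \<le> card B"
    using independent_span_bound[OF B(1)] p(1) by auto
  then show ?thesis by (simp add: card_image[OF inj])
qed

lemma orthonormal_indep:
  assumes B: "finite B" "B \<subseteq> H" "orthonormal B"
  shows "indep B"
  unfolding indep_def
proof (intro allI impI ballI)
  fix a b assume n: "nrm (\<Sum>b\<in>B. a b *\<^sub>R b) = 0" and b: "b \<in> B"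
  have "(\<Sum>c\<in>B. a c *\<^sub>R c) \<in> H" using B(2) by (intro H_closed(4,5)) auto
  then have "0 = ip (\<Sum>c\<in>B. a c *\<^sub>R c) b" using ip_null n b B(2) by auto
  also have "\<dots> = (\<Sum>c\<in>B. ip (a c *\<^sub>R c) b)" using B(2) b by (intro ip_sum) auto
  also have "\<dots> = (\<Sum>c\<in>B. if c = b then a b else 0)"
    using B b by (intro sum.cong) (auto simp: ip_scale orthonormal_def subset_iff)
  finally show "a b = 0" using B(1) b by simp
qed

end

context form_operator
begin

text \<open>
  \<open>N j\<close> is the size of an orthonormal basis of the eigenspace, which is independent; the union of the
  bases spans all sums of eigenvectors up to null vectors.
\<close>

lemma truncation_dim:
  "\<exists>N :: nat \<Rightarrow> nat.
     (\<forall>j. \<exists>B. finite B \<and> B \<subseteq> espace (\<mu> j) \<and> indep B \<and> card B = N j) \<and>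
     (\<forall>J C. finite J \<longrightarrow> finite C \<longrightarrow> C \<subseteq> {\<Sum>j\<in>J. p j | p. \<forall>j. p j \<in> espace (\<mu> j)} \<longrightarrow> indep C \<longrightarrow>
       card C \<le> (\<Sum>j\<in>J. N j))"
proof -
  have "\<forall>j. \<exists>B. finite B \<and> B \<subseteq> espace (\<mu> j) \<and> orthonormal B \<and>
     (\<forall>u\<in>espace (\<mu> j). nrm (u - (\<Sum>b\<in>B. ip u b *\<^sub>R b)) = 0)"
    using espace_basis by blast
  then obtain B where B: "\<forall>j. finite (B j) \<and> B j \<subseteq> espace (\<mu> j) \<and> orthonormal (B j) \<and>
     (\<forall>u\<in>espace (\<mu> j). nrm (u - (\<Sum>b\<in>B j. ip u b *\<^sub>R b)) = 0)"
    by (rule choice[THEN exE])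
  have BH: "B j \<subseteq> H" for j using B by (meson espace_H subset_eq)
  have 1: "\<exists>B'. finite B' \<and> B' \<subseteq> espace (\<mu> j) \<and> indep B' \<and> card B' = card (B j)" for j
    using B orthonormal_indep[OF _ BH[of j]] by blast
  have 2: "card C \<le> (\<Sum>j\<in>J. card (B j))"
    if J: "finite J" and C: "finite C" "C \<subseteq> {\<Sum>j\<in>J. p j | p. \<forall>j. p j \<in> espace (\<mu> j)}" "indep C" for J C
  proof -
    have CH: "C \<subseteq> H"
    proof
      fix c assume "c \<in> C"
      then obtain p where "c = (\<Sum>j\<in>J. p j)" "\<forall>j. p j \<in> espace (\<mu> j)" using C(2) by blast
      then show "c \<in> H" using H_closed(5)[of J p] espace_H by blast
    qed
    have "card C \<le> card (\<Union>j\<in>J. B j)"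
    proof (rule indep_card_le[OF C(1) CH C(3)])
      fix c assume "c \<in> C"
      then obtain p where p: "c = (\<Sum>j\<in>J. p j)" "\<forall>j. p j \<in> espace (\<mu> j)" using C(2) by blast
      define q where "q j = (\<Sum>b\<in>B j. ip (p j) b *\<^sub>R b)" for j
      have qH: "q j \<in> H" for j unfolding q_def using BH[of j] by (intro H_closed(4,5)) auto
      have pH: "p j \<in> H" for j using espace_H p(2) by blast
      have "nrm (c - (\<Sum>j\<in>J. q j)) = nrm (\<Sum>j\<in>J. p j - q j)" by (simp add: p(1) sum_subtractf)
      also have "\<dots> \<le> (\<Sum>j\<in>J. nrm (p j - q j))" using qH pH by (intro nrm_sum_le) simp
      also have "\<dots> = 0" using B p(2) by (intro sum.neutral) (auto simp: q_def)
      finally have "nrm (c - (\<Sum>j\<in>J. q j)) \<le> 0" .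
      moreover have "c - (\<Sum>j\<in>J. q j) \<in> H" using qH pH p(1) by (intro H_closed) auto
      ultimately have "nrm (c - (\<Sum>j\<in>J. q j)) = 0" using nrm_nonneg[of "c - (\<Sum>j\<in>J. q j)"] by linarith
      moreover have "(\<Sum>j\<in>J. q j) \<in> span (\<Union>j\<in>J. B j)"
        unfolding q_def by (intro span_sum span_scale span_base) blast
      ultimately show "\<exists>y\<in>span (\<Union>j\<in>J. B j). nrm (c - y) = 0" by blast
    next
      show "finite (\<Union>j\<in>J. B j)" using B J by auto
      show "(\<Union>j\<in>J. B j) \<subseteq> H" using BH by blast
    qed
    also have "\<dots> \<le> (\<Sum>j\<in>J. card (B j))" by (rule card_UN_le[OF J])
    finally show ?thesis .
  qed
  show ?thesis
    using 1 2 by (intro exI[of _ "\<lambda>j. card (B j)"]) blast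
qed

end

section \<open>Square-integrable functions\<close>

instantiation "fun" :: (type, real_vector) real_vector
begin

definition scaleR_fun :: "real \<Rightarrow> ('a \<Rightarrow> 'b) \<Rightarrow> 'a \<Rightarrow> 'b" where
  "scaleR_fun c f = (\<lambda>x. c *\<^sub>R f x)"

instance
  by standard (auto simp: scaleR_fun_def fun_eq_iff scaleR_add_right scaleR_add_left)

end

lemma scaleR_fun_apply [simp]: "(c *\<^sub>R f) x = c *\<^sub>R f x"
  by (simp add: scaleR_fun_def)

lemma sum_fun_apply: "(\<Sum>i\<in>I. f i) x = (\<Sum>i\<in>I. f i x)"
  by (induction I rule: infinite_finite_induct) auto

lemma L2_spaceD: "f \<in> L2_space M \<Longrightarrow> f \<in> borel_measurable M" "f \<in> L2_space M \<Longrightarrow> integrable M (\<lambda>x. (f x)\<^sup>2)"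
  by (auto simp: L2_space_def)

lemma L2_mult_integrable:
  assumes "f \<in> L2_space M" "g \<in> L2_space M"
  shows "integrable M (\<lambda>x. f x * g x)"
proof (rule Bochner_Integration.integrable_bound)
  show "integrable M (\<lambda>x. (f x)\<^sup>2 + (g x)\<^sup>2)"
    using assms by (auto dest: L2_spaceD)
  show "AE x in M. norm (f x * g x) \<le> norm ((f x)\<^sup>2 + (g x)\<^sup>2)"
  proof (intro AE_I2)
    fix x
    have "2 * (\<bar>f x\<bar> * \<bar>g x\<bar>) \<le> \<bar>f x\<bar>\<^sup>2 + \<bar>g x\<bar>\<^sup>2"
      using sum_squares_bound[of "\<bar>f x\<bar>" "\<bar>g x\<bar>"] by (simp add: mult.assoc)
    moreover have "0 \<le> \<bar>f x\<bar> * \<bar>g x\<bar>" by simp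
    ultimately have "\<bar>f x\<bar> * \<bar>g x\<bar> \<le> \<bar>f x\<bar>\<^sup>2 + \<bar>g x\<bar>\<^sup>2" by linarith
    then show "norm (f x * g x) \<le> norm ((f x)\<^sup>2 + (g x)\<^sup>2)"
      by (simp add: abs_mult)
  qed
  show "(\<lambda>x. f x * g x) \<in> borel_measurable M"
    using assms by (auto dest!: L2_spaceD(1))
qed

lemma L2_space_add: "f \<in> L2_space M \<Longrightarrow> g \<in> L2_space M \<Longrightarrow> f + g \<in> L2_space M"
  using L2_mult_integrable[of f M g]
  by (auto simp: L2_space_def plus_fun_def power2_sum mult.assoc)

lemma L2_space_scale: "f \<in> L2_space M \<Longrightarrow> c *\<^sub>R f \<in> L2_space M" for f :: "'a \<Rightarrow> real"
  by (auto simp: L2_space_def scaleR_fun_def power_mult_distrib)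

lemma subspace_L2: "subspace (L2_space M)"
  by (rule subspaceI) (auto simp: L2_space_add L2_space_scale, simp add: L2_space_def zero_fun_def)

interpretation L2: semi_inner "L2_space M" "L2_inner M" for M :: "'a measure"
proof
  show "subspace (L2_space M)" by (rule subspace_L2)
  show "L2_inner M (f + g) h = L2_inner M f h + L2_inner M g h"
    if "f \<in> L2_space M" "g \<in> L2_space M" "h \<in> L2_space M" for f g h
    using L2_mult_integrable[OF that(1,3)] L2_mult_integrable[OF that(2,3)]
    by (simp add: L2_inner_def distrib_right)
  show "L2_inner M (c *\<^sub>R f) h = c * L2_inner M f h" for c f h
    by (simp add: L2_inner_def mult.assoc)
  show "L2_inner M f h = L2_inner M h f" for f h
    by (simp add: L2_inner_def mult.commute)
  show "0 \<le> L2_inner M f f" for f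
    by (simp add: L2_inner_def)
qed

lemma L2_nrm: "L2.nrm M = L2_norm M"
  by (simp add: L2.nrm_def L2_norm_def fun_eq_iff)

lemma L2_inner_sq: "L2_inner M f f = (LINT x|M. (f x)\<^sup>2)"
  by (simp add: L2_inner_def power2_eq_square)

lemma L2_nn_integral:
  assumes "f \<in> L2_space M"
  shows "(\<integral>\<^sup>+x. ennreal ((f x)\<^sup>2) \<partial>M) = ennreal ((L2_norm M f)\<^sup>2)"
  using assms nn_integral_eq_integral[of M "\<lambda>x. (f x)\<^sup>2"]
  by (simp add: L2_space_def L2_norm_def L2_inner_sq)

lemma L2_norm_zero_AE:
  assumes "f \<in> L2_space M"
  shows "L2_norm M f = 0 \<longleftrightarrow> (AE x in M. f x = 0)"
  using integral_nonneg_eq_0_iff_AE[of M "\<lambda>x. (f x)\<^sup>2"] assms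
  by (simp add: L2_norm_def L2_inner_sq L2_space_def)

text \<open>
  Riesz--Fischer: a rapidly converging subsequence \<open>x (r k)\<close> has absolutely summable increments almost
  everywhere, and Fatou's lemma estimates the distance to its pointwise limit. Finiteness of the measure
  bounds the integral of the increments by their norms.
\<close>

lemma L2_complete:
  assumes fin: "finite_measure M"
    and x: "\<And>n. x n \<in> L2_space M"
    and cauchy: "\<And>e. e > 0 \<Longrightarrow> \<exists>N. \<forall>m\<ge>N. \<forall>n\<ge>N. L2_norm M (x m - x n) < e"
  shows "\<exists>y\<in>L2_space M. (\<lambda>n. L2_norm M (x n - y)) \<longlonglongrightarrow> 0"
proof -
  interpret finite_measure M by (rule fin)
  have meas[measurable]: "x n \<in> borel_measurable M" for n using x by (rule L2_spaceD)
  have xd: "x m - x n \<in> L2_space M" for m n using x by simp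
  have "\<forall>k. \<exists>N. \<forall>m\<ge>N. \<forall>n\<ge>N. L2_norm M (x m - x n) < (1/2)^k" for k :: nat
    using cauchy by simp
  then obtain N where N: "\<And>k m n. m \<ge> N k \<Longrightarrow> n \<ge> N k \<Longrightarrow> L2_norm M (x m - x n) < (1/2)^k"
    by metis
  define r where "r k = (\<Sum>i\<le>k. N i) + k" for k
  have rN: "r k \<ge> N k" "r (Suc k) \<ge> N k" "r k \<ge> k" for k
    using member_le_sum[of k "{..k}" N] by (auto simp: r_def)
  define d where "d k = x (r (Suc k)) - x (r k)" for k
  have dL: "d k \<in> L2_space M" for k using x by (simp add: d_def)
  have dm[measurable]: "d k \<in> borel_measurable M" for k using dL by (rule L2_spaceD)
  have dn: "L2_norm M (d k) \<le> (1/2)^k" for k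
    using N[OF rN(2) rN(1)] by (simp add: d_def less_imp_le)
  have oneL: "(\<lambda>_. 1) \<in> L2_space M" by (simp add: L2_space_def)
  define c where "c = L2_norm M (\<lambda>_. 1)"
  have d1: "(\<integral>\<^sup>+t. ennreal \<bar>d k t\<bar> \<partial>M) \<le> ennreal ((1/2)^k * c)" for k
  proof -
    have absL: "(\<lambda>t. \<bar>d k t\<bar>) \<in> L2_space M" using dL[of k] by (simp add: L2_space_def)
    have int: "integrable M (\<lambda>t. \<bar>d k t\<bar>)"
      using L2_mult_integrable[OF absL oneL] by simp
    have "(\<integral>t. \<bar>d k t\<bar> \<partial>M) = L2_inner M (\<lambda>t. \<bar>d k t\<bar>) (\<lambda>_. 1)" by (simp add: L2_inner_def)
    also have "\<dots> \<le> L2_norm M (\<lambda>t. \<bar>d k t\<bar>) * c"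
      using L2.cauchy_schwarz[OF absL oneL] by (simp add: L2_nrm c_def)
    also have "L2_norm M (\<lambda>t. \<bar>d k t\<bar>) = L2_norm M (d k)" by (simp add: L2_norm_def L2_inner_def)
    also have "L2_norm M (d k) * c \<le> (1/2)^k * c"
      using dn[of k] by (intro mult_right_mono) (auto simp: c_def L2_norm_def L2_inner_def)
    finally show ?thesis
      using nn_integral_eq_integral[OF int] by (simp add: ennreal_leI)
  qed
  have "(\<integral>\<^sup>+t. (\<Sum>k. ennreal \<bar>d k t\<bar>) \<partial>M) = (\<Sum>k. \<integral>\<^sup>+t. ennreal \<bar>d k t\<bar> \<partial>M)"
    by (intro nn_integral_suminf) measurable
  also have "\<dots> \<le> (\<Sum>k. ennreal ((1/2)^k * c))"
    using d1 by (intro suminf_le) auto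
  also have "\<dots> = ennreal (\<Sum>k. (1/2)^k * c)"
  proof (rule suminf_ennreal2)
    show "0 \<le> (1/2)^k * c" for k by (simp add: c_def L2_norm_def L2_inner_def)
    show "summable (\<lambda>k. (1/2)^k * c)" by (intro summable_mult2 summable_geometric) simp
  qed
  also have "\<dots> < \<infinity>" by simp
  finally have "AE t in M. (\<Sum>k. ennreal \<bar>d k t\<bar>) \<noteq> \<infinity>"
    by (intro nn_integral_noteq_infinite) (auto simp: less_top[symmetric])
  then have conv: "AE t in M. convergent (\<lambda>k. x (r k) t)"
  proof eventually_elim
    case (elim t)
    have "summable (\<lambda>k. \<bar>d k t\<bar>)"
      using elim by (intro summable_suminf_not_top) auto
    then have "summable (\<lambda>k. d k t)" by (rule summable_rabs_cancel)
    then have "convergent (\<lambda>n. \<Sum>k<n. d k t)" by (simp add: summable_iff_convergent)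
    moreover have "(\<Sum>k<n. d k t) = x (r n) t - x (r 0) t" for n
      unfolding d_def by (simp add: sum_lessThan_telescope[of "\<lambda>k. x (r k) t"])
    ultimately have "convergent (\<lambda>n. x (r n) t - x (r 0) t)" by simp
    then have "convergent (\<lambda>n. (x (r n) t - x (r 0) t) + x (r 0) t)"
      by (intro convergent_add convergent_const)
    then show ?case by simp
  qed
  define y where "y t = lim (\<lambda>k. x (r k) t)" for t
  have ym[measurable]: "y \<in> borel_measurable M"
    unfolding y_def by (intro borel_measurable_lim_metric meas)
  have lim: "AE t in M. (\<lambda>k. x (r k) t) \<longlonglongrightarrow> y t"
    using conv by eventually_elim (simp add: y_def convergent_LIMSEQ_iff)
  have fatou: "(\<integral>\<^sup>+t. ennreal ((x n t - y t)\<^sup>2) \<partial>M) \<le> ennreal (e\<^sup>2)"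
    if e: "e > 0" and K: "\<And>m. m \<ge> K \<Longrightarrow> L2_norm M (x n - x m) < e" for n e K
  proof -
    have eq: "(\<integral>\<^sup>+t. ennreal ((x n t - y t)\<^sup>2) \<partial>M)
        = (\<integral>\<^sup>+t. liminf (\<lambda>k. ennreal ((x n t - x (r k) t)\<^sup>2)) \<partial>M)"
    proof (rule nn_integral_cong_AE)
      show "AE t in M. ennreal ((x n t - y t)\<^sup>2) = liminf (\<lambda>k. ennreal ((x n t - x (r k) t)\<^sup>2))"
        using lim
      proof eventually_elim
        case (elim t)
        have "(\<lambda>k. ennreal ((x n t - x (r k) t)\<^sup>2)) \<longlonglongrightarrow> ennreal ((x n t - y t)\<^sup>2)"
          by (intro tendsto_ennrealI tendsto_intros elim)
        then show ?case by (rule lim_imp_Liminf[OF sequentially_bot, symmetric])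
      qed
    qed
    have "(\<integral>\<^sup>+t. liminf (\<lambda>k. ennreal ((x n t - x (r k) t)\<^sup>2)) \<partial>M)
        \<le> liminf (\<lambda>k. \<integral>\<^sup>+t. ennreal ((x n t - x (r k) t)\<^sup>2) \<partial>M)"
      by (intro nn_integral_liminf) measurable
    also have "\<dots> \<le> limsup (\<lambda>k. \<integral>\<^sup>+t. ennreal ((x n t - x (r k) t)\<^sup>2) \<partial>M)"
      by (rule Liminf_le_Limsup) simp
    also have "\<dots> \<le> ennreal (e\<^sup>2)"
    proof (rule Limsup_bounded)
      have "(\<integral>\<^sup>+t. ennreal ((x n t - x (r k) t)\<^sup>2) \<partial>M) \<le> ennreal (e\<^sup>2)" if "k \<ge> K" for k
      proof -
        have "(\<integral>\<^sup>+t. ennreal ((x n t - x (r k) t)\<^sup>2) \<partial>M) = ennreal ((L2_norm M (x n - x (r k)))\<^sup>2)"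
          using L2_nn_integral[OF xd, of n "r k"] by simp
        also have "\<dots> \<le> ennreal (e\<^sup>2)"
          using K[of "r k"] rN(3)[of k] that L2.nrm_nonneg[OF xd]
          by (intro ennreal_leI power_mono) (auto simp: L2_nrm)
        finally show ?thesis .
      qed
      then show "\<forall>\<^sub>F k in sequentially. (\<integral>\<^sup>+t. ennreal ((x n t - x (r k) t)\<^sup>2) \<partial>M) \<le> ennreal (e\<^sup>2)"
        unfolding eventually_at_top_linorder by blast
    qed
    finally show ?thesis by (simp add: eq)
  qed
  have diffL: "x n - y \<in> L2_space M" if "e > 0" "\<And>m. m \<ge> K \<Longrightarrow> L2_norm M (x n - x m) < e" for n e K
  proof -
    have "integrable M (\<lambda>t. (x n t - y t)\<^sup>2)"
    proof (rule integrableI_bounded)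
      have "(\<integral>\<^sup>+t. ennreal ((x n t - y t)\<^sup>2) \<partial>M) < \<infinity>"
        by (rule le_less_trans[OF fatou[OF that]]) simp_all
      then show "(\<integral>\<^sup>+t. ennreal (norm ((x n t - y t)\<^sup>2)) \<partial>M) < \<infinity>" by simp
    qed simp
    then show ?thesis by (simp add: L2_space_def fun_diff_def)
  qed
  obtain N1 where N1: "\<forall>m\<ge>N1. \<forall>n\<ge>N1. L2_norm M (x m - x n) < 1" using cauchy[of 1] by auto
  have "x N1 - (x N1 - y) \<in> L2_space M"
    using x by (intro L2.H_closed(3) diffL[of 1 N1]) (use N1 in auto)
  then have yL: "y \<in> L2_space M" by simp
  have "(\<lambda>n. L2_norm M (x n - y)) \<longlonglongrightarrow> 0"
  proof (rule LIMSEQ_I)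
    fix e :: real assume e: "e > 0"
    obtain K where K: "\<forall>m\<ge>K. \<forall>n\<ge>K. L2_norm M (x m - x n) < e / 2" using cauchy[of "e / 2"] e by auto
    have "norm (L2_norm M (x n - y) - 0) < e" if n: "n \<ge> K" for n
    proof -
      have dy: "x n - y \<in> L2_space M" using x yL by simp
      have "ennreal ((L2_norm M (x n - y))\<^sup>2) \<le> ennreal ((e / 2)\<^sup>2)"
        using fatou[of "e / 2" K n] K n e L2_nn_integral[OF dy] by simp
      then have "(L2_norm M (x n - y))\<^sup>2 \<le> (e / 2)\<^sup>2" by (subst (asm) ennreal_le_iff) auto
      then have "L2_norm M (x n - y) \<le> e / 2" by (rule power2_le_imp_le) (use e in simp)
      then show ?thesis using e L2.nrm_nonneg[OF dy] by (simp add: L2_nrm)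
    qed
    then show "\<exists>no. \<forall>n\<ge>no. norm (L2_norm M (x n - y) - 0) < e" by blast
  qed
  then show ?thesis using yL by blast
qed

section \<open>Calculus of \<open>C\<^sup>k\<close> functions\<close>

lemma has_derivative_partial:
  fixes f :: "real^'n \<Rightarrow> real"
  assumes "f differentiable (at x)"
  shows "(f has_derivative (\<lambda>h. \<Sum>i\<in>UNIV. partial_deriv i f x * h $ i)) (at x)"
proof -
  have d: "(f has_derivative frechet_derivative f (at x)) (at x)"
    using assms by (simp add: frechet_derivative_works)
  interpret bounded_linear "frechet_derivative f (at x)" using d by (rule has_derivative_bounded_linear)
  have "frechet_derivative f (at x) h = (\<Sum>i\<in>UNIV. partial_deriv i f x * h $ i)" for h
  proof -
    have "h = (\<Sum>i\<in>UNIV. h $ i *\<^sub>R axis i 1)"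
      by (simp add: vec_eq_iff axis_def if_distrib if_distribR cong: if_cong)
    then have "frechet_derivative f (at x) h = (\<Sum>i\<in>UNIV. h $ i *\<^sub>R frechet_derivative f (at x) (axis i 1))"
      by (metis (mono_tags, lifting) sum scaleR sum.cong)
    then show ?thesis by (simp add: partial_deriv_def mult.commute)
  qed
  then have "frechet_derivative f (at x) = (\<lambda>h. \<Sum>i\<in>UNIV. partial_deriv i f x * h $ i)" by (rule ext)
  then show ?thesis using d by simp
qed

lemma partial_deriv_eqI:
  assumes "(f has_derivative f') (at x)"
  shows "partial_deriv i f x = f' (axis i 1)"
  using frechet_derivative_at[OF assms] by (simp add: partial_deriv_def)

lemma Ck_on_cong:
  fixes f g :: "real^'n \<Rightarrow> real"
  assumes "open S" "\<And>x. x \<in> S \<Longrightarrow> f x = g x"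
  shows "Ck_on k S f = Ck_on k S g"
proof -
  have "Ck_on k S g" if "Ck_on k S f" "\<And>x. x \<in> S \<Longrightarrow> f x = g x" for f g :: "real^'n \<Rightarrow> real"
    using that
  proof (induction k arbitrary: f g)
    case 0
    then show ?case using continuous_on_cong[of S S f g] by simp
  next
    case (Suc k)
    have d: "(g has_derivative f') (at x)" if "(f has_derivative f') (at x)" "x \<in> S" for x f'
      using that Suc.prems(2) assms(1) by (intro has_derivative_transform_within_open[OF that(1)]) auto
    have 1: "g differentiable (at x)" if x: "x \<in> S" for x
    proof -
      obtain f' where "(f has_derivative f') (at x)"
        using Suc.prems(1) x by (auto simp: differentiable_def)
      from d[OF this x] show ?thesis by (auto simp: differentiable_def)
    qed
    have "partial_deriv i f x = partial_deriv i g x" if "x \<in> S" for i x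
    proof -
      have "(f has_derivative frechet_derivative f (at x)) (at x)"
        using Suc.prems(1) that by (simp add: frechet_derivative_works[symmetric])
      from partial_deriv_eqI[OF d[OF this that]] show ?thesis by (simp add: partial_deriv_def)
    qed
    then have "Ck_on k S (partial_deriv i g)" for i
      using Suc.IH[of "partial_deriv i f" "partial_deriv i g"] Suc.prems(1) by simp
    then show ?case using 1 by simp
  qed
  then show ?thesis using assms(2) by (metis)
qed

text \<open>
  The closure properties below follow from this rule by induction on \<open>k\<close>, using the known derivative.
\<close>

lemma Ck_on_SucI:
  assumes "open S" "\<And>x. x \<in> S \<Longrightarrow> (f has_derivative f' x) (at x)"
    "\<And>i. Ck_on k S (\<lambda>x. f' x (axis i 1))"
  shows "Ck_on (Suc k) S f"
proof -
  have "Ck_on k S (partial_deriv i f)" for i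
    using Ck_on_cong[OF assms(1), of "partial_deriv i f" "\<lambda>x. f' x (axis i 1)" k] assms(3)[of i]
      partial_deriv_eqI[OF assms(2)] by simp
  then show ?thesis using assms(2) by (auto simp: differentiable_def)
qed

lemma Ck_on_continuous: "Ck_on k S f \<Longrightarrow> continuous_on S f"
proof (cases k)
  case (Suc j)
  assume "Ck_on k S f"
  then have "\<forall>x\<in>S. f differentiable (at x)" using Suc by simp
  then show ?thesis
    by (auto intro!: continuous_at_imp_continuous_on differentiable_imp_continuous_within)
qed auto

lemma Ck_on_Suc_imp: "Ck_on (Suc k) S f \<Longrightarrow> Ck_on k S f"
proof (induction k arbitrary: f)
  case 0
  then show ?case using Ck_on_continuous[OF 0] by simp
next
  case (Suc k)
  then show ?case by simp
qed

lemma Ck_on_subset: "Ck_on k S f \<Longrightarrow> T \<subseteq> S \<Longrightarrow> Ck_on k T f"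
  by (induction k arbitrary: f) (auto intro: continuous_on_subset)

lemma Ck_on_derivative: "Ck_on (Suc k) S f \<Longrightarrow> x \<in> S \<Longrightarrow>
    (f has_derivative (\<lambda>h. \<Sum>i\<in>UNIV. partial_deriv i f x * h $ i)) (at x)"
  by (intro has_derivative_partial) simp

lemma sum_axis [simp]: "(\<Sum>j\<in>UNIV. (c j :: real) * axis i 1 $ j) = c i"
  by (simp add: axis_def if_distrib cong: if_cong)

lemma Ck_on_const: "open S \<Longrightarrow> Ck_on k S (\<lambda>_. c)"
proof (induction k arbitrary: c)
  case (Suc k)
  show ?case by (rule Ck_on_SucI[OF Suc.prems, of _ "\<lambda>_ _. 0"]) (use Suc in auto)
qed auto

lemma Ck_on_add:
  assumes "open S" shows "Ck_on k S f \<Longrightarrow> Ck_on k S g \<Longrightarrow> Ck_on k S (\<lambda>x. f x + g x)"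
proof (induction k arbitrary: f g)
  case (Suc k)
  show ?case
    by (rule Ck_on_SucI[OF assms has_derivative_add[OF Ck_on_derivative[OF Suc.prems(1)] Ck_on_derivative[OF Suc.prems(2)]]])
      (use Suc in auto)
qed (auto intro: continuous_on_add)

lemma Ck_on_mult:
  assumes "open S" shows "Ck_on k S f \<Longrightarrow> Ck_on k S g \<Longrightarrow> Ck_on k S (\<lambda>x. f x * g x)"
proof (induction k arbitrary: f g)
  case (Suc k)
  have "Ck_on k S f" "Ck_on k S g" using Suc.prems Ck_on_Suc_imp by blast+
  then show ?case
    using Suc by (intro Ck_on_SucI[OF assms has_derivative_mult[OF Ck_on_derivative[OF Suc.prems(1)] Ck_on_derivative[OF Suc.prems(2)]]])
      (auto intro!: Ck_on_add[OF assms])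
qed (auto intro: continuous_on_mult)

lemma Ck_on_cmult: "open S \<Longrightarrow> Ck_on k S f \<Longrightarrow> Ck_on k S (\<lambda>x. c * f x)"
  by (intro Ck_on_mult Ck_on_const)

lemma Ck_on_diff:
  assumes "open S" "Ck_on k S f" "Ck_on k S g" shows "Ck_on k S (\<lambda>x. f x - g x)"
  using Ck_on_add[OF assms(1,2) Ck_on_cmult[OF assms(1,3), of "-1"]] by simp

lemma Ck_on_sum: "open S \<Longrightarrow> (\<And>i. i \<in> I \<Longrightarrow> Ck_on k S (f i)) \<Longrightarrow> Ck_on k S (\<lambda>x. \<Sum>i\<in>I. f i x)"
  by (induction I rule: infinite_finite_induct) (auto intro: Ck_on_const Ck_on_add)

lemma Ck_on_prod: "open S \<Longrightarrow> (\<And>i. i \<in> I \<Longrightarrow> Ck_on k S (f i)) \<Longrightarrow> Ck_on k S (\<lambda>x. \<Prod>i\<in>I. f i x)"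
  by (induction I rule: infinite_finite_induct) (auto intro: Ck_on_const Ck_on_mult)

lemma Ck_on_inverse:
  assumes "open S" "\<And>x. x \<in> S \<Longrightarrow> f x \<noteq> 0"
  shows "Ck_on k S f \<Longrightarrow> Ck_on k S (\<lambda>x. inverse (f x))"
proof (induction k)
  case (Suc k)
  have i: "Ck_on k S (\<lambda>x. inverse (f x))" using Suc.IH[OF Ck_on_Suc_imp[OF Suc.prems]] .
  have d: "((\<lambda>x. inverse (f x)) has_derivative
      (\<lambda>h. - (inverse (f x) * (\<Sum>i\<in>UNIV. partial_deriv i f x * h $ i) * inverse (f x)))) (at x)"
    if "x \<in> S" for x
    using assms(2)[OF that] by (rule Deriv.has_derivative_inverse[OF _ Ck_on_derivative[OF Suc.prems that]])
  have "Ck_on k S (\<lambda>x. (- 1) * (inverse (f x) * partial_deriv j f x * inverse (f x)))" for j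
    using Suc.prems by (intro Ck_on_mult Ck_on_const assms i) auto
  then show ?case by (intro Ck_on_SucI[OF assms(1) d]) auto
qed (use assms(2) continuous_on_inverse[of S f] in auto)

lemma Ck_on_sqrt:
  assumes "open S" "\<And>x. x \<in> S \<Longrightarrow> f x > 0"
  shows "Ck_on k S f \<Longrightarrow> Ck_on k S (\<lambda>x. sqrt (f x))"
proof (induction k)
  case (Suc k)
  have i: "Ck_on k S (\<lambda>x. inverse (sqrt (f x)))"
    using Suc.IH[OF Ck_on_Suc_imp[OF Suc.prems]] assms(2) by (intro Ck_on_inverse assms(1)) fastforce+
  have d: "((\<lambda>x. sqrt (f x)) has_derivative
      (\<lambda>h. (\<Sum>i\<in>UNIV. partial_deriv i f x * h $ i) * (inverse (sqrt (f x)) / 2))) (at x)"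
    if "x \<in> S" for x
    using has_derivative_real_sqrt[OF assms(2)[OF that] Ck_on_derivative[OF Suc.prems that]] .
  have "Ck_on k S (\<lambda>x. partial_deriv j f x * (inverse (sqrt (f x)) * (1 / 2)))" for j
    using Suc.prems by (intro Ck_on_mult Ck_on_const assms i) auto
  then show ?case by (intro Ck_on_SucI[OF assms(1) d]) auto
qed (auto intro: continuous_on_real_sqrt)

lemma has_derivative_vec_lambda_components:
  fixes g :: "'j::finite \<Rightarrow> 'a::real_normed_vector \<Rightarrow> real"
  assumes "\<And>j. (g j has_derivative g' j) (at x)"
  shows "((\<lambda>x. \<chi> j. g j x) has_derivative (\<lambda>h. \<chi> j. g' j h)) (at x)"
proof (rule has_derivative_componentwise_within[THEN iffD2], rule ballI)
  fix b :: "real^'j" assume "b \<in> Basis"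
  then obtain j where "b = axis j 1" by (auto simp: Basis_vec_def)
  then show "((\<lambda>x. (\<chi> j. g j x) \<bullet> b) has_derivative (\<lambda>h. (\<chi> j. g' j h) \<bullet> b)) (at x)"
    using assms[of j] by (simp add: inner_axis)
qed

lemma Ck_on_compose:
  fixes g :: "'j::finite \<Rightarrow> real^'n \<Rightarrow> real" and f :: "real^'j \<Rightarrow> real"
  assumes S: "open S" and g: "\<And>j. Ck_on k S (g j)" and map: "\<And>x. x \<in> S \<Longrightarrow> (\<chi> j. g j x) \<in> T"
  shows "Ck_on k T f \<Longrightarrow> Ck_on k S (\<lambda>x. f (\<chi> j. g j x))"
  using g
proof (induction k arbitrary: f)
  case 0
  then have "continuous_on S (\<lambda>x. \<chi> j. g j x)" by (intro continuous_on_vec_lambda) auto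
  then show ?case using 0 map continuous_on_compose2[of T f S "\<lambda>x. \<chi> j. g j x"] by auto
next
  case (Suc k)
  have g': "Ck_on k S (g j)" for j using Suc.prems(2) Ck_on_Suc_imp by blast
  have d: "((\<lambda>x. f (\<chi> j. g j x)) has_derivative
      (\<lambda>h. \<Sum>j\<in>UNIV. partial_deriv j f (\<chi> j. g j x) * (\<Sum>i\<in>UNIV. partial_deriv i (g j) x * h $ i))) (at x)"
    if "x \<in> S" for x
    using has_derivative_compose[OF has_derivative_vec_lambda_components[OF Ck_on_derivative[OF Suc.prems(2) that]]
      Ck_on_derivative[OF Suc.prems(1) map[OF that]]] by simp
  have "Ck_on k S (\<lambda>x. \<Sum>j\<in>UNIV. partial_deriv j f (\<chi> j. g j x) * partial_deriv i (g j) x)" for i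
    using Suc.prems Suc.IH[OF _ g'] by (intro Ck_on_sum Ck_on_mult S) auto
  then show ?case by (intro Ck_on_SucI[OF S d]) auto
qed

section \<open>Bump functions and the divergence theorem\<close>

text \<open>
  The classical flat function \<open>exp (- 1 / t)\<close>, divided by powers of \<open>t\<close>: by \<open>exp_flat_deriv\<close> the linear span of
  this family is closed under differentiation, which makes smoothness a simple induction.
\<close>

definition exp_flat :: "nat \<Rightarrow> real \<Rightarrow> real" where
  "exp_flat k t = (if t > 0 then exp (- 1 / t) / t ^ k else 0)"

lemma exp_flat_tendsto_0: "(exp_flat k \<longlongrightarrow> 0) (at 0)"
proof -
  have right: "(exp_flat k \<longlongrightarrow> 0) (at_right 0)"
  proof -
    have "((\<lambda>t. (inverse t) ^ k / exp (inverse t)) \<longlongrightarrow> (0::real)) (at_right 0)"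
      by (rule filterlim_compose[OF tendsto_power_div_exp_0 filterlim_inverse_at_top_right])
    then show ?thesis
    proof (rule Lim_transform_eventually)
      show "\<forall>\<^sub>F t in at_right 0. inverse t ^ k / exp (inverse t) = exp_flat k t"
        by (auto simp: eventually_at_filter exp_flat_def exp_minus field_simps)
    qed
  qed
  have left: "(exp_flat k \<longlongrightarrow> 0) (at_left 0)"
    by (rule tendsto_eventually) (auto simp: eventually_at_filter exp_flat_def)
  show ?thesis using filterlim_split_at[OF left right] .
qed

lemma exp_flat_deriv:
  "(exp_flat k has_real_derivative (exp_flat (k + 2) t - real k * exp_flat (k + 1) t)) (at t)"
proof -
  consider "t > 0" | "t < 0" | "t = 0" by linarith
  then show ?thesis
  proof cases
    case 1
    have pw: "real k * t ^ (k - Suc 0) = real k * (t ^ k / t)"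
      using 1 by (cases k) auto
    have "((\<lambda>t. exp (- 1 / t) / t ^ k) has_real_derivative
       ((exp (- 1 / t) * (1 / t\<^sup>2)) * t ^ k - exp (- 1 / t) * (real k * t ^ (k - Suc 0))) / (t ^ k * t ^ k)) (at t)"
      using 1 by (auto intro!: derivative_eq_intros simp: power2_eq_square)
    also have "((exp (- 1 / t) * (1 / t\<^sup>2)) * t ^ k - exp (- 1 / t) * (real k * t ^ (k - Suc 0))) / (t ^ k * t ^ k)
        = exp_flat (k + 2) t - real k * exp_flat (k + 1) t"
      unfolding pw using 1 by (simp add: exp_flat_def field_simps power2_eq_square)
    finally have "((\<lambda>t. exp (- 1 / t) / t ^ k) has_real_derivative
       (exp_flat (k + 2) t - real k * exp_flat (k + 1) t)) (at t)" .
    then show ?thesis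
      by (rule has_field_derivative_transform_within_open[of _ _ _ "{0<..}"]) (use 1 in \<open>auto simp: exp_flat_def\<close>)
  next
    case 2
    have "((\<lambda>t. 0) has_real_derivative (exp_flat (k + 2) t - real k * exp_flat (k + 1) t)) (at t)"
      using 2 by (simp add: exp_flat_def)
    then show ?thesis
      by (rule has_field_derivative_transform_within_open[of _ _ _ "{..<0}"]) (use 2 in \<open>auto simp: exp_flat_def\<close>)
  next
    case 3
    have "((\<lambda>h. (exp_flat k (0 + h) - exp_flat k 0) / h) \<longlongrightarrow> 0) (at 0)"
      using exp_flat_tendsto_0[of "Suc k"]
      by (rule Lim_transform_eventually) (auto simp: eventually_at_filter exp_flat_def)
    then have "(exp_flat k has_real_derivative 0) (at 0)" by (simp add: DERIV_def)
    then show ?thesis using 3 by (simp add: exp_flat_def)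
  qed
qed

lemma exp_flat_continuous: "continuous_on S (exp_flat k)"
  using exp_flat_deriv by (auto intro!: continuous_at_imp_continuous_on DERIV_isCont)

lemma Ck_on_exp_flat:
  "Ck_on m UNIV (\<lambda>x::real^'n. exp_flat k (c * x $ i + d))"
proof (induction m arbitrary: k)
  case 0
  then show ?case
    by (auto intro!: continuous_intros continuous_on_compose2[OF exp_flat_continuous[of UNIV]])
next
  case (Suc m)
  have d: "((\<lambda>x. exp_flat k (c * x $ i + d)) has_derivative
      (\<lambda>h. (exp_flat (k + 2) (c * x $ i + d) - real k * exp_flat (k + 1) (c * x $ i + d)) * (c * h $ i))) (at x)"
    for x :: "real^'n"
  proof -
    have "((\<lambda>x. c * x $ i + d) has_derivative (\<lambda>h. c * h $ i)) (at x)"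
      by (auto intro!: derivative_eq_intros bounded_linear_imp_has_derivative bounded_linear_vec_nth)
    from has_derivative_compose[OF this exp_flat_deriv[of k "c * x $ i + d", unfolded has_field_derivative_def]]
    show ?thesis by simp
  qed
  show ?case
    by (rule Ck_on_SucI[OF open_UNIV d]) (intro Ck_on_mult Ck_on_diff Ck_on_const open_UNIV Suc)
qed

text \<open>
  A smooth function that is positive exactly on the open box; as the slope \<open>r\<close> tends to infinity it
  tends to the indicator function. The arguments have the form \<open>c * x $ i + d\<close> of \<open>Ck_on_exp_flat\<close>.
\<close>

definition box_bump :: "real^'n \<Rightarrow> real^'n \<Rightarrow> real \<Rightarrow> real^'n \<Rightarrow> real" where
  "box_bump a b r x = (\<Prod>i\<in>UNIV. exp_flat 0 (r * x $ i + - r * a $ i) * exp_flat 0 (- r * x $ i + r * b $ i))"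

lemma Ck_on_box_bump: "open S \<Longrightarrow> Ck_on k S (box_bump a b r)"
  unfolding box_bump_def[abs_def]
  by (rule Ck_on_subset[OF _ subset_UNIV]) (intro Ck_on_prod Ck_on_mult Ck_on_exp_flat open_UNIV)

lemma exp_flat_bounds: "0 \<le> exp_flat 0 t" "exp_flat 0 t \<le> 1"
  by (auto simp: exp_flat_def)

lemma box_bump_bounds: "0 \<le> box_bump a b r x" "box_bump a b r x \<le> 1"
  unfolding box_bump_def
  by (auto intro!: prod_nonneg prod_le_1 mult_nonneg_nonneg mult_le_one exp_flat_bounds)

lemma box_bump_pos_iff:
  assumes "r > 0" shows "box_bump a b r x > 0 \<longleftrightarrow> x \<in> box a b"
proof -
  have e: "exp_flat 0 t > 0 \<longleftrightarrow> t > 0" "exp_flat 0 t = 0 \<longleftrightarrow> \<not> t > 0" for t by (auto simp: exp_flat_def)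
  have "box_bump a b r x > 0 \<longleftrightarrow> box_bump a b r x \<noteq> 0"
    using box_bump_bounds(1)[of a b r x] by linarith
  also have "\<dots> \<longleftrightarrow> (\<forall>i. a $ i < x $ i \<and> x $ i < b $ i)"
    unfolding box_bump_def using assms
    by (auto simp: e)
  also have "\<dots> \<longleftrightarrow> x \<in> box a b" by (simp add: mem_box_cart)
  finally show ?thesis .
qed

lemma box_bump_zero: "r > 0 \<Longrightarrow> x \<notin> box a b \<Longrightarrow> box_bump a b r x = 0"
  using box_bump_pos_iff[of r a b x] box_bump_bounds(1)[of a b r x] by linarith

lemma box_bump_limit:
  fixes a b x :: "real^'n"
  shows "(\<lambda>n. box_bump a b (real (Suc n)) x) \<longlonglongrightarrow> indicator (box a b) x"
proof (cases "x \<in> box a b")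
  case True
  have lim: "(\<lambda>n. exp_flat 0 (real (Suc n) * t)) \<longlonglongrightarrow> 1" if "t > 0" for t
  proof -
    have "(\<lambda>n. exp (- ((1 / t) * (1 / real (Suc n))))) \<longlonglongrightarrow> exp (- ((1 / t) * 0))"
      using LIMSEQ_inverse_real_of_nat by (intro tendsto_intros) (simp add: inverse_eq_divide)
    then show ?thesis using that by (simp add: exp_flat_def mult.commute)
  qed
  have "(\<lambda>n. \<Prod>i\<in>UNIV. exp_flat 0 (real (Suc n) * (x $ i - a $ i)) * exp_flat 0 (real (Suc n) * (b $ i - x $ i)))
     \<longlonglongrightarrow> (\<Prod>i::'n\<in>UNIV. 1 * 1)"
    using True by (intro Limits.tendsto_prod tendsto_mult lim) (auto simp: mem_box_cart)
  then show ?thesis using True by (simp add: box_bump_def algebra_simps)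
next
  case False
  then show ?thesis by (simp add: box_bump_zero)
qed

lemma integrable_continuous_compact_support:
  fixes f :: "'a::euclidean_space \<Rightarrow> real"
  assumes "compact K" "continuous_on K f" "\<And>x. x \<notin> K \<Longrightarrow> f x = 0"
  shows "integrable lborel f"
proof -
  have "f = (\<lambda>x. indicator K x *\<^sub>R f x)" using assms(3) by (auto simp: fun_eq_iff indicator_def)
  then show ?thesis using borel_integrable_compact[OF assms(1,2)] by metis
qed

text \<open>
  The divergence theorem without boundary: the integral of a derivative is the limit of integrals of
  difference quotients, and these vanish by translation invariance.
\<close>

lemma integral_partial_deriv_eq_0:
  fixes F :: "real^'n \<Rightarrow> real"
  assumes S: "open S" and K: "compact K" "K \<subseteq> S"
    and F: "\<And>x. x \<in> S \<Longrightarrow> F differentiable (at x)" "continuous_on S (partial_deriv i F)"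
    and zero: "\<And>x. x \<notin> K \<Longrightarrow> F x = 0"
  shows "integrable lborel (partial_deriv i F)" and "(LINT x|lborel. partial_deriv i F x) = 0"
proof -
  let ?D = "partial_deriv i F" and ?e = "axis i 1 :: real^'n"
  have oK: "open (- K)" using K(1) by (simp add: compact_imp_closed open_Compl)
  have F0: "(F has_derivative (\<lambda>_. 0)) (at x)" if "x \<notin> K" for x
    by (rule has_derivative_transform_within_open[of "\<lambda>_. 0" _ _ _ "- K"]) (use oK zero that in auto)
  have D0: "?D x = 0" if "x \<notin> K" for x using partial_deriv_eqI[OF F0[OF that]] .
  have Fd: "F differentiable (at x)" for x
    using F(1)[of x] F0[of x] K(2) by (cases "x \<in> K") (auto simp: differentiable_def)
  have "continuous_on (- K) ?D" using D0 by (subst continuous_on_cong[of _ "- K" _ "\<lambda>_. 0"]) auto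
  then have "continuous_on (S \<union> - K) ?D" by (intro continuous_on_open_Un S oK F(2))
  moreover have "S \<union> - K = UNIV" using K(2) by auto
  ultimately have Dc: "continuous_on UNIV ?D" by simp
  have Fc: "continuous_on UNIV F"
    using Fd by (auto intro!: continuous_at_imp_continuous_on differentiable_imp_continuous_within)
  have line: "((\<lambda>t. F (x + t *\<^sub>R ?e)) has_real_derivative ?D (x + t *\<^sub>R ?e)) (at t)" for x t
  proof -
    have "((\<lambda>t. x + t *\<^sub>R ?e) has_derivative (\<lambda>h. h *\<^sub>R ?e)) (at t)"
      by (auto intro!: derivative_eq_intros)
    from has_derivative_compose[OF this has_derivative_partial[OF Fd]]
    show ?thesis
      by (simp add: has_field_derivative_def sum_distrib_left[symmetric] mult.left_commute mult_commute_abs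
          flip: sum_distrib_left)
  qed
  have intF: "integrable lborel F"
    using K(1) Fc zero by (intro integrable_continuous_compact_support[of K]) (auto intro: continuous_on_subset)
  obtain C where C: "\<And>x. \<bar>?D x\<bar> \<le> C"
  proof -
    have "compact (?D ` K)" using Dc K(1) by (intro compact_continuous_image) (auto intro: continuous_on_subset)
    then obtain B where "\<forall>y\<in>?D ` K. norm y \<le> B" using compact_imp_bounded bounded_iff by metis
    then have "\<bar>?D x\<bar> \<le> max B 0" for x using D0[of x] by (cases "x \<in> K") (auto simp: max_def)
    then show ?thesis by (rule that)
  qed
  obtain R where R: "K \<subseteq> cball 0 R"
    using compact_imp_bounded[OF K(1)] unfolding bounded_iff by (auto simp: subset_iff)
  define h where "h n = 1 / real (Suc n)" for n
  have h: "h n > 0" "h n \<le> 1" for n by (auto simp: h_def)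
  define q where "q n x = (F (x + h n *\<^sub>R ?e) - F x) / h n" for n x
  have qint: "(LINT x|lborel. q n x) = 0" "integrable lborel (q n)" for n
  proof -
    have d: "distr lborel borel ((+) (h n *\<^sub>R ?e)) = lborel" by (rule lborel_distr_plus)
    have "integrable (distr lborel borel ((+) (h n *\<^sub>R ?e))) F" using intF by (simp add: d)
    then have i: "integrable lborel (\<lambda>x. F (h n *\<^sub>R ?e + x))"
      using intF by (subst (asm) integrable_distr_eq) auto
    have "(LINT x|lborel. F (h n *\<^sub>R ?e + x)) = (LINT x|distr lborel borel ((+) (h n *\<^sub>R ?e)). F x)"
      using intF by (subst integral_distr) auto
    then have e: "(LINT x|lborel. F (h n *\<^sub>R ?e + x)) = (LINT x|lborel. F x)" by (simp add: d)
    show "integrable lborel (q n)" unfolding q_def using i intF by (auto simp: add.commute)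
    show "(LINT x|lborel. q n x) = 0" unfolding q_def using i intF e by (simp add: add.commute)
  qed
  have lim: "(\<lambda>n. q n x) \<longlonglongrightarrow> ?D x" for x
  proof -
    have "((\<lambda>t. (F (x + (0 + t) *\<^sub>R ?e) - F (x + 0 *\<^sub>R ?e)) / t) \<longlongrightarrow> ?D x) (at 0)"
      using line[of x 0] by (simp add: DERIV_def)
    moreover have "filterlim h (at 0) sequentially"
      unfolding filterlim_at h_def using LIMSEQ_inverse_real_of_nat by (simp add: inverse_eq_divide)
    ultimately have "(\<lambda>n. (F (x + (0 + h n) *\<^sub>R ?e) - F (x + 0 *\<^sub>R ?e)) / h n) \<longlonglongrightarrow> ?D x"
      by (rule filterlim_compose)
    then show ?thesis by (simp add: q_def)
  qed
  \<comment> \<open>by the mean value theorem; shifts by \<open>h n \<le> 1\<close> stay in a ball of radius \<open>R + 1\<close>\<close>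
  have bound: "norm (q n x) \<le> C * indicator (cball 0 (R + 1)) x" for n x
  proof (cases "x \<in> cball 0 (R + 1)")
    case True
    obtain z where z: "F (x + h n *\<^sub>R ?e) - F (x + 0 *\<^sub>R ?e) = (h n - 0) * ?D (x + z *\<^sub>R ?e)"
      using MVT2[of 0 "h n" "\<lambda>t. F (x + t *\<^sub>R ?e)" "\<lambda>t. ?D (x + t *\<^sub>R ?e)"] h line by blast
    then have "q n x = ?D (x + z *\<^sub>R ?e)" using h(1)[of n] by (simp add: q_def)
    then show ?thesis using C True by simp
  next
    case False
    have "norm x \<le> norm (x + h n *\<^sub>R ?e) + norm (h n *\<^sub>R ?e)"
      using norm_triangle_ineq4[of "x + h n *\<^sub>R ?e" "h n *\<^sub>R ?e"] by simp
    also have "norm (h n *\<^sub>R ?e) \<le> 1" using h[of n] by (simp add: norm_axis_1)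
    finally have "x + h n *\<^sub>R ?e \<notin> K" "x \<notin> K" using False R by auto
    then show ?thesis using False zero by (simp add: q_def)
  qed
  have w: "integrable lborel (\<lambda>x::real^'n. C * indicator (cball 0 (R + 1)) x)"
    by (intro integrable_mult_right integrable_real_indicator emeasure_bounded_finite) auto
  have Dm: "?D \<in> borel_measurable lborel" using Dc by (simp add: borel_measurable_continuous_onI)
  have qm: "q n \<in> borel_measurable lborel" for n using qint(2) by auto
  show "integrable lborel ?D"
    by (rule integrable_dominated_convergence[where s = q, OF Dm qm w]) (use lim bound in auto)
  have "(\<lambda>n. LINT x|lborel. q n x) \<longlonglongrightarrow> (LINT x|lborel. ?D x)"
    by (rule integral_dominated_convergence[where s = q, OF Dm qm w]) (use lim bound in auto)
  then show "(LINT x|lborel. ?D x) = 0" by (simp add: qint(1) LIMSEQ_const_iff)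
qed

section \<open>The Poincare inequality on convex sets\<close>

lemma nn_integral_lborel_affine:
  fixes f :: "'a::euclidean_space \<Rightarrow> ennreal"
  assumes [measurable]: "f \<in> borel_measurable borel" and c: "c > 0"
  shows "ennreal (c ^ DIM('a)) * (\<integral>\<^sup>+x. f (v + c *\<^sub>R x) \<partial>lborel) = (\<integral>\<^sup>+x. f x \<partial>lborel)"
proof -
  have "(\<integral>\<^sup>+x. f x \<partial>lborel) = (\<integral>\<^sup>+x. f x \<partial>density (distr lborel borel (\<lambda>x. v + c *\<^sub>R x)) (\<lambda>_. \<bar>c\<bar>^DIM('a)))"
    using lborel_affine[of c v] c by simp
  also have "\<dots> = ennreal (c ^ DIM('a)) * (\<integral>\<^sup>+x. f (v + c *\<^sub>R x) \<partial>lborel)"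
    using c by (simp add: nn_integral_density nn_integral_distr nn_integral_cmult)
  finally show ?thesis by simp
qed

lemma nn_integral_lborel_affine_le:
  fixes f :: "'a::euclidean_space \<Rightarrow> ennreal"
  assumes f[measurable]: "f \<in> borel_measurable borel" and c: "c \<ge> 1 / 2"
  shows "(\<integral>\<^sup>+x. f (v + c *\<^sub>R x) \<partial>lborel) \<le> 2 ^ DIM('a) * (\<integral>\<^sup>+x. f x \<partial>lborel)"
proof -
  have "(1 / 2) ^ DIM('a) \<le> c ^ DIM('a)" using c by (intro power_mono) auto
  then have "1 \<le> 2 ^ DIM('a) * c ^ DIM('a)" by (simp add: field_simps power_one_over)
  then have "ennreal 1 \<le> ennreal (2 ^ DIM('a) * c ^ DIM('a))" by (rule ennreal_leI)
  then have 1: "1 \<le> 2 ^ DIM('a) * ennreal (c ^ DIM('a))"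
    using c ennreal_power[of 2 "DIM('a)"] by (simp add: ennreal_mult)
  have "(\<integral>\<^sup>+x. f (v + c *\<^sub>R x) \<partial>lborel) \<le> (2 ^ DIM('a) * ennreal (c ^ DIM('a))) * (\<integral>\<^sup>+x. f (v + c *\<^sub>R x) \<partial>lborel)"
    using mult_right_mono[OF 1] by simp
  then show ?thesis using c nn_integral_lborel_affine[OF f, of c v] by (simp add: mult.assoc)
qed

lemma sum_nth_mult_sq_le:
  fixes g :: "'n::finite \<Rightarrow> real" and v :: "real^'n"
  shows "(\<Sum>i\<in>UNIV. g i * v $ i)\<^sup>2 \<le> (norm v)\<^sup>2 * (\<Sum>i\<in>UNIV. (g i)\<^sup>2)"
proof -
  have "((\<chi> i. g i) \<bullet> v)\<^sup>2 \<le> ((\<chi> i. g i) \<bullet> (\<chi> i. g i)) * (v \<bullet> v)" by (rule Cauchy_Schwarz_ineq)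
  then show ?thesis by (simp add: inner_vec_def power2_eq_square mult.commute flip: power2_norm_eq_inner)
     (simp add: power2_norm_eq_inner inner_vec_def mult.commute flip: power2_eq_square)
qed

lemma has_bochner_integral_nonneg_D:
  fixes f :: "'a \<Rightarrow> real"
  assumes "has_bochner_integral M f r" "\<And>x. 0 \<le> f x"
  shows "0 \<le> r" "(\<integral>\<^sup>+x. ennreal (f x) \<partial>M) = ennreal r"
  using assms nn_integral_eq_integral[of M f]
  by (auto simp: has_bochner_integral_iff intro: integral_nonneg)

definition grad_sq :: "(real^'n \<Rightarrow> real) \<Rightarrow> real^'n \<Rightarrow> real" where
  "grad_sq u x = (\<Sum>i\<in>UNIV. (partial_deriv i u x)\<^sup>2)"

text \<open>
  The increment is the integral of \<open>\<langle>\<nabla>u, x - y\<rangle>\<close> along the segment; the square of this integral is at most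
  the integral of the square, as the variance is nonnegative.
\<close>

lemma increment_sq_le:
  fixes u :: "real^'n \<Rightarrow> real"
  assumes S: "open S" and u: "Ck_on (Suc 0) S u" and seg: "\<And>t. 0 \<le> t \<Longrightarrow> t \<le> 1 \<Longrightarrow> y + t *\<^sub>R (x - y) \<in> S"
  shows "ennreal ((u x - u y)\<^sup>2) \<le>
    (\<integral>\<^sup>+t\<in>{0..1}. ennreal ((norm (x - y))\<^sup>2 * grad_sq u (y + t *\<^sub>R (x - y))) \<partial>lborel)"
proof -
  define l where "l t = y + t *\<^sub>R (x - y)" for t
  define \<psi> where "\<psi> t = (\<Sum>i\<in>UNIV. partial_deriv i u (l t) * (x - y) $ i)" for t
  have cont_l: "isCont l t" for t unfolding l_def by (intro continuous_intros)
  have pc: "isCont (partial_deriv i u) z" if "z \<in> S" for i z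
    using u S that by (simp add: continuous_on_eq_continuous_at)
  have pl: "isCont (\<lambda>t. partial_deriv i u (l t)) t" if "0 \<le> t" "t \<le> 1" for i t
    by (rule isCont_o2[OF cont_l pc[OF seg[OF that, folded l_def]]])
  have \<psi>c: "isCont \<psi> t" if "0 \<le> t" "t \<le> 1" for t
    unfolding \<psi>_def by (intro continuous_intros pl that)
  have d: "((\<lambda>t. u (l t)) has_real_derivative \<psi> t) (at t)" if t: "0 \<le> t" "t \<le> 1" for t
  proof -
    have "(l has_derivative (\<lambda>h. h *\<^sub>R (x - y))) (at t)"
      unfolding l_def by (auto intro!: derivative_eq_intros)
    moreover have "(u has_derivative (\<lambda>h. \<Sum>i\<in>UNIV. partial_deriv i u (l t) * h $ i)) (at (l t))"
      using u seg[OF t] by (intro has_derivative_partial) (simp add: l_def)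
    ultimately have "((\<lambda>t. u (l t)) has_derivative (\<lambda>h. \<Sum>i\<in>UNIV. partial_deriv i u (l t) * (h *\<^sub>R (x - y)) $ i)) (at t)"
      by (rule has_derivative_compose)
    moreover have "(\<lambda>h. \<Sum>i\<in>UNIV. partial_deriv i u (l t) * (h *\<^sub>R (x - y)) $ i) = (*) (\<psi> t)"
      by (simp add: fun_eq_iff \<psi>_def sum_distrib_left mult_ac del: vector_minus_component)
    ultimately show ?thesis by (simp add: has_field_derivative_def)
  qed
  define c where "c = u x - u y"
  have c: "has_bochner_integral lborel (\<lambda>t. \<psi> t * indicator {0..1} t) c"
    using has_bochner_integral_FTC_Icc_real[of 0 1 "\<lambda>t. u (l t)" \<psi>] d \<psi>c by (simp add: l_def c_def)
  have \<psi>2: "has_bochner_integral lborel (\<lambda>t. (\<psi> t)\<^sup>2 * indicator {0..1} t) (LINT t|lborel. (\<psi> t)\<^sup>2 * indicator {0..1} t)"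
  proof -
    have "continuous_on {0..1} (\<lambda>t. (\<psi> t)\<^sup>2)"
      using \<psi>c by (intro continuous_intros continuous_at_imp_continuous_on) auto
    from borel_integrable_compact[OF compact_Icc this]
    show ?thesis by (intro has_bochner_integral_integrable) (simp add: mult.commute)
  qed
  have one: "has_bochner_integral lborel (\<lambda>t::real. indicator {0..1} t :: real) 1"
    using has_bochner_integral_indicator[of "{0..1::real}" lborel "1::real"] by simp
  have "has_bochner_integral lborel (\<lambda>t. (\<psi> t)\<^sup>2 * indicator {0..1} t - 2 * c * (\<psi> t * indicator {0..1} t) + c\<^sup>2 * indicator {0..1} t)
      ((LINT t|lborel. (\<psi> t)\<^sup>2 * indicator {0..1} t) - 2 * c * c + c\<^sup>2 * 1)"
    by (intro has_bochner_integral_add has_bochner_integral_diff has_bochner_integral_mult_right \<psi>2 c one)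
  moreover have "(\<psi> t)\<^sup>2 * indicator {0..1} t - 2 * c * (\<psi> t * indicator {0..1} t) + c\<^sup>2 * indicator {0..1} t
      = (\<psi> t - c)\<^sup>2 * indicator {0..1} t" for t
    by (simp add: power2_eq_square algebra_simps split: split_indicator)
  ultimately have "has_bochner_integral lborel (\<lambda>t. (\<psi> t - c)\<^sup>2 * indicator {0..1} t)
      ((LINT t|lborel. (\<psi> t)\<^sup>2 * indicator {0..1} t) - c\<^sup>2)"
    by (simp add: power2_eq_square)
  then have "0 \<le> (LINT t|lborel. (\<psi> t)\<^sup>2 * indicator {0..1} t) - c\<^sup>2"
    by (rule has_bochner_integral_nonneg_D) auto
  then have "ennreal (c\<^sup>2) \<le> ennreal (LINT t|lborel. (\<psi> t)\<^sup>2 * indicator {0..1} t)" by (intro ennreal_leI) simp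
  also have "\<dots> = (\<integral>\<^sup>+t. ennreal ((\<psi> t)\<^sup>2 * indicator {0..1} t) \<partial>lborel)"
    using \<psi>2 by (intro nn_integral_eq_integral[symmetric]) (auto dest: integrable.intros)
  also have "\<dots> \<le> (\<integral>\<^sup>+t\<in>{0..1}. ennreal ((norm (x - y))\<^sup>2 * grad_sq u (l t)) \<partial>lborel)"
  proof (rule nn_integral_mono)
    fix t :: real
    show "ennreal ((\<psi> t)\<^sup>2 * indicator {0..1} t) \<le> ennreal ((norm (x - y))\<^sup>2 * grad_sq u (l t)) * indicator {0..1} t"
      using sum_nth_mult_sq_le[of "\<lambda>i. partial_deriv i u (l t)" "x - y"]
      by (auto simp: \<psi>_def grad_sq_def intro!: ennreal_leI split: split_indicator)
  qed
  finally show ?thesis by (simp add: c_def l_def)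
qed

text \<open>
  After exchanging the integrals, for fixed \<open>t\<close> one of the two affine substitutions
  \<open>x \<mapsto> (1 - t) y + t x\<close> and \<open>y \<mapsto> t x + (1 - t) y\<close> has a dilation factor of at least \<open>1/2\<close>.
\<close>

lemma double_segment_integral_le:
  fixes g :: "'a::euclidean_space \<Rightarrow> ennreal"
  assumes [measurable]: "g \<in> borel_measurable borel" "Q \<in> sets borel"
  shows "(\<integral>\<^sup>+y\<in>Q. (\<integral>\<^sup>+x\<in>Q. (\<integral>\<^sup>+t\<in>{0..1}. g (y + t *\<^sub>R (x - y)) \<partial>lborel) \<partial>lborel) \<partial>lborel)
     \<le> 2 ^ DIM('a) * emeasure lborel Q * (\<integral>\<^sup>+x. g x \<partial>lborel)"
proof -
  let ?I = "\<integral>\<^sup>+x. g x \<partial>lborel"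
  define f where "f t y x = g (y + t *\<^sub>R (x - y)) * indicator {0..1} t * indicator Q x * indicator Q y"
    for t :: real and x y :: 'a
  have f_meas[measurable]: "(\<lambda>(t, y, x). f t y x) \<in> borel_measurable (borel \<Otimes>\<^sub>M borel \<Otimes>\<^sub>M borel)"
    unfolding f_def by measurable
  have "(\<integral>\<^sup>+y\<in>Q. (\<integral>\<^sup>+x\<in>Q. (\<integral>\<^sup>+t\<in>{0..1}. g (y + t *\<^sub>R (x - y)) \<partial>lborel) \<partial>lborel) \<partial>lborel)
     = (\<integral>\<^sup>+y. \<integral>\<^sup>+x. \<integral>\<^sup>+t. f t y x \<partial>lborel \<partial>lborel \<partial>lborel)"
    by (simp add: f_def nn_integral_multc[symmetric])
  also have "\<dots> = (\<integral>\<^sup>+y. \<integral>\<^sup>+t. \<integral>\<^sup>+x. f t y x \<partial>lborel \<partial>lborel \<partial>lborel)"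
    unfolding f_def by (intro nn_integral_cong lborel_pair.Fubini') measurable
  also have "\<dots> = (\<integral>\<^sup>+t. \<integral>\<^sup>+y. \<integral>\<^sup>+x. f t y x \<partial>lborel \<partial>lborel \<partial>lborel)"
    unfolding f_def by (intro lborel_pair.Fubini') measurable
  also have "\<dots> \<le> (\<integral>\<^sup>+t. 2 ^ DIM('a) * emeasure lborel Q * ?I * indicator {0..1} (t::real) \<partial>lborel)"
  proof (rule nn_integral_mono)
    fix t :: real
    show "(\<integral>\<^sup>+y. \<integral>\<^sup>+x. f t y x \<partial>lborel \<partial>lborel) \<le> 2 ^ DIM('a) * emeasure lborel Q * ?I * indicator {0..1} t"
    proof (cases "t \<in> {0..1}")
      case False
      then show ?thesis by (simp add: f_def)
    next
      case t: True
      show ?thesis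
      proof (cases "t \<ge> 1 / 2")
        case True
        have "(\<integral>\<^sup>+x. f t y x \<partial>lborel) \<le> 2 ^ DIM('a) * ?I * indicator Q y" for y
        proof -
          have "(\<integral>\<^sup>+x. f t y x \<partial>lborel) \<le> (\<integral>\<^sup>+x. g ((1 - t) *\<^sub>R y + t *\<^sub>R x) * indicator Q y \<partial>lborel)"
            using t by (intro nn_integral_mono) (auto simp: f_def algebra_simps split: split_indicator)
          also have "\<dots> = (\<integral>\<^sup>+x. g ((1 - t) *\<^sub>R y + t *\<^sub>R x) \<partial>lborel) * indicator Q y"
            by (rule nn_integral_multc) measurable
          also have "\<dots> \<le> 2 ^ DIM('a) * ?I * indicator Q y"
            using True by (intro mult_right_mono nn_integral_lborel_affine_le) auto
          finally show ?thesis .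
        qed
        then have "(\<integral>\<^sup>+y. \<integral>\<^sup>+x. f t y x \<partial>lborel \<partial>lborel) \<le> (\<integral>\<^sup>+y. 2 ^ DIM('a) * ?I * indicator Q y \<partial>lborel)"
          by (rule nn_integral_mono)
        also have "\<dots> = 2 ^ DIM('a) * emeasure lborel Q * ?I"
          by (subst nn_integral_cmult_indicator) (simp_all add: mult_ac)
        finally show ?thesis using t by simp
      next
        case False
        have "(\<integral>\<^sup>+y. f t y x \<partial>lborel) \<le> 2 ^ DIM('a) * ?I * indicator Q x" for x
        proof -
          have "(\<integral>\<^sup>+y. f t y x \<partial>lborel) \<le> (\<integral>\<^sup>+y. g (t *\<^sub>R x + (1 - t) *\<^sub>R y) * indicator Q x \<partial>lborel)"
            using t by (intro nn_integral_mono) (auto simp: f_def algebra_simps split: split_indicator)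
          also have "\<dots> = (\<integral>\<^sup>+y. g (t *\<^sub>R x + (1 - t) *\<^sub>R y) \<partial>lborel) * indicator Q x"
            by (rule nn_integral_multc) measurable
          also have "\<dots> \<le> 2 ^ DIM('a) * ?I * indicator Q x"
            using False by (intro mult_right_mono nn_integral_lborel_affine_le) auto
          finally show ?thesis .
        qed
        then have "(\<integral>\<^sup>+x. \<integral>\<^sup>+y. f t y x \<partial>lborel \<partial>lborel) \<le> (\<integral>\<^sup>+x. 2 ^ DIM('a) * ?I * indicator Q x \<partial>lborel)"
          by (rule nn_integral_mono)
        also have "\<dots> = 2 ^ DIM('a) * emeasure lborel Q * ?I"
          by (subst nn_integral_cmult_indicator) (simp_all add: mult_ac)
        also have "(\<integral>\<^sup>+x. \<integral>\<^sup>+y. f t y x \<partial>lborel \<partial>lborel) = (\<integral>\<^sup>+y. \<integral>\<^sup>+x. f t y x \<partial>lborel \<partial>lborel)"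
          unfolding f_def by (rule lborel_pair.Fubini') measurable
        finally show ?thesis using t by simp
      qed
    qed
  qed
  also have "\<dots> = 2 ^ DIM('a) * emeasure lborel Q * ?I"
    by (simp add: nn_integral_cmult_indicator)
  finally show ?thesis .
qed

text \<open>
  Integrated over \<open>Q \<times> Q\<close>, the square \<open>(u x - u y)\<^sup>2\<close> gives \<open>2 |Q| \<integral> u\<^sup>2 - 2 (\<integral> u)\<^sup>2\<close>. The same double integral
  is controlled by the gradient along segments, which stay in the convex set \<open>Q\<close>.
\<close>

lemma poincare_inequality:
  fixes u :: "real^'n \<Rightarrow> real"
  assumes S: "open S" and u: "Ck_on (Suc 0) S u" and Q: "compact Q" "convex Q" "Q \<subseteq> S"
    and diam: "\<And>x y. x \<in> Q \<Longrightarrow> y \<in> Q \<Longrightarrow> norm (x - y) \<le> d"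
  shows "measure lborel Q * (LINT x|lborel. indicator Q x * (u x)\<^sup>2)
    \<le> (LINT x|lborel. indicator Q x * u x)\<^sup>2
      + measure lborel Q * (2 ^ CARD('n) * d\<^sup>2 * (LINT x|lborel. indicator Q x * grad_sq u x))"
proof -
  have uc: "continuous_on Q u" using Ck_on_continuous[OF u] Q(3) by (rule continuous_on_subset)
  have gc: "continuous_on Q (grad_sq u)"
    unfolding grad_sq_def using u Q(3) by (auto intro!: continuous_intros intro: continuous_on_subset)
  have int: "integrable lborel (\<lambda>x. indicator Q x * f x)" if "continuous_on Q f" for f :: "real^'n \<Rightarrow> real"
    using borel_integrable_compact[OF Q(1) that] by simp
  have Qb[measurable]: "Q \<in> sets borel" using Q(1) by (simp add: borel_compact)
  have Qfin: "emeasure lborel Q < \<infinity>" using Q(1) by (intro emeasure_bounded_finite compact_imp_bounded)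
  then have Qe: "emeasure lborel Q = ennreal (measure lborel Q)" by (simp add: emeasure_eq_ennreal_measure)
  define A where "A = (LINT x|lborel. indicator Q x * (u x)\<^sup>2)"
  define B where "B = (LINT x|lborel. indicator Q x * u x)"
  define E where "E = (LINT x|lborel. indicator Q x * grad_sq u x)"
  define V where "V = measure lborel Q"
  have g0: "0 \<le> grad_sq u x" for x by (auto simp: grad_sq_def intro: sum_nonneg)
  have hA: "has_bochner_integral lborel (\<lambda>x. indicator Q x * (u x)\<^sup>2) A"
    unfolding A_def using uc by (intro has_bochner_integral_integrable int continuous_intros)
  have hB: "has_bochner_integral lborel (\<lambda>x. indicator Q x * u x) B"
    unfolding B_def using uc by (intro has_bochner_integral_integrable int)
  have hE: "has_bochner_integral lborel (\<lambda>x. indicator Q x * grad_sq u x) E"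
    unfolding E_def using gc by (intro has_bochner_integral_integrable int)
  have hV: "has_bochner_integral lborel (\<lambda>x. indicator Q x :: real) V"
    unfolding V_def using Qfin has_bochner_integral_indicator[of Q lborel "1::real"] by simp
  have E0: "0 \<le> E" using hE by (rule has_bochner_integral_nonneg_D) (simp add: g0)
  have V0: "0 \<le> V" by (simp add: V_def)
  define g where "g x = ennreal (d\<^sup>2 * (indicator Q x * grad_sq u x))" for x
  have gm[measurable]: "g \<in> borel_measurable borel"
    using int[OF gc] unfolding g_def by (auto dest: borel_measurable_integrable)
  have gi: "(\<integral>\<^sup>+x. g x \<partial>lborel) = ennreal (d\<^sup>2 * E)"
    unfolding g_def
    by (rule has_bochner_integral_nonneg_D(2)[OF has_bochner_integral_mult_right[OF hE]]) (simp add: g0)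
  define W where "W y = A - 2 * u y * B + (u y)\<^sup>2 * V" for y
  have hW: "has_bochner_integral lborel (\<lambda>x. indicator Q x * (u x - u y)\<^sup>2) (W y)" for y
  proof -
    have "has_bochner_integral lborel
        (\<lambda>x. indicator Q x * (u x)\<^sup>2 - 2 * u y * (indicator Q x * u x) + (u y)\<^sup>2 * indicator Q x) (W y)"
      unfolding W_def
      by (intro has_bochner_integral_add has_bochner_integral_diff has_bochner_integral_mult_right hA hB hV)
    moreover have "indicator Q x * (u x)\<^sup>2 - 2 * u y * (indicator Q x * u x) + (u y)\<^sup>2 * indicator Q x
        = indicator Q x * (u x - u y)\<^sup>2" for x
      by (simp add: power2_eq_square algebra_simps)
    ultimately show ?thesis by simp
  qed
  have W0: "0 \<le> W y" for y using hW by (rule has_bochner_integral_nonneg_D) simp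
  have inner: "(\<integral>\<^sup>+x\<in>Q. ennreal ((u x - u y)\<^sup>2) \<partial>lborel) = ennreal (W y)" for y
  proof -
    have "(\<integral>\<^sup>+x\<in>Q. ennreal ((u x - u y)\<^sup>2) \<partial>lborel) = (\<integral>\<^sup>+x. ennreal (indicator Q x * (u x - u y)\<^sup>2) \<partial>lborel)"
      by (intro nn_integral_cong) (auto split: split_indicator)
    then show ?thesis using has_bochner_integral_nonneg_D(2)[OF hW[of y]] by simp
  qed
  have "has_bochner_integral lborel
      (\<lambda>y. A * indicator Q y - 2 * B * (indicator Q y * u y) + V * (indicator Q y * (u y)\<^sup>2))
      (A * V - 2 * B * B + V * A)"
    by (intro has_bochner_integral_add has_bochner_integral_diff has_bochner_integral_mult_right hA hB hV)
  moreover have "A * indicator Q y - 2 * B * (indicator Q y * u y) + V * (indicator Q y * (u y)\<^sup>2)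
      = indicator Q y * W y" for y
    by (simp add: W_def algebra_simps)
  ultimately have hO: "has_bochner_integral lborel (\<lambda>y. indicator Q y * W y) (2 * V * A - 2 * B\<^sup>2)"
    by (simp add: power2_eq_square mult_ac)
  have "ennreal (2 * V * A - 2 * B\<^sup>2) = (\<integral>\<^sup>+y. ennreal (indicator Q y * W y) \<partial>lborel)"
    by (rule has_bochner_integral_nonneg_D(2)[OF hO, symmetric]) (simp add: W0)
  also have "\<dots> = (\<integral>\<^sup>+y\<in>Q. ennreal (W y) \<partial>lborel)"
    by (intro nn_integral_cong) (auto split: split_indicator)
  also have "\<dots> \<le> (\<integral>\<^sup>+y\<in>Q. (\<integral>\<^sup>+x\<in>Q. (\<integral>\<^sup>+t\<in>{0..1}. g (y + t *\<^sub>R (x - y)) \<partial>lborel) \<partial>lborel) \<partial>lborel)"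
  proof (intro nn_integral_mono)
    fix y
    have "(\<integral>\<^sup>+x\<in>Q. ennreal ((u x - u y)\<^sup>2) \<partial>lborel) \<le> (\<integral>\<^sup>+x\<in>Q. (\<integral>\<^sup>+t\<in>{0..1}. g (y + t *\<^sub>R (x - y)) \<partial>lborel) \<partial>lborel)"
      if y: "y \<in> Q"
    proof (intro nn_integral_mono)
      fix x
      have "ennreal ((u x - u y)\<^sup>2) \<le> (\<integral>\<^sup>+t\<in>{0..1}. g (y + t *\<^sub>R (x - y)) \<partial>lborel)" if x: "x \<in> Q"
      proof -
        have seg: "y + t *\<^sub>R (x - y) \<in> Q" if "0 \<le> t" "t \<le> 1" for t
          using convexD[OF Q(2) y x, of "1 - t" t] that by (simp add: algebra_simps)
        have "ennreal ((u x - u y)\<^sup>2) \<le> (\<integral>\<^sup>+t\<in>{0..1}. ennreal ((norm (x - y))\<^sup>2 * grad_sq u (y + t *\<^sub>R (x - y))) \<partial>lborel)"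
          using seg Q(3) by (intro increment_sq_le[OF S u]) auto
        also have "\<dots> \<le> (\<integral>\<^sup>+t\<in>{0..1}. g (y + t *\<^sub>R (x - y)) \<partial>lborel)"
        proof (intro nn_integral_mono)
          fix t :: real
          have "(norm (x - y))\<^sup>2 \<le> d\<^sup>2" using diam[OF x y] by (intro power_mono) auto
          then show "ennreal ((norm (x - y))\<^sup>2 * grad_sq u (y + t *\<^sub>R (x - y))) * indicator {0..1} t
              \<le> g (y + t *\<^sub>R (x - y)) * indicator {0..1} t"
            using seg[of t] g0
            by (auto simp: g_def intro!: ennreal_leI mult_right_mono split: split_indicator)
        qed
        finally show ?thesis .
      qed
      then show "ennreal ((u x - u y)\<^sup>2) * indicator Q x \<le> (\<integral>\<^sup>+t\<in>{0..1}. g (y + t *\<^sub>R (x - y)) \<partial>lborel) * indicator Q x"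
        by (simp split: split_indicator)
    qed
    then show "ennreal (W y) * indicator Q y \<le> (\<integral>\<^sup>+x\<in>Q. (\<integral>\<^sup>+t\<in>{0..1}. g (y + t *\<^sub>R (x - y)) \<partial>lborel) \<partial>lborel) * indicator Q y"
      by (simp add: inner split: split_indicator)
  qed
  also have "\<dots> \<le> 2 ^ CARD('n) * emeasure lborel Q * (\<integral>\<^sup>+x. g x \<partial>lborel)"
    using double_segment_integral_le[of g Q] by simp
  also have "\<dots> = ennreal (2 ^ CARD('n) * V * (d\<^sup>2 * E))"
  proof -
    have "(2::ennreal) ^ CARD('n) = ennreal (2 ^ CARD('n))" using ennreal_power[of 2 "CARD('n)"] by simp
    then show ?thesis unfolding gi Qe V_def[symmetric] using V0 E0 by (simp only: ennreal_mult) (simp add: ennreal_mult)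
  qed
  finally have "2 * V * A - 2 * B\<^sup>2 \<le> 2 ^ CARD('n) * V * (d\<^sup>2 * E)"
    using V0 E0 by (subst (asm) ennreal_le_iff) auto
  moreover have "0 \<le> 2 ^ CARD('n) * V * (d\<^sup>2 * E)" using V0 E0 by simp
  ultimately have "V * A \<le> B\<^sup>2 + 2 ^ CARD('n) * V * (d\<^sup>2 * E)" by linarith
  then show ?thesis by (simp add: V_def A_def B_def E_def mult_ac)
qed

section \<open>Positive definite matrices\<close>

definition pos_def :: "real^'n^'n \<Rightarrow> bool" where
  "pos_def M \<longleftrightarrow> transpose M = M \<and> (\<forall>v. v \<noteq> 0 \<longrightarrow> v \<bullet> (M *v v) > 0)"

lemma pos_def_invertible: "pos_def M \<Longrightarrow> invertible M"
  unfolding invertible_left_inverse matrix_left_invertible_ker pos_def_def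
  by (metis inner_zero_right less_irrefl)

lemma matrix_inv_mult:
  fixes M :: "real^'n^'n"
  assumes "invertible M" shows "M ** matrix_inv M = mat 1" "matrix_inv M ** M = mat 1"
proof -
  have "\<exists>B. M ** B = mat 1 \<and> B ** M = mat 1" using assms by (simp add: invertible_def)
  from someI_ex[OF this] show "M ** matrix_inv M = mat 1" "matrix_inv M ** M = mat 1"
    by (auto simp: matrix_inv_def)
qed

lemma pos_def_inverse:
  assumes "pos_def M"
  shows "M ** matrix_inv M = mat 1" "matrix_inv M ** M = mat 1"
  using matrix_inv_mult[OF pos_def_invertible[OF assms]] by auto

text \<open>
  Along the segment from the identity to \<open>M\<close> all matrices are positive definite, so the determinant does not change sign.
\<close>

lemma pos_def_det:
  fixes M :: "real^'n^'n"
  assumes M: "pos_def M" shows "det M > 0"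
proof (rule ccontr)
  assume neg: "\<not> det M > 0"
  define H where "H t = (\<chi> i j. (1 - t) * (mat 1 :: real^'n^'n) $ i $ j + t * M $ i $ j)" for t :: real
  have H_eq: "H t = (1 - t) *\<^sub>R mat 1 + t *\<^sub>R M" for t
    by (simp add: H_def vec_eq_iff)
  have H_v: "v \<bullet> (H t *v v) = (1 - t) * (v \<bullet> v) + t * (v \<bullet> (M *v v))" for t v
    by (simp add: H_eq matrix_vector_mult_add_rdistrib scaleR_matrix_vector_assoc[symmetric] inner_add_right)
  have pd: "v \<bullet> (H t *v v) > 0" if "v \<noteq> 0" "0 \<le> t" "t \<le> 1" for t v
  proof (cases "t = 0")
    case False
    have "v \<bullet> (M *v v) > 0" using M that by (simp add: pos_def_def)
    then have "t * (v \<bullet> (M *v v)) > 0" using False that by simp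
    moreover have "(1 - t) * (v \<bullet> v) \<ge> 0" using that by simp
    ultimately show ?thesis unfolding H_v by linarith
  qed (use that in \<open>simp add: H_v\<close>)
  have nz: "det (H t) \<noteq> 0" if "0 \<le> t" "t \<le> 1" for t
  proof -
    have "invertible (H t)"
      unfolding invertible_left_inverse matrix_left_invertible_ker
      using pd[OF _ that] by (metis inner_zero_right less_irrefl)
    then show ?thesis by (simp add: invertible_det_nz)
  qed
  have cont: "continuous_on {0..1} (\<lambda>t. det (H t))"
    unfolding det_def H_def by (auto intro!: continuous_intros)
  have "det (H 0) = 1" "det (H 1) = det M" by (auto simp: H_eq)
  then have "\<exists>t\<ge>0. t \<le> 1 \<and> det (H t) = 0"
    using IVT2'[of "\<lambda>t. det (H t)" 1 0 0] neg cont by auto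
  then show False using nz by blast
qed

text \<open>
  Cramer's rule shows that the entries of the inverse depend smoothly on the matrix.
\<close>

lemma matrix_inv_nth:
  fixes M :: "real^'n^'n"
  assumes "invertible M"
  shows "matrix_inv M $ i $ j = det (\<chi> k l. if l = i then axis j 1 $ k else M $ k $ l) / det M"
proof -
  have d: "det M \<noteq> 0" using assms by (simp add: invertible_det_nz)
  have "M *v (matrix_inv M *v axis j 1) = axis j 1"
    using matrix_inv_mult[OF assms] by (simp add: matrix_vector_mul_assoc)
  then have "matrix_inv M *v axis j 1 = (\<chi> k. det (\<chi> p q. if q = k then axis j 1 $ p else M $ p $ q) / det M)"
    using cramer[OF d] by blast
  then have "(matrix_inv M *v axis j 1) $ i = det (\<chi> k l. if l = i then axis j 1 $ k else M $ k $ l) / det M"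
    by simp
  then show ?thesis by (simp add: matrix_vector_mult_basis column_def)
qed

lemma pos_def_matrix_inv_symmetric:
  assumes "pos_def M" shows "x \<bullet> (matrix_inv M *v y) = y \<bullet> (matrix_inv M *v x)"
proof -
  let ?a = "matrix_inv M *v x" and ?b = "matrix_inv M *v y"
  have "M *v ?a = x" "M *v ?b = y"
    using pos_def_inverse[OF assms] by (simp_all add: matrix_vector_mul_assoc)
  moreover have "(M *v ?a) \<bullet> ?b = ?a \<bullet> (M *v ?b)"
    using assms by (simp add: pos_def_def dot_lmul_matrix[symmetric] flip: matrix_transpose_mul)
      (metis dot_lmul_matrix inner_commute transpose_matrix_vector)
  ultimately show ?thesis by (simp add: inner_commute)
qed

lemma pos_def_matrix_inv_pos:
  assumes "pos_def M" "x \<noteq> 0" shows "x \<bullet> (matrix_inv M *v x) > 0"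
proof -
  let ?a = "matrix_inv M *v x"
  have a: "M *v ?a = x" using pos_def_inverse[OF assms(1)] by (simp add: matrix_vector_mul_assoc)
  then have "?a \<noteq> 0" using assms(2) by auto
  then have "?a \<bullet> (M *v ?a) > 0" using assms(1) by (simp add: pos_def_def)
  then show ?thesis by (simp add: a inner_commute)
qed

lemma pos_def_matrix_inv_nonneg: "pos_def M \<Longrightarrow> 0 \<le> x \<bullet> (matrix_inv M *v x)"
  using pos_def_matrix_inv_pos[of M x] by (cases "x = 0") auto

text \<open>
  Under a change of coordinates with Jacobian \<open>J\<close>, metrics transform as in the hypothesis and gradients by the
  transpose of \<open>J\<close>. Thus the form of the inverse metric on gradients does not depend on the coordinates.
\<close>

lemma matrix_inv_congruence:
  fixes M N J :: "real^'n^'n"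
  assumes M: "pos_def M" and N: "pos_def N" and eq: "M = transpose J ** N ** J"
  shows "(transpose J *v a) \<bullet> (matrix_inv M *v (transpose J *v b)) = a \<bullet> (matrix_inv N *v b)"
proof -
  have "det M = det J * det N * det J" unfolding eq by (simp add: det_mul)
  then have "det J \<noteq> 0" using pos_def_det[OF M] by auto
  then have J: "invertible J" by (simp add: invertible_det_nz)
  define z where "z = matrix_inv J *v (matrix_inv N *v b)"
  have Jz: "J *v z = matrix_inv N *v b"
    using matrix_inv_mult[OF J] by (simp add: z_def matrix_vector_mul_assoc matrix_mul_assoc)
  have "M *v z = transpose J *v (N *v (J *v z))"
    unfolding eq by (simp add: matrix_vector_mul_assoc matrix_mul_assoc)
  also have "N *v (J *v z) = b"
    using pos_def_inverse[OF N] by (simp add: Jz matrix_vector_mul_assoc)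
  finally have "matrix_inv M *v (transpose J *v b) = matrix_inv M *v (M *v z)" by simp
  also have "\<dots> = z" using pos_def_inverse[OF M] by (simp add: matrix_vector_mul_assoc)
  finally have "(transpose J *v a) \<bullet> (matrix_inv M *v (transpose J *v b)) = (transpose J *v a) \<bullet> z" by simp
  also have "\<dots> = a \<bullet> (J *v z)" by (metis dot_lmul_matrix transpose_matrix_vector)
  finally show ?thesis by (simp add: Jz)
qed

lemma Ck_on_det:
  assumes "open S" "\<And>i j. Ck_on k S (\<lambda>x. M x $ i $ j)"
  shows "Ck_on k S (\<lambda>x. det (M x))"
  unfolding det_def by (intro Ck_on_sum Ck_on_mult Ck_on_prod Ck_on_const assms)

lemma Ck_on_matrix_inv:
  fixes M :: "real^'m \<Rightarrow> real^'n^'n"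
  assumes S: "open S" and M: "\<And>i j. Ck_on k S (\<lambda>x. M x $ i $ j)" and inv: "\<And>x. x \<in> S \<Longrightarrow> invertible (M x)"
  shows "Ck_on k S (\<lambda>x. matrix_inv (M x) $ i $ j)"
proof -
  have "Ck_on k S (\<lambda>x. if l = i then axis j 1 $ p else M x $ p $ l)" for p l
    by (cases "l = i") (auto intro: Ck_on_const S M)
  then have d: "Ck_on k S (\<lambda>x. det (\<chi> p l. if l = i then axis j 1 $ p else M x $ p $ l))"
    by (intro Ck_on_det S) simp
  have "Ck_on k S (\<lambda>x. det (\<chi> p l. if l = i then axis j 1 $ p else M x $ p $ l) * inverse (det (M x)))"
    using inv by (intro Ck_on_mult[OF S d] Ck_on_inverse Ck_on_det S M) (auto simp: invertible_det_nz)
  then show ?thesis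
    by (subst Ck_on_cong[OF S, of _ "\<lambda>x. det (\<chi> p l. if l = i then axis j 1 $ p else M x $ p $ l) * inverse (det (M x))"])
      (auto simp: matrix_inv_nth inv divide_inverse)
qed

lemma Ck_on_Un:
  assumes "open S" "open T"
  shows "Ck_on k S f \<Longrightarrow> Ck_on k T f \<Longrightarrow> Ck_on k (S \<union> T) f"
  by (induction k arbitrary: f) (auto intro: continuous_on_open_Un assms)

section \<open>Smooth functions on a compact manifold\<close>

text \<open>
  The measure is a constant multiple of the Riemannian volume, as for the normalized volume. The factor \<open>\<kappa>\<close>
  only rescales all inner products.
\<close>

locale weighted_manifold =
  fixes A :: "('a::t2_space, 'n::finite) chart set" and G :: "('a, 'n) metric"
    and \<nu> :: "'a measure" and \<kappa> :: real
  assumes compact_M: "compact (UNIV :: 'a set)"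
    and atlas: "smooth_atlas A" and metric: "riemannian_metric A G"
    and sets_nu: "sets \<nu> = sets borel" and finite_nu: "finite_measure \<nu>" and kappa_pos: "\<kappa> > 0"
    and volume: "c \<in> A \<Longrightarrow> B \<in> sets borel \<Longrightarrow> B \<subseteq> chart_dom c \<Longrightarrow>
      emeasure \<nu> B = ennreal \<kappa> * (\<integral>\<^sup>+x\<in>chart_map c ` B. ennreal (sqrt (det (G c x))) \<partial>lborel)"
begin

lemma space_nu [simp]: "space \<nu> = UNIV"
  using sets_eq_imp_space_eq[OF sets_nu] by simp

lemma measurable_nu [simp]: "borel_measurable \<nu> = borel_measurable borel"
  using sets_nu by (intro measurable_cong_sets) auto

abbreviation smooth :: "('a \<Rightarrow> real) set" where "smooth \<equiv> smooth_functions A"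

definition rep :: "('a, 'n) chart \<Rightarrow> ('a \<Rightarrow> real) \<Rightarrow> real^'n \<Rightarrow> real" where
  "rep c u = u \<circ> chart_inv c"

definition overlap :: "('a, 'n) chart \<Rightarrow> ('a, 'n) chart \<Rightarrow> (real^'n) set" where
  "overlap c d = chart_map c ` (chart_dom c \<inter> chart_dom d)"

context
  fixes c :: "('a, 'n) chart"
  assumes c: "c \<in> A"
begin

lemma chart_c: "is_chart c"
  using atlas c by (simp add: smooth_atlas_def)

lemma chart_open: "open (chart_dom c)" "open (chart_image c)"
  using chart_c by (auto simp: is_chart_def)

lemma chart_homeo: "homeomorphism (chart_dom c) (chart_image c) (chart_map c) (chart_inv c)"
  using chart_c by (simp add: is_chart_def)

lemma chart_inv_map [simp]: "p \<in> chart_dom c \<Longrightarrow> chart_inv c (chart_map c p) = p"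
  using chart_homeo by (simp add: homeomorphism_def)

lemma chart_map_inv [simp]: "x \<in> chart_image c \<Longrightarrow> chart_map c (chart_inv c x) = x"
  using chart_homeo by (simp add: homeomorphism_def)

lemma chart_map_image [simp]: "p \<in> chart_dom c \<Longrightarrow> chart_map c p \<in> chart_image c"
  by (simp add: chart_image_def)

lemma chart_inv_dom [simp]: "x \<in> chart_image c \<Longrightarrow> chart_inv c x \<in> chart_dom c"
  using chart_homeo by (auto simp: homeomorphism_def)

lemma chart_cont: "continuous_on (chart_dom c) (chart_map c)" "continuous_on (chart_image c) (chart_inv c)"
  using chart_homeo by (auto simp: homeomorphism_def)

lemma open_chart_preimage:
  assumes "open X" "X \<subseteq> chart_image c" shows "open (chart_inv c ` X)"
proof -
  have "chart_inv c ` X = chart_dom c \<inter> chart_map c -` X"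
    using assms(2) by (force simp: image_iff)
  then show ?thesis
    using continuous_open_preimage[OF chart_cont(1) chart_open(1) assms(1)] by simp
qed

lemma open_chart_map_image:
  assumes "open X" "X \<subseteq> chart_dom c" shows "open (chart_map c ` X)"
proof -
  have "chart_map c ` X = chart_image c \<inter> chart_inv c -` X"
    using assms(2) by (force simp: image_iff)
  then show ?thesis
    using continuous_open_preimage[OF chart_cont(2) chart_open(2) assms(1)] by simp
qed

lemma smooth_rep: "u \<in> smooth \<Longrightarrow> Ck_on k (chart_image c) (rep c u)"
  using c by (simp add: smooth_functions_def smooth_on_def rep_def)

lemma compact_chart_inv: "compact K \<Longrightarrow> K \<subseteq> chart_image c \<Longrightarrow> compact (chart_inv c ` K)"
  using chart_cont(2) by (blast intro: compact_continuous_image continuous_on_subset)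

lemma metric_smooth: "Ck_on k (chart_image c) (\<lambda>x. G c x $ i $ j)"
  using metric c by (simp add: riemannian_metric_def smooth_on_def)

lemma metric_pos_def: "x \<in> chart_image c \<Longrightarrow> pos_def (G c x)"
  using metric c by (simp add: riemannian_metric_def pos_def_def)

end

definition wt :: "('a, 'n) chart \<Rightarrow> real^'n \<Rightarrow> real" where
  "wt c x = sqrt (det (G c x))"

lemma open_overlap: "c \<in> A \<Longrightarrow> d \<in> A \<Longrightarrow> open (overlap c d)"
  unfolding overlap_def by (intro open_chart_map_image open_Int chart_open) auto

lemma transition_smooth:
  "c \<in> A \<Longrightarrow> d \<in> A \<Longrightarrow> Ck_on k (overlap c d) (\<lambda>x. transition c d x $ i)"
  using atlas by (simp add: smooth_atlas_def smooth_on_def overlap_def)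

lemma wt_pos: "c \<in> A \<Longrightarrow> x \<in> chart_image c \<Longrightarrow> wt c x > 0"
  using pos_def_det[OF metric_pos_def] by (simp add: wt_def)

lemma wt_smooth: "c \<in> A \<Longrightarrow> Ck_on k (chart_image c) (wt c)"
  unfolding wt_def[abs_def] using pos_def_det[OF metric_pos_def]
  by (intro Ck_on_sqrt Ck_on_det chart_open metric_smooth)

lemma metric_inv_smooth: "c \<in> A \<Longrightarrow> Ck_on k (chart_image c) (\<lambda>x. matrix_inv (G c x) $ i $ j)"
  using pos_def_invertible[OF metric_pos_def] by (intro Ck_on_matrix_inv chart_open metric_smooth)

lemma charts_cover: obtains c where "c \<in> A" "p \<in> chart_dom c"
  using atlas unfolding smooth_atlas_def by blast

lemma smoothI: "(\<And>c k. c \<in> A \<Longrightarrow> Ck_on k (chart_image c) (rep c u)) \<Longrightarrow> u \<in> smooth"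
  by (simp add: smooth_functions_def smooth_on_def rep_def)

lemma smooth_continuous:
  assumes u: "u \<in> smooth" shows "continuous_on UNIV u"
proof -
  have "continuous_on (chart_dom c) u" if c: "c \<in> A" for c
  proof -
    have "continuous_on (chart_dom c) (\<lambda>p. rep c u (chart_map c p))"
      using Ck_on_continuous[OF smooth_rep[OF c u, of 0]] chart_cont(1)[OF c]
      by (rule continuous_on_compose2) (use chart_map_image[OF c] in auto)
    then show ?thesis
      by (rule continuous_on_eq) (simp add: rep_def c)
  qed
  then have "continuous_on (\<Union>c\<in>A. chart_dom c) u"
    using chart_open(1) by (intro continuous_on_open_UN) auto
  then show ?thesis using atlas by (simp add: smooth_atlas_def)
qed

lemma continuous_integrable:
  fixes f :: "'a \<Rightarrow> real"
  assumes f: "continuous_on UNIV f" shows "integrable \<nu> f"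
proof -
  interpret finite_measure \<nu> by (rule finite_nu)
  obtain B where "\<And>p. norm (f p) \<le> B"
    using compact_imp_bounded[OF compact_continuous_image[OF f compact_M]] by (auto simp: bounded_iff)
  moreover have "f \<in> borel_measurable \<nu>" using f by (simp add: borel_measurable_continuous_onI)
  ultimately show ?thesis by (intro integrable_const_bound) auto
qed

lemma continuous_L2: "continuous_on UNIV f \<Longrightarrow> f \<in> L2_space \<nu>"
  unfolding L2_space_def by (auto intro!: continuous_integrable continuous_intros borel_measurable_continuous_onI)

lemma smooth_const: "(\<lambda>_. a) \<in> smooth"
  by (rule smoothI) (simp add: rep_def o_def Ck_on_const chart_open)

lemma smooth_add: "u \<in> smooth \<Longrightarrow> v \<in> smooth \<Longrightarrow> (\<lambda>p. u p + v p) \<in> smooth"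
  by (rule smoothI) (use Ck_on_add[OF chart_open(2) smooth_rep smooth_rep] in \<open>simp add: rep_def o_def\<close>)

lemma smooth_mult: "u \<in> smooth \<Longrightarrow> v \<in> smooth \<Longrightarrow> (\<lambda>p. u p * v p) \<in> smooth"
  by (rule smoothI) (use Ck_on_mult[OF chart_open(2) smooth_rep smooth_rep] in \<open>simp add: rep_def o_def\<close>)

lemma smooth_inverse: "u \<in> smooth \<Longrightarrow> (\<And>p. u p \<noteq> 0) \<Longrightarrow> (\<lambda>p. inverse (u p)) \<in> smooth"
  by (rule smoothI) (use Ck_on_inverse[OF chart_open(2) _ smooth_rep] in \<open>simp add: rep_def o_def\<close>)

lemma smooth_sum: "(\<And>i. i \<in> I \<Longrightarrow> u i \<in> smooth) \<Longrightarrow> (\<lambda>p. \<Sum>i\<in>I. u i p) \<in> smooth"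
  by (induction I rule: infinite_finite_induct) (auto intro: smooth_const smooth_add)

lemma subspace_smooth: "subspace smooth"
proof (rule subspaceI)
  show "0 \<in> smooth" using smooth_const[of 0] by (simp add: zero_fun_def)
  show "u + v \<in> smooth" if "u \<in> smooth" "v \<in> smooth" for u v
    using smooth_add[OF that] by (simp add: plus_fun_def)
  show "a *\<^sub>R u \<in> smooth" if "u \<in> smooth" for a u
    using smooth_mult[OF smooth_const that] by (simp add: scaleR_fun_def)
qed

lemma smooth_L2: "u \<in> smooth \<Longrightarrow> u \<in> L2_space \<nu>"
  by (intro continuous_L2 smooth_continuous)

definition chart_ext :: "('a, 'n) chart \<Rightarrow> (real^'n \<Rightarrow> real) \<Rightarrow> 'a \<Rightarrow> real" where
  "chart_ext c \<beta> p = (if p \<in> chart_dom c then \<beta> (chart_map c p) else 0)"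

text \<open>
  In another chart, the extension by zero is smooth on the overlap of the charts and vanishes off the
  compact, hence closed, image of \<open>K\<close>; these two open sets cover the chart.
\<close>

lemma chart_ext_smooth:
  assumes c: "c \<in> A" and \<beta>: "\<And>k. Ck_on k (chart_image c) \<beta>"
    and K: "compact K" "K \<subseteq> chart_image c" "\<And>x. x \<notin> K \<Longrightarrow> \<beta> x = 0"
  shows "chart_ext c \<beta> \<in> smooth"
proof (rule smoothI)
  fix d k assume d: "d \<in> A"
  let ?T = "chart_map d ` (chart_dom d - chart_inv c ` K)"
  have closedK: "closed (chart_inv c ` K)"
    using compact_chart_inv[OF c K(1,2)] by (rule compact_imp_closed)
  have oT: "open ?T" using chart_open(1)[OF d] closedK by (intro open_chart_map_image d) auto
  have cover: "overlap d c \<union> ?T = chart_image d"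
  proof -
    have "chart_inv c ` K \<subseteq> chart_dom c" using K(2) chart_inv_dom[OF c] by auto
    then have "(chart_dom d \<inter> chart_dom c) \<union> (chart_dom d - chart_inv c ` K) = chart_dom d" by auto
    then show ?thesis unfolding overlap_def chart_image_def image_Un[symmetric] by simp
  qed
  have "Ck_on k (overlap d c) (\<lambda>x. \<beta> (\<chi> i. transition d c x $ i))"
  proof (rule Ck_on_compose[OF open_overlap[OF d c] transition_smooth[OF d c] _ \<beta>])
    fix x assume "x \<in> overlap d c"
    then show "(\<chi> i. transition d c x $ i) \<in> chart_image c"
      using c d by (auto simp: overlap_def transition_def)
  qed
  then have 1: "Ck_on k (overlap d c) (rep d (chart_ext c \<beta>))"
    by (subst Ck_on_cong[OF open_overlap[OF d c], of _ "\<lambda>x. \<beta> (\<chi> i. transition d c x $ i)"])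
      (auto simp: rep_def chart_ext_def overlap_def transition_def d)
  have 2: "Ck_on k ?T (rep d (chart_ext c \<beta>))"
  proof (subst Ck_on_cong[OF oT, of _ "\<lambda>_. 0"])
    fix x assume "x \<in> ?T"
    then obtain p where p: "x = chart_map d p" "p \<in> chart_dom d" "p \<notin> chart_inv c ` K" by auto
    have "chart_map c p \<notin> K" if "p \<in> chart_dom c"
      using p(3) that chart_inv_map[OF c that] by (metis image_eqI)
    then show "rep d (chart_ext c \<beta>) x = 0"
      using p K(3) d by (simp add: rep_def chart_ext_def)
  qed (rule Ck_on_const[OF oT])
  show "Ck_on k (chart_image d) (rep d (chart_ext c \<beta>))"
    using Ck_on_Un[OF open_overlap[OF d c] oT 1 2] by (simp add: cover)
qed

lemma chart_bump_smooth:
  assumes "c \<in> A" "cbox a b \<subseteq> chart_image c" "r > 0"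
  shows "chart_ext c (box_bump a b r) \<in> smooth"
proof (rule chart_ext_smooth[OF assms(1) _ compact_cbox assms(2)])
  show "Ck_on k (chart_image c) (box_bump a b r)" for k using chart_open(2)[OF assms(1)] by (rule Ck_on_box_bump)
  show "box_bump a b r x = 0" if "x \<notin> cbox a b" for x
    using that box_subset_cbox[of a b] assms(3) by (intro box_bump_zero) auto
qed

section \<open>Integration in a chart\<close>

definition chart_density :: "('a, 'n) chart \<Rightarrow> real^'n \<Rightarrow> real" where
  "chart_density c x = indicator (chart_image c) x * (\<kappa> * wt c x)"

text \<open>
  Unlike \<open>chart_inv\<close>, whose values outside the image of the chart are arbitrary, this is Borel measurable on
  the whole space, so that measures can be pushed forward along it.
\<close>

definition chart_inv' :: "('a, 'n) chart \<Rightarrow> real^'n \<Rightarrow> 'a" where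
  "chart_inv' c x = (if x \<in> chart_image c then chart_inv c x else undefined)"

lemma chart_density_nonneg: "c \<in> A \<Longrightarrow> 0 \<le> chart_density c x"
  using wt_pos[of c x] kappa_pos by (auto simp: chart_density_def indicator_def)

lemma chart_density_pos: "c \<in> A \<Longrightarrow> x \<in> chart_image c \<Longrightarrow> 0 < chart_density c x"
  using wt_pos[of c x] kappa_pos by (auto simp: chart_density_def)

lemma borel_measurable_indicator_continuous:
  fixes f :: "'b::topological_space \<Rightarrow> real"
  assumes "open S" "continuous_on S f"
  shows "(\<lambda>x. indicator S x * f x) \<in> borel_measurable borel"
  using borel_measurable_continuous_on_indicator[OF _ assms(2)] assms(1) by simp

lemma chart_density_measurable [measurable]: "c \<in> A \<Longrightarrow> chart_density c \<in> borel_measurable borel"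
  unfolding chart_density_def[abs_def]
  using Ck_on_continuous[OF wt_smooth]
  by (intro borel_measurable_indicator_continuous chart_open continuous_intros) auto

lemma chart_inv'_measurable [measurable]:
  assumes c: "c \<in> A" shows "chart_inv' c \<in> borel_measurable borel"
  unfolding chart_inv'_def[abs_def]
  using borel_measurable_continuous_on_restrict[OF chart_cont(2)[OF c]] chart_open(2)[OF c]
  by (subst measurable_restrict_space_iff[symmetric]) auto

lemma chart_measure:
  assumes c: "c \<in> A"
  shows "density \<nu> (\<lambda>p. ennreal (indicator (chart_dom c) p)) =
    distr (density lborel (\<lambda>x. ennreal (chart_density c x))) borel (chart_inv' c)"
proof (rule measure_eqI)
  show "sets (density \<nu> (\<lambda>p. ennreal (indicator (chart_dom c) p))) =
      sets (distr (density lborel (\<lambda>x. ennreal (chart_density c x))) borel (chart_inv' c))"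
    by (simp add: sets_nu)
  fix B assume "B \<in> sets (density \<nu> (\<lambda>p. ennreal (indicator (chart_dom c) p)))"
  then have B: "B \<in> sets borel" by (simp add: sets_nu)
  have U: "chart_dom c \<in> sets borel" using chart_open(1)[OF c] by simp
  have "emeasure (density \<nu> (\<lambda>p. ennreal (indicator (chart_dom c) p))) B =
      (\<integral>\<^sup>+p. indicator (chart_dom c \<inter> B) p \<partial>\<nu>)"
    using B U sets_nu by (subst emeasure_density) (auto simp del: nn_integral_indicator intro!: nn_integral_cong split: split_indicator)
  also have "\<dots> = emeasure \<nu> (chart_dom c \<inter> B)"
    using B U sets_nu by (intro nn_integral_indicator) auto
  also have "\<dots> = ennreal \<kappa> * (\<integral>\<^sup>+x\<in>chart_map c ` (chart_dom c \<inter> B). ennreal (sqrt (det (G c x))) \<partial>lborel)"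
    using B U by (intro volume c) auto
  also have "\<dots> = ennreal \<kappa> * (\<integral>\<^sup>+x. ennreal (1 / \<kappa>) * (ennreal (chart_density c x) * indicator (chart_inv' c -` B) x) \<partial>lborel)"
  proof (intro arg_cong[where f = "(*) (ennreal \<kappa>)"] nn_integral_cong)
    fix x
    have "x \<in> chart_map c ` (chart_dom c \<inter> B) \<longleftrightarrow> x \<in> chart_image c \<and> chart_inv' c x \<in> B"
      using c by (force simp: chart_image_def chart_inv'_def image_iff)
    moreover have "ennreal (1 / \<kappa>) * ennreal (\<kappa> * wt c x) = ennreal (wt c x)" if "x \<in> chart_image c"
      using kappa_pos wt_pos[OF c that] by (simp flip: ennreal_mult)
    ultimately show "ennreal (sqrt (det (G c x))) * indicator (chart_map c ` (chart_dom c \<inter> B)) x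
        = ennreal (1 / \<kappa>) * (ennreal (chart_density c x) * indicator (chart_inv' c -` B) x)"
      by (auto simp: chart_density_def wt_def split: split_indicator)
  qed
  also have "\<dots> = (ennreal \<kappa> * ennreal (1 / \<kappa>)) * (\<integral>\<^sup>+x. ennreal (chart_density c x) * indicator (chart_inv' c -` B) x \<partial>lborel)"
    using measurable_sets[OF chart_inv'_measurable[OF c] B] chart_density_measurable[OF c]
    by (subst nn_integral_cmult) (auto simp: mult.assoc)
  also have "ennreal \<kappa> * ennreal (1 / \<kappa>) = 1" using kappa_pos by (simp flip: ennreal_mult)
  also have "1 * (\<integral>\<^sup>+x. ennreal (chart_density c x) * indicator (chart_inv' c -` B) x \<partial>lborel)
      = (\<integral>\<^sup>+x. ennreal (chart_density c x) * indicator (chart_inv' c -` B) x \<partial>lborel)" by simp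
  also have "\<dots> = emeasure (density lborel (\<lambda>x. ennreal (chart_density c x))) (chart_inv' c -` B)"
    using measurable_sets[OF chart_inv'_measurable[OF c] B] chart_density_measurable[OF c]
    by (intro emeasure_density[symmetric]) auto
  also have "\<dots> = emeasure (distr (density lborel (\<lambda>x. ennreal (chart_density c x))) borel (chart_inv' c)) B"
    using B chart_inv'_measurable[OF c] by (subst emeasure_distr) auto
  finally show "emeasure (density \<nu> (\<lambda>p. ennreal (indicator (chart_dom c) p))) B =
      emeasure (distr (density lborel (\<lambda>x. ennreal (chart_density c x))) borel (chart_inv' c)) B" .
qed

lemma chart_integral_measurable:
  fixes f :: "'a \<Rightarrow> real"
  assumes c: "c \<in> A" and f: "f \<in> borel_measurable borel"
  shows "integrable \<nu> (\<lambda>p. indicator (chart_dom c) p * f p) \<longleftrightarrow> integrable lborel (\<lambda>x. chart_density c x * f (chart_inv' c x))"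
    and "(LINT p|\<nu>. indicator (chart_dom c) p * f p) = (LINT x|lborel. chart_density c x * f (chart_inv' c x))"
proof -
  note [measurable] = chart_inv'_measurable[OF c] chart_density_measurable[OF c] f
  have U: "chart_dom c \<in> sets borel" using chart_open(1)[OF c] by simp
  have fc: "(\<lambda>x. f (chart_inv' c x)) \<in> borel_measurable borel" by measurable
  have "integrable \<nu> (\<lambda>p. indicator (chart_dom c) p *\<^sub>R f p) \<longleftrightarrow> integrable (density \<nu> (\<lambda>p. ennreal (indicator (chart_dom c) p))) f"
    using U f by (intro integrable_density[symmetric]) auto
  also have "\<dots> \<longleftrightarrow> integrable (density lborel (\<lambda>x. ennreal (chart_density c x))) (\<lambda>x. f (chart_inv' c x))"
    unfolding chart_measure[OF c] using f by (intro integrable_distr_eq) auto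
  also have "\<dots> \<longleftrightarrow> integrable lborel (\<lambda>x. chart_density c x *\<^sub>R f (chart_inv' c x))"
    using fc chart_density_nonneg[OF c] by (intro integrable_density) auto
  finally show "integrable \<nu> (\<lambda>p. indicator (chart_dom c) p * f p) \<longleftrightarrow> integrable lborel (\<lambda>x. chart_density c x * f (chart_inv' c x))"
    by simp
  have "(LINT p|\<nu>. indicator (chart_dom c) p *\<^sub>R f p) = integral\<^sup>L (density \<nu> (\<lambda>p. ennreal (indicator (chart_dom c) p))) f"
    using U f by (intro integral_density[symmetric]) auto
  also have "\<dots> = integral\<^sup>L (density lborel (\<lambda>x. ennreal (chart_density c x))) (\<lambda>x. f (chart_inv' c x))"
    unfolding chart_measure[OF c] using f by (intro integral_distr) auto
  also have "\<dots> = (LINT x|lborel. chart_density c x *\<^sub>R f (chart_inv' c x))"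
    using fc chart_density_nonneg[OF c] by (intro integral_density) auto
  finally show "(LINT p|\<nu>. indicator (chart_dom c) p * f p) = (LINT x|lborel. chart_density c x * f (chart_inv' c x))"
    by simp
qed

text \<open>Integrals over a chart domain, for integrands that need only be measurable on that domain.\<close>

lemma chart_integral:
  fixes f :: "'a \<Rightarrow> real"
  assumes c: "c \<in> A" and f: "(\<lambda>p. indicator (chart_dom c) p * f p) \<in> borel_measurable borel"
  shows "integrable \<nu> (\<lambda>p. indicator (chart_dom c) p * f p) \<longleftrightarrow> integrable lborel (\<lambda>x. chart_density c x * f (chart_inv c x))"
    and "(LINT p|\<nu>. indicator (chart_dom c) p * f p) = (LINT x|lborel. chart_density c x * f (chart_inv c x))"
proof -
  have e: "chart_density c x * (indicator (chart_dom c) (chart_inv' c x) * f (chart_inv' c x)) = chart_density c x * f (chart_inv c x)" for x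
    using c by (cases "x \<in> chart_image c") (auto simp: chart_density_def chart_inv'_def)
  have i: "indicator (chart_dom c) p * (indicator (chart_dom c) p * f p) = indicator (chart_dom c) p * f p" for p
    by (auto split: split_indicator)
  show "integrable \<nu> (\<lambda>p. indicator (chart_dom c) p * f p) \<longleftrightarrow> integrable lborel (\<lambda>x. chart_density c x * f (chart_inv c x))"
    and "(LINT p|\<nu>. indicator (chart_dom c) p * f p) = (LINT x|lborel. chart_density c x * f (chart_inv c x))"
    using chart_integral_measurable[OF c f] by (simp_all add: e i)
qed

lemma chart_AE:
  assumes c: "c \<in> A" and P: "Measurable.pred borel P"
    and ae: "AE x in lborel. x \<in> chart_image c \<longrightarrow> P (chart_inv c x)"
  shows "AE p in \<nu>. p \<in> chart_dom c \<longrightarrow> P p"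
proof -
  note [measurable] = chart_inv'_measurable[OF c] chart_density_measurable[OF c] P
  have "AE x in lborel. 0 < ennreal (chart_density c x) \<longrightarrow> P (chart_inv' c x)"
    using ae by eventually_elim (auto simp: chart_density_def chart_inv'_def split: split_indicator_asm)
  then have "AE x in density lborel (\<lambda>x. ennreal (chart_density c x)). P (chart_inv' c x)"
    by (subst AE_density) auto
  then have "AE p in distr (density lborel (\<lambda>x. ennreal (chart_density c x))) borel (chart_inv' c). P p"
    by (subst AE_distr_iff) auto
  then have "AE p in density \<nu> (\<lambda>p. ennreal (indicator (chart_dom c) p)). P p"
    by (simp only: chart_measure[OF c])
  then have "AE p in \<nu>. 0 < ennreal (indicator (chart_dom c) p) \<longrightarrow> P p"
    using chart_open(1)[OF c] by (subst (asm) AE_density) auto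
  then show ?thesis by eventually_elim (auto simp: indicator_def)
qed

section \<open>Green's formula in a chart\<close>

definition grad :: "(real^'n \<Rightarrow> real) \<Rightarrow> real^'n \<Rightarrow> real^'n" where
  "grad u x = (\<chi> i. partial_deriv i u x)"

text \<open>
  The gradient form \<open>\<langle>\<nabla>u, \<nabla>v\<rangle>\<close> in coordinates.
\<close>

definition gam :: "('a, 'n) chart \<Rightarrow> (real^'n \<Rightarrow> real) \<Rightarrow> (real^'n \<Rightarrow> real) \<Rightarrow> real^'n \<Rightarrow> real" where
  "gam c u v x = grad u x \<bullet> (matrix_inv (G c x) *v grad v x)"

text \<open>
  The components of \<open>\<nabla>w\<close> times the volume density: the vector field whose Euclidean divergence is the density times the Laplacian.
\<close>

definition flux :: "('a, 'n) chart \<Rightarrow> (real^'n \<Rightarrow> real) \<Rightarrow> 'n \<Rightarrow> real^'n \<Rightarrow> real" where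
  "flux c w i x = wt c x * (\<Sum>j\<in>UNIV. matrix_inv (G c x) $ i $ j * partial_deriv j w x)"

lemma laplace_coord_flux: "laplace_coord (G c) w x = (\<Sum>i\<in>UNIV. partial_deriv i (flux c w i) x) / wt c x"
  by (simp add: laplace_coord_def flux_def[abs_def] wt_def)

lemma gam_flux: "c \<in> A \<Longrightarrow> gam c u w x * wt c x = (\<Sum>i\<in>UNIV. partial_deriv i u x * flux c w i x)"
  by (simp add: gam_def grad_def flux_def inner_vec_def matrix_vector_mult_def sum_distrib_left sum_distrib_right mult_ac)

lemma flux_smooth:
  assumes c: "c \<in> A" and w: "\<And>k. Ck_on k (chart_image c) w"
  shows "Ck_on k (chart_image c) (flux c w i)"
proof -
  have "Ck_on k (chart_image c) (partial_deriv j w)" for j using w[of "Suc k"] by simp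
  then show ?thesis unfolding flux_def[abs_def]
    by (intro Ck_on_mult Ck_on_sum chart_open wt_smooth metric_inv_smooth c)
qed

lemma laplace_coord_continuous:
  assumes c: "c \<in> A" and w: "\<And>k. Ck_on k (chart_image c) w"
  shows "continuous_on (chart_image c) (laplace_coord (G c) w)"
proof -
  have "continuous_on (chart_image c) (partial_deriv i (flux c w i))" for i
    using flux_smooth[OF c w, of "Suc 0" i] by simp
  then show ?thesis
    unfolding laplace_coord_flux[abs_def] using wt_pos[OF c] Ck_on_continuous[OF wt_smooth[OF c]]
    by (intro continuous_intros) force+
qed

lemma gam_continuous:
  assumes c: "c \<in> A" and u: "Ck_on (Suc 0) (chart_image c) u" and w: "\<And>k. Ck_on k (chart_image c) w"
  shows "continuous_on (chart_image c) (gam c u w)"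
proof -
  have "gam c u w x = (\<Sum>i\<in>UNIV. partial_deriv i u x * flux c w i x) / wt c x" if "x \<in> chart_image c" for x
    using gam_flux[OF c, of u w x] wt_pos[OF c that] by (simp add: field_simps)
  moreover have "continuous_on (chart_image c) (\<lambda>x. (\<Sum>i\<in>UNIV. partial_deriv i u x * flux c w i x) / wt c x)"
    using wt_pos[OF c] Ck_on_continuous[OF wt_smooth[OF c]] Ck_on_continuous[OF flux_smooth[OF c w]] u
    by (intro continuous_intros) force+
  ultimately show ?thesis by (simp cong: continuous_on_cong_simp)
qed

lemma partial_deriv_eq_0:
  fixes F :: "real^'m \<Rightarrow> real"
  assumes "closed K" "\<And>x. x \<notin> K \<Longrightarrow> F x = 0" "x \<notin> K"
  shows "partial_deriv i F x = 0"
proof -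
  have "(F has_derivative (\<lambda>_. 0)) (at x)"
    by (rule has_derivative_transform_within_open[of "\<lambda>_. 0" _ _ _ "- K"]) (use assms in auto)
  from partial_deriv_eqI[OF this] show ?thesis .
qed

text \<open>
  The divergence theorem for the vector field \<open>\<eta> * flux w\<close>, which has compact support.
\<close>

lemma green_coord:
  assumes c: "c \<in> A" and w: "\<And>k. Ck_on k (chart_image c) w"
    and \<eta>: "Ck_on (Suc 0) (chart_image c) \<eta>" and K: "compact K" "K \<subseteq> chart_image c" "\<And>x. x \<notin> K \<Longrightarrow> \<eta> x = 0"
  shows "(LINT x|lborel. chart_density c x * (\<eta> x * laplace_coord (G c) w x))
       = - (LINT x|lborel. chart_density c x * gam c \<eta> w x)"
proof -
  let ?V = "chart_image c"
  have Kc: "closed K" using K(1) by (rule compact_imp_closed)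
  have pd0: "partial_deriv i \<eta> x = 0" if "x \<notin> K" for i x
    by (rule partial_deriv_eq_0[OF Kc _ that]) (rule K(3))
  have fl: "Ck_on (Suc 0) ?V (flux c w i)" for i by (rule flux_smooth[OF c w])
  have prod: "Ck_on (Suc 0) ?V (\<lambda>x. \<eta> x * flux c w i x)" for i
    by (rule Ck_on_mult[OF chart_open(2)[OF c] \<eta> fl])
  have d: "partial_deriv i (\<lambda>x. \<eta> x * flux c w i x) x
      = partial_deriv i \<eta> x * flux c w i x + \<eta> x * partial_deriv i (flux c w i) x" for i x
  proof (cases "x \<in> K")
    case True
    then have x: "x \<in> ?V" using K(2) by auto
    show ?thesis
      by (subst partial_deriv_eqI[OF has_derivative_mult[OF Ck_on_derivative[OF \<eta> x] Ck_on_derivative[OF fl x]]])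
        (simp add: add.commute)
  next
    case False
    then show ?thesis
      using partial_deriv_eq_0[OF Kc _ False, of "\<lambda>x. \<eta> x * flux c w i x" i] pd0[OF False] K(3)
      by simp
  qed
  have z: "integrable lborel (partial_deriv i (\<lambda>x. \<eta> x * flux c w i x))"
      "(LINT x|lborel. partial_deriv i (\<lambda>x. \<eta> x * flux c w i x) x) = 0" for i
    using integral_partial_deriv_eq_0[OF chart_open(2)[OF c] K(1,2), of "\<lambda>x. \<eta> x * flux c w i x" i] prod[of i] K(3)
    by auto
  have i1: "integrable lborel (\<lambda>x. partial_deriv i \<eta> x * flux c w i x)" for i
    using \<eta> Ck_on_continuous[OF fl] K pd0
    by (intro integrable_continuous_compact_support[of K]) (auto intro!: continuous_intros intro: continuous_on_subset)
  have i2: "integrable lborel (\<lambda>x. \<eta> x * partial_deriv i (flux c w i) x)" for i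
    using fl[of i] Ck_on_continuous[OF \<eta>] K
    by (intro integrable_continuous_compact_support[of K]) (auto intro!: continuous_intros intro: continuous_on_subset)
  have s: "(LINT x|lborel. \<eta> x * partial_deriv i (flux c w i) x) = - (LINT x|lborel. partial_deriv i \<eta> x * flux c w i x)" for i
    using z(2)[of i] i1[of i] i2[of i] unfolding d by simp
  have "(LINT x|lborel. chart_density c x * (\<eta> x * laplace_coord (G c) w x))
      = (LINT x|lborel. \<kappa> * (\<Sum>i\<in>UNIV. \<eta> x * partial_deriv i (flux c w i) x))"
  proof (intro Bochner_Integration.integral_cong refl)
    fix x
    show "chart_density c x * (\<eta> x * laplace_coord (G c) w x) = \<kappa> * (\<Sum>i\<in>UNIV. \<eta> x * partial_deriv i (flux c w i) x)"
      using wt_pos[OF c, of x] K(2) K(3)[of x]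
      by (cases "x \<in> K") (auto simp: chart_density_def laplace_coord_flux sum_distrib_left[symmetric])
  qed
  also have "\<dots> = \<kappa> * (\<Sum>i\<in>UNIV. LINT x|lborel. \<eta> x * partial_deriv i (flux c w i) x)"
    using i2 by simp
  also have "\<dots> = - (\<kappa> * (\<Sum>i\<in>UNIV. LINT x|lborel. partial_deriv i \<eta> x * flux c w i x))"
    by (simp add: s sum_negf)
  also have "\<kappa> * (\<Sum>i\<in>UNIV. LINT x|lborel. partial_deriv i \<eta> x * flux c w i x)
      = (LINT x|lborel. \<kappa> * (\<Sum>i\<in>UNIV. partial_deriv i \<eta> x * flux c w i x))"
    using i1 by simp
  also have "\<dots> = (LINT x|lborel. chart_density c x * gam c \<eta> w x)"
  proof (intro Bochner_Integration.integral_cong refl)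
    fix x
    show "\<kappa> * (\<Sum>i\<in>UNIV. partial_deriv i \<eta> x * flux c w i x) = chart_density c x * gam c \<eta> w x"
    proof (cases "x \<in> K")
      case True
      then show ?thesis using K(2) gam_flux[OF c, of \<eta> w x] by (auto simp: chart_density_def mult_ac)
    next
      case False
      then have "partial_deriv i \<eta> x = 0" for i by (rule pd0)
      then show ?thesis by (simp add: gam_def grad_def zero_vec_def[symmetric])
    qed
  qed
  finally show ?thesis .
qed

end

lemma partial_deriv_cong_open:
  assumes "open S" "x \<in> S" "\<And>y. y \<in> S \<Longrightarrow> f y = g y" "f differentiable (at x)"
  shows "partial_deriv i f x = partial_deriv i g x"
proof -
  have f: "(f has_derivative frechet_derivative f (at x)) (at x)"
    using assms(4) by (simp add: frechet_derivative_works)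
  have "(g has_derivative frechet_derivative f (at x)) (at x)"
    by (rule has_derivative_transform_within_open[OF f assms(1,2,3)])
  from partial_deriv_eqI[OF this] show ?thesis by (simp add: partial_deriv_def)
qed

context weighted_manifold
begin

lemma smooth_rep_differentiable: "c \<in> A \<Longrightarrow> u \<in> smooth \<Longrightarrow> x \<in> chart_image c \<Longrightarrow> rep c u differentiable (at x)"
  using smooth_rep[of c u "Suc 0"] by simp

definition chart_gam :: "('a, 'n) chart \<Rightarrow> ('a \<Rightarrow> real) \<Rightarrow> ('a \<Rightarrow> real) \<Rightarrow> 'a \<Rightarrow> real" where
  "chart_gam c f w p = gam c (rep c f) (rep c w) (chart_map c p)"

definition chart_laplace :: "('a, 'n) chart \<Rightarrow> ('a \<Rightarrow> real) \<Rightarrow> 'a \<Rightarrow> real" where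
  "chart_laplace c w p = laplace_coord (G c) (rep c w) (chart_map c p)"

lemma transition_derivative:
  assumes c: "c \<in> A" and d: "d \<in> A" and x: "x \<in> overlap c d"
  shows "(transition c d has_derivative frechet_derivative (transition c d) (at x)) (at x)"
proof -
  have "((\<lambda>y. \<chi> i. transition c d y $ i) has_derivative
      (\<lambda>h. \<chi> i. \<Sum>j\<in>UNIV. partial_deriv j (\<lambda>y. transition c d y $ i) x * h $ j)) (at x)"
    using transition_smooth[OF c d] x by (intro has_derivative_vec_lambda_components Ck_on_derivative)
  then have "transition c d differentiable (at x)" by (auto simp: differentiable_def)
  then show ?thesis by (simp add: frechet_derivative_works)
qed

text \<open>
  The chain rule for \<open>rep c f = rep d f \<circ> transition c d\<close>.
\<close>

lemma grad_transition:
  assumes c: "c \<in> A" and d: "d \<in> A" and p: "p \<in> chart_dom c" "p \<in> chart_dom d" and f: "f \<in> smooth"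
  shows "grad (rep c f) (chart_map c p) =
    transpose (matrix (frechet_derivative (transition c d) (at (chart_map c p)))) *v grad (rep d f) (chart_map d p)"
proof -
  let ?x = "chart_map c p" and ?T = "transition c d"
  let ?T' = "frechet_derivative ?T (at ?x)"
  have x: "?x \<in> overlap c d" using p by (auto simp: overlap_def)
  have Tx: "?T ?x = chart_map d p" using p c by (simp add: transition_def)
  have "(rep d f has_derivative (\<lambda>h. \<Sum>k\<in>UNIV. partial_deriv k (rep d f) (chart_map d p) * h $ k)) (at (?T ?x))"
    unfolding Tx using p d f by (intro has_derivative_partial smooth_rep_differentiable) auto
  from has_derivative_compose[OF transition_derivative[OF c d x] this]
  have "((\<lambda>y. rep d f (?T y)) has_derivative (\<lambda>h. \<Sum>k\<in>UNIV. partial_deriv k (rep d f) (chart_map d p) * ?T' h $ k)) (at ?x)" .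
  then have "(rep c f has_derivative (\<lambda>h. \<Sum>k\<in>UNIV. partial_deriv k (rep d f) (chart_map d p) * ?T' h $ k)) (at ?x)"
  proof (rule has_derivative_transform_within_open[OF _ open_overlap[OF c d] x])
    fix y assume "y \<in> overlap c d"
    then show "rep d f (?T y) = rep c f y" using c d by (auto simp: overlap_def rep_def transition_def)
  qed
  then have "partial_deriv i (rep c f) ?x = (\<Sum>k\<in>UNIV. partial_deriv k (rep d f) (chart_map d p) * ?T' (axis i 1) $ k)" for i
    by (rule partial_deriv_eqI)
  then show ?thesis
    by (simp add: vec_eq_iff grad_def matrix_vector_mult_def transpose_def matrix_def mult.commute)
qed

lemma chart_gam_invariant:
  assumes c: "c \<in> A" and d: "d \<in> A" and p: "p \<in> chart_dom c" "p \<in> chart_dom d" and f: "f \<in> smooth" "w \<in> smooth"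
  shows "chart_gam c f w p = chart_gam d f w p"
proof -
  let ?J = "matrix (frechet_derivative (transition c d) (at (chart_map c p)))"
  have "G c (chart_map c p) = transpose ?J ** G d (chart_map d p) ** ?J"
    using metric c d p unfolding riemannian_metric_def Let_def by blast
  from matrix_inv_congruence[OF metric_pos_def[OF c] metric_pos_def[OF d] this]
  show ?thesis
    unfolding chart_gam_def gam_def grad_transition[OF c d p f(1)] grad_transition[OF c d p f(2)]
    using p c d by simp
qed

lemma chart_gam_eq_0:
  assumes c: "c \<in> A" and p: "p \<in> chart_dom c" "p \<notin> C" and C: "closed C" "\<And>q. q \<notin> C \<Longrightarrow> f q = 0"
  shows "chart_gam c f w p = 0"
proof -
  let ?S = "chart_map c ` (chart_dom c - C)"
  have oS: "open ?S" using chart_open(1)[OF c] C(1) by (intro open_chart_map_image c) auto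
  have d: "(rep c f has_derivative (\<lambda>_. 0)) (at (chart_map c p))"
    by (rule has_derivative_transform_within_open[of "\<lambda>_. 0" _ _ _ ?S]) (use oS p C(2) c in \<open>auto simp: rep_def\<close>)
  have "grad (rep c f) (chart_map c p) = 0"
    using partial_deriv_eqI[OF d] by (simp add: grad_def zero_vec_def)
  then show ?thesis by (simp add: chart_gam_def gam_def)
qed

lemma chart_laplace_continuous:
  assumes c: "c \<in> A" and w: "w \<in> smooth" shows "continuous_on (chart_dom c) (chart_laplace c w)"
  unfolding chart_laplace_def[abs_def]
  using laplace_coord_continuous[OF c smooth_rep[OF c w]] chart_cont(1)[OF c]
  by (rule continuous_on_compose2) (use chart_map_image[OF c] in auto)

lemma chart_gam_continuous:
  assumes c: "c \<in> A" and w: "u \<in> smooth" "w \<in> smooth" shows "continuous_on (chart_dom c) (chart_gam c u w)"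
  unfolding chart_gam_def[abs_def]
  using gam_continuous[OF c smooth_rep[OF c w(1)] smooth_rep[OF c w(2)]] chart_cont(1)[OF c]
  by (rule continuous_on_compose2) (use chart_map_image[OF c] in auto)

lemma indicator_continuous:
  fixes F :: "'a \<Rightarrow> real"
  assumes c: "c \<in> A" and F: "continuous_on (chart_dom c) F" and C: "closed C" "C \<subseteq> chart_dom c" "\<And>p. p \<in> chart_dom c \<Longrightarrow> p \<notin> C \<Longrightarrow> F p = 0"
  shows "continuous_on UNIV (\<lambda>p. indicator (chart_dom c) p * F p)"
proof -
  have "continuous_on (chart_dom c) (\<lambda>p. indicator (chart_dom c) p * F p)"
    using F by (rule continuous_on_eq) simp
  moreover have "continuous_on (- C) (\<lambda>p. indicator (chart_dom c) p * F p)"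
    by (rule continuous_on_eq[of _ "\<lambda>_. 0"]) (use C(3) in \<open>auto simp: indicator_def\<close>)
  ultimately have "continuous_on (chart_dom c \<union> - C) (\<lambda>p. indicator (chart_dom c) p * F p)"
    using C(1) chart_open(1)[OF c] by (intro continuous_on_open_Un) auto
  moreover have "chart_dom c \<union> - C = UNIV" using C(2) by auto
  ultimately show ?thesis by simp
qed

text \<open>
  \<open>green_coord\<close> transported to the manifold. Since \<open>rep c f\<close> is arbitrary outside the image of the chart, it is
  replaced by its extension by zero.
\<close>

lemma chart_green:
  assumes c: "c \<in> A" and f: "f \<in> smooth" and w: "w \<in> smooth"
    and C: "compact C" "C \<subseteq> chart_dom c" "\<And>p. p \<notin> C \<Longrightarrow> f p = 0"
  shows "(LINT p|\<nu>. indicator (chart_dom c) p * (f p * chart_laplace c w p)) = - (LINT p|\<nu>. indicator (chart_dom c) p * chart_gam c f w p)"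
proof -
  let ?V = "chart_image c"
  define K where "K = chart_map c ` C"
  have K: "compact K" "K \<subseteq> ?V"
    unfolding K_def using C(1,2) chart_cont(1)[OF c]
    by (auto intro!: compact_continuous_image intro: continuous_on_subset simp: c subset_iff)
  define \<eta> where "\<eta> x = (if x \<in> ?V then rep c f x else 0)" for x
  have \<eta>0: "\<eta> x = 0" if "x \<notin> K" for x
  proof (cases "x \<in> ?V")
    case True
    have "chart_inv c x \<notin> C" using that True chart_map_inv[OF c True] by (metis K_def image_eqI)
    then show ?thesis using True C(3) by (simp add: \<eta>_def rep_def)
  qed (simp add: \<eta>_def)
  have \<eta>: "Ck_on (Suc 0) ?V \<eta>"
    using smooth_rep[OF c f] Ck_on_cong[OF chart_open(2)[OF c], of \<eta> "rep c f" "Suc 0"] by (simp add: \<eta>_def)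
  have gam_\<eta>: "gam c \<eta> (rep c w) x = gam c (rep c f) (rep c w) x" if x: "x \<in> ?V" for x
  proof -
    have "partial_deriv i (rep c f) x = partial_deriv i \<eta> x" for i
      by (rule partial_deriv_cong_open[OF chart_open(2)[OF c] x _ smooth_rep_differentiable[OF c f x]]) (simp add: \<eta>_def)
    then show ?thesis by (simp add: gam_def grad_def)
  qed
  have m1: "(\<lambda>p. indicator (chart_dom c) p * (f p * chart_laplace c w p)) \<in> borel_measurable borel"
    using smooth_continuous[OF f] chart_laplace_continuous[OF c w]
    by (intro borel_measurable_indicator_continuous chart_open c continuous_intros) (auto intro: continuous_on_subset)
  have m2: "(\<lambda>p. indicator (chart_dom c) p * chart_gam c f w p) \<in> borel_measurable borel"
    using chart_gam_continuous[OF c f w] by (intro borel_measurable_indicator_continuous chart_open c)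
  have "(LINT p|\<nu>. indicator (chart_dom c) p * (f p * chart_laplace c w p))
      = (LINT x|lborel. chart_density c x * (f (chart_inv c x) * chart_laplace c w (chart_inv c x)))"
    by (rule chart_integral(2)[OF c m1])
  also have "\<dots> = (LINT x|lborel. chart_density c x * (\<eta> x * laplace_coord (G c) (rep c w) x))"
    by (intro Bochner_Integration.integral_cong refl)
      (auto simp: chart_density_def \<eta>_def rep_def chart_laplace_def c)
  also have "\<dots> = - (LINT x|lborel. chart_density c x * gam c \<eta> (rep c w) x)"
    by (rule green_coord[OF c smooth_rep[OF c w] \<eta> K \<eta>0])
  also have "(LINT x|lborel. chart_density c x * gam c \<eta> (rep c w) x)
      = (LINT x|lborel. chart_density c x * chart_gam c f w (chart_inv c x))"
    by (intro Bochner_Integration.integral_cong refl)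
      (auto simp: chart_density_def gam_\<eta> chart_gam_def c split: split_indicator)
  also have "\<dots> = (LINT p|\<nu>. indicator (chart_dom c) p * chart_gam c f w p)"
    by (rule chart_integral(2)[OF c m2, symmetric])
  finally show ?thesis .
qed

section \<open>The Laplacian and Green's formula\<close>

text \<open>
  By Green's formula, integrating the Laplacian against a bump supported in both charts gives minus the integral
  of the gradient form, which is the same in both charts. So the difference of the two Laplacians cannot be
  positive on a neighbourhood of \<open>p\<close>. This replaces a computation with second derivatives of the transition.
\<close>

lemma chart_laplace_le:
  assumes c: "c \<in> A" and d: "d \<in> A" and p: "p \<in> chart_dom c" "p \<in> chart_dom d" and w: "w \<in> smooth"
  shows "chart_laplace c w p \<le> chart_laplace d w p"
proof (rule ccontr)
  assume "\<not> chart_laplace c w p \<le> chart_laplace d w p"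
  define h where "h q = chart_laplace c w q - chart_laplace d w q" for q
  let ?W = "chart_dom c \<inter> chart_dom d"
  have oW: "open ?W" using chart_open(1)[OF c] chart_open(1)[OF d] by auto
  have hc: "continuous_on ?W h" unfolding h_def
    using chart_laplace_continuous[OF c w] chart_laplace_continuous[OF d w]
    by (intro continuous_intros) (auto intro: continuous_on_subset)
  define P where "P = ?W \<inter> h -` {0<..}"
  have oP: "open P" unfolding P_def by (rule continuous_open_preimage[OF hc oW]) simp
  have pP: "p \<in> P" using \<open>\<not> _\<close> p by (simp add: P_def h_def)
  have PU: "P \<subseteq> chart_dom c" by (auto simp: P_def)
  have "open (chart_map c ` P)" using oP PU by (rule open_chart_map_image[OF c])
  then obtain a b where ab: "cbox a b \<subseteq> chart_map c ` P" "chart_map c p \<in> box a b" "\<forall>i\<in>Basis. a \<bullet> i < b \<bullet> i"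
    using pP by (meson image_eqI open_contains_cbox)
  have abV: "cbox a b \<subseteq> chart_image c" unfolding chart_image_def using ab(1) PU by blast
  define C where "C = chart_inv c ` cbox a b"
  have C: "compact C" unfolding C_def by (rule compact_chart_inv[OF c compact_cbox abV])
  have CP: "C \<subseteq> P" unfolding C_def using ab(1) PU by (auto simp: c subset_iff dest!: bspec)
  have Cc: "closed C" using C by (rule compact_imp_closed)
  define f where "f = chart_ext c (box_bump a b 1)"
  have f: "f \<in> smooth" unfolding f_def by (rule chart_bump_smooth[OF c abV]) simp
  have f0: "f q = 0" if "q \<notin> C" for q
  proof (cases "q \<in> chart_dom c")
    case True
    then have "chart_map c q \<notin> cbox a b" using that chart_inv_map[OF c True] by (metis C_def image_eqI)
    then show ?thesis using True box_subset_cbox[of a b] by (auto simp: f_def chart_ext_def intro!: box_bump_zero)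
  qed (simp add: f_def chart_ext_def)
  have CW: "C \<subseteq> chart_dom c" "C \<subseteq> chart_dom d" using CP by (auto simp: P_def)
  have gam_eq: "indicator (chart_dom c) q * chart_gam c f w q = indicator (chart_dom d) q * chart_gam d f w q" for q
  proof (cases "q \<in> C")
    case True
    then have "q \<in> chart_dom c" "q \<in> chart_dom d" using CW by auto
    then show ?thesis using chart_gam_invariant[OF c d _ _ f w] by simp
  next
    case False
    then show ?thesis
      using chart_gam_eq_0[OF c _ False Cc f0] chart_gam_eq_0[OF d _ False Cc f0] by (auto simp: indicator_def)
  qed
  have eq: "(LINT q|\<nu>. indicator (chart_dom c) q * (f q * chart_laplace c w q))
      = (LINT q|\<nu>. indicator (chart_dom d) q * (f q * chart_laplace d w q))"
    using chart_green[OF c f w C CW(1) f0] chart_green[OF d f w C CW(2) f0] by (simp add: gam_eq)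
  have int: "integrable \<nu> (\<lambda>q. indicator (chart_dom e) q * (f q * chart_laplace e w q))" if "e \<in> A" "C \<subseteq> chart_dom e" for e
    using smooth_continuous[OF f] chart_laplace_continuous[OF that(1) w] f0 that
    by (intro continuous_integrable indicator_continuous[OF that(1) _ Cc that(2)])
      (auto intro!: continuous_intros intro: continuous_on_subset)
  have e: "indicator (chart_dom c) q * (f q * h q) = indicator (chart_dom c) q * (f q * chart_laplace c w q)
      - indicator (chart_dom d) q * (f q * chart_laplace d w q)" for q
  proof (cases "q \<in> C")
    case True
    then have "q \<in> chart_dom c" "q \<in> chart_dom d" using CW by auto
    then show ?thesis by (simp add: h_def algebra_simps)
  qed (simp add: f0)
  have I: "integrable \<nu> (\<lambda>q. indicator (chart_dom c) q * (f q * h q))"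
      "(LINT q|\<nu>. indicator (chart_dom c) q * (f q * h q)) = 0"
    unfolding e using int[OF c CW(1)] int[OF d CW(2)] eq by auto
  have "(\<lambda>q. indicator (chart_dom c) q * (f q * h q)) \<in> borel_measurable borel"
    using I(1) borel_measurable_integrable by fastforce
  from chart_integral[OF c this] I
  have J: "integrable lborel (\<lambda>x. chart_density c x * (f (chart_inv c x) * h (chart_inv c x)))"
     "(LINT x|lborel. chart_density c x * (f (chart_inv c x) * h (chart_inv c x))) = 0" by auto
  have fx: "f (chart_inv c x) = box_bump a b 1 x" if "x \<in> chart_image c" for x
    using that c by (simp add: f_def chart_ext_def)
  have pos: "0 < chart_density c x * (f (chart_inv c x) * h (chart_inv c x))" if x: "x \<in> box a b" for x
  proof -
    have xV: "x \<in> chart_image c" and xc: "x \<in> cbox a b" using x abV box_subset_cbox[of a b] by auto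
    have "chart_inv c x \<in> P" using xc CP by (auto simp: C_def)
    then have "0 < h (chart_inv c x)" by (simp add: P_def)
    then show ?thesis using chart_density_pos[OF c xV] fx[OF xV] box_bump_pos_iff[of 1 a b x] x by simp
  qed
  have nonneg: "0 \<le> chart_density c x * (f (chart_inv c x) * h (chart_inv c x))" for x
  proof (cases "x \<in> box a b")
    case True then show ?thesis using pos by (simp add: less_imp_le)
  next
    case False
    then have "chart_density c x = 0 \<or> f (chart_inv c x) = 0"
      using fx[of x] box_bump_zero[of 1 x a b] by (cases "x \<in> chart_image c") (auto simp: chart_density_def)
    then show ?thesis by auto
  qed
  have "AE x in lborel. chart_density c x * (f (chart_inv c x) * h (chart_inv c x)) = 0"
    using integral_nonneg_eq_0_iff_AE[OF J(1)] J(2) nonneg by simp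
  then have "AE x in lborel. x \<notin> box a b"
    by eventually_elim (use pos in force)
  then have "emeasure lborel (box a b) = 0"
    by (subst (asm) AE_iff_measurable[where N = "box a b"]) auto
  moreover have "(\<Prod>i\<in>Basis. (b - a) \<bullet> i) > 0"
    using ab(3) by (intro prod_pos) (auto simp: inner_diff_left)
  ultimately show False
    using ab(3) by (simp add: emeasure_lborel_box less_imp_le ennreal_eq_0_iff)
qed

lemma chart_laplace_invariant:
  assumes "c \<in> A" "d \<in> A" "p \<in> chart_dom c" "p \<in> chart_dom d" "w \<in> smooth"
  shows "chart_laplace c w p = chart_laplace d w p"
  using chart_laplace_le assms by (meson order_antisym)

abbreviation \<Delta> :: "('a \<Rightarrow> real) \<Rightarrow> 'a \<Rightarrow> real" where "\<Delta> \<equiv> laplace_beltrami A G"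

definition chart_at :: "'a \<Rightarrow> ('a, 'n) chart" where
  "chart_at p = (SOME c. c \<in> A \<and> p \<in> chart_dom c)"

lemma chart_at: "chart_at p \<in> A" "p \<in> chart_dom (chart_at p)"
  using someI_ex[of "\<lambda>c. c \<in> A \<and> p \<in> chart_dom c"] charts_cover[of p] unfolding chart_at_def by blast+

lemma laplace_beltrami_chart:
  assumes "c \<in> A" "p \<in> chart_dom c" "w \<in> smooth"
  shows "\<Delta> w p = chart_laplace c w p"
  using chart_laplace_invariant[OF chart_at(1) assms(1) chart_at(2) assms(2,3)]
  by (simp add: laplace_beltrami_def Let_def chart_at_def chart_laplace_def rep_def)

definition \<Gamma> :: "('a \<Rightarrow> real) \<Rightarrow> ('a \<Rightarrow> real) \<Rightarrow> 'a \<Rightarrow> real" where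
  "\<Gamma> f w p = chart_gam (chart_at p) f w p"

lemma \<Gamma>_chart:
  assumes "c \<in> A" "p \<in> chart_dom c" "f \<in> smooth" "w \<in> smooth"
  shows "\<Gamma> f w p = chart_gam c f w p"
  unfolding \<Gamma>_def by (rule chart_gam_invariant[OF chart_at(1) assms(1) chart_at(2) assms(2-)])

lemma continuous_on_charts:
  fixes F :: "'a \<Rightarrow> real"
  assumes "\<And>c. c \<in> A \<Longrightarrow> continuous_on (chart_dom c) F"
  shows "continuous_on UNIV F"
proof -
  have "continuous_on (\<Union>c\<in>A. chart_dom c) F"
    using chart_open(1) assms by (intro continuous_on_open_UN) auto
  then show ?thesis using atlas by (simp add: smooth_atlas_def)
qed

lemma laplace_continuous:
  assumes w: "w \<in> smooth" shows "continuous_on UNIV (\<Delta> w)"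
proof (rule continuous_on_charts)
  fix c assume c: "c \<in> A"
  show "continuous_on (chart_dom c) (\<Delta> w)"
    by (rule continuous_on_eq[OF chart_laplace_continuous[OF c w]]) (simp add: laplace_beltrami_chart[OF c _ w])
qed

lemma \<Gamma>_continuous:
  assumes f: "f \<in> smooth" and w: "w \<in> smooth" shows "continuous_on UNIV (\<Gamma> f w)"
proof (rule continuous_on_charts)
  fix c assume c: "c \<in> A"
  show "continuous_on (chart_dom c) (\<Gamma> f w)"
    by (rule continuous_on_eq[OF chart_gam_continuous[OF c f w]]) (simp add: \<Gamma>_chart[OF c _ f w])
qed

lemma \<Gamma>_symmetric: "f \<in> smooth \<Longrightarrow> w \<in> smooth \<Longrightarrow> \<Gamma> f w p = \<Gamma> w f p"
  using chart_at[of p]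
  by (auto simp: \<Gamma>_def chart_gam_def gam_def intro!: pos_def_matrix_inv_symmetric metric_pos_def)

lemma \<Gamma>_nonneg: "0 \<le> \<Gamma> f f p"
  using chart_at[of p]
  by (auto simp: \<Gamma>_def chart_gam_def gam_def intro!: pos_def_matrix_inv_nonneg metric_pos_def)

lemma grad_rep_sum:
  assumes c: "c \<in> A" and f: "\<And>i. i \<in> I \<Longrightarrow> f i \<in> smooth" and x: "x \<in> chart_image c"
  shows "grad (rep c (\<lambda>p. \<Sum>i\<in>I. f i p)) x = (\<Sum>i\<in>I. grad (rep c (f i)) x)"
proof -
  have "((\<lambda>y. \<Sum>i\<in>I. rep c (f i) y) has_derivative (\<lambda>h. \<Sum>i\<in>I. \<Sum>j\<in>UNIV. partial_deriv j (rep c (f i)) x * h $ j)) (at x)"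
    using f by (intro has_derivative_sum has_derivative_partial smooth_rep_differentiable c x)
  then have "(rep c (\<lambda>p. \<Sum>i\<in>I. f i p) has_derivative (\<lambda>h. \<Sum>i\<in>I. \<Sum>j\<in>UNIV. partial_deriv j (rep c (f i)) x * h $ j)) (at x)"
    by (simp add: rep_def o_def)
  from partial_deriv_eqI[OF this] show ?thesis
    by (simp add: grad_def vec_eq_iff)
qed

lemma \<Gamma>_sum:
  assumes f: "\<And>i. i \<in> I \<Longrightarrow> f i \<in> smooth"
  shows "\<Gamma> (\<lambda>p. \<Sum>i\<in>I. f i p) w p = (\<Sum>i\<in>I. \<Gamma> (f i) w p)"
  using chart_at[of p]
  by (simp add: \<Gamma>_def chart_gam_def gam_def grad_rep_sum[OF _ f] inner_sum_left)

text \<open>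
  The open boxes cover the manifold, while the closed ones stay inside the charts and so provide compact
  supports.
\<close>

definition box_cover :: "(('a, 'n) chart \<times> (real^'n) \<times> (real^'n)) set \<Rightarrow> bool" where
  "box_cover I \<longleftrightarrow> finite I \<and> (\<forall>(c, a, b)\<in>I. c \<in> A \<and> cbox a b \<subseteq> chart_image c) \<and>
     (\<forall>p. \<exists>(c, a, b)\<in>I. p \<in> chart_dom c \<and> chart_map c p \<in> box a b)"

lemma box_cover_exists: "\<exists>I. box_cover I"
proof -
  have "\<exists>a b. cbox a b \<subseteq> chart_image (chart_at p) \<and> chart_map (chart_at p) p \<in> box a b" for p
    using open_contains_cbox[OF chart_open(2)[OF chart_at(1)], of "chart_map (chart_at p) p" p]
      chart_map_image[OF chart_at(1) chart_at(2)] by metis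
  then obtain a b where ab: "\<And>p. cbox (a p) (b p) \<subseteq> chart_image (chart_at p)"
      "\<And>p. chart_map (chart_at p) p \<in> box (a p) (b p)" by metis
  define T where "T p = chart_inv (chart_at p) ` box (a p) (b p)" for p
  have sub: "box (a p) (b p) \<subseteq> chart_image (chart_at p)" for p using ab(1)[of p] box_subset_cbox by blast
  have "open (T p)" for p unfolding T_def by (rule open_chart_preimage[OF chart_at(1) open_box sub])
  moreover have "p \<in> T p" for p
    unfolding T_def using ab(2)[of p] chart_inv_map[OF chart_at(1) chart_at(2), of p] by (metis image_eqI)
  ultimately obtain P where P: "finite P" "UNIV \<subseteq> (\<Union>p\<in>P. T p)"
    using compactE_image[OF compact_M, of UNIV T] by (metis UNIV_I UN_iff subsetI)
  have "box_cover ((\<lambda>p. (chart_at p, a p, b p)) ` P)"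
    unfolding box_cover_def
  proof (intro conjI allI)
    show "\<exists>(c, a, b)\<in>(\<lambda>p. (chart_at p, a p, b p)) ` P. q \<in> chart_dom c \<and> chart_map c q \<in> box a b" for q
    proof -
      have "q \<in> (\<Union>p\<in>P. T p)" using P(2) by blast
      then obtain p x where p: "p \<in> P" "x \<in> box (a p) (b p)" "q = chart_inv (chart_at p) x"
        by (auto simp: T_def)
      have "x \<in> chart_image (chart_at p)" using p(2) sub by blast
      then have "q \<in> chart_dom (chart_at p)" "chart_map (chart_at p) q = x"
        using p(3) chart_at(1)[of p] by auto
      then show ?thesis using p by force
    qed
  qed (use P(1) ab(1) chart_at(1) in auto)
  then show ?thesis by blast
qed

text \<open>
  A partition of unity subordinate to finitely many coordinate boxes reduces the formula to functions supported
  in one chart.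
\<close>

lemma green_formula:
  assumes v: "v \<in> smooth" and w: "w \<in> smooth"
  shows "L2_inner \<nu> v (\<lambda>p. - \<Delta> w p) = (LINT p|\<nu>. \<Gamma> v w p)"
proof -
  obtain I where I: "box_cover I" using box_cover_exists by blast
  have fin: "finite I" using I by (simp add: box_cover_def)
  define \<beta> where "\<beta> = (\<lambda>(c, a, b). chart_ext c (box_bump a b 1))"
  have Ip: "c \<in> A" "cbox a b \<subseteq> chart_image c" if "(c, a, b) \<in> I" for c a b
    using I that by (auto simp: box_cover_def)
  have \<beta>_smooth: "\<beta> i \<in> smooth" if "i \<in> I" for i
  proof (cases i)
    case (fields c a b)
    then show ?thesis using chart_bump_smooth[OF Ip(1)[of c a b] Ip(2)[of c a b], of 1] that by (simp add: \<beta>_def)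
  qed
  have \<beta>_nonneg: "0 \<le> \<beta> i p" for i p
    by (cases i) (simp add: \<beta>_def chart_ext_def box_bump_bounds)
  have \<beta>_pos: "\<exists>i\<in>I. 0 < \<beta> i p" for p
  proof -
    obtain c a b where i: "(c, a, b) \<in> I" "p \<in> chart_dom c" "chart_map c p \<in> box a b"
      using I unfolding box_cover_def by blast
    then have "0 < \<beta> (c, a, b) p" by (simp add: \<beta>_def chart_ext_def box_bump_pos_iff)
    then show ?thesis using i(1) by blast
  qed
  \<comment> \<open>dividing by the positive sum \<open>S\<close> turns the bumps into a partition of unity\<close>
  define S where "S p = (\<Sum>i\<in>I. \<beta> i p)" for p
  have S_pos: "S p > 0" for p
    unfolding S_def using \<beta>_pos[of p] \<beta>_nonneg fin by (metis sum_pos2)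
  have S_smooth: "S \<in> smooth" unfolding S_def using \<beta>_smooth by (rule smooth_sum)
  define v' where "v' p = v p * inverse (S p)" for p
  have v': "v' \<in> smooth" unfolding v'_def
    using S_pos by (intro smooth_mult v smooth_inverse S_smooth) (metis less_irrefl)
  define f where "f i p = \<beta> i p * v' p" for i p
  have f: "f i \<in> smooth" if "i \<in> I" for i unfolding f_def using \<beta>_smooth[OF that] v' by (rule smooth_mult)
  have v_sum: "v = (\<lambda>p. \<Sum>i\<in>I. f i p)"
  proof
    fix p
    have "(\<Sum>i\<in>I. f i p) = S p * v' p" by (simp add: f_def S_def sum_distrib_right)
    then show "v p = (\<Sum>i\<in>I. f i p)" using S_pos[of p] by (simp add: v'_def)
  qed
  have local: "(LINT p|\<nu>. f i p * \<Delta> w p) = - (LINT p|\<nu>. \<Gamma> (f i) w p)" if i: "i \<in> I" for i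
  proof -
    obtain c a b where i': "i = (c, a, b)" by (cases i)
    have c: "c \<in> A" and ab: "cbox a b \<subseteq> chart_image c" using Ip i i' by auto
    define C where "C = chart_inv c ` cbox a b"
    have C: "compact C" unfolding C_def by (rule compact_chart_inv[OF c compact_cbox ab])
    have CU: "C \<subseteq> chart_dom c" using ab c by (auto simp: C_def)
    have f0: "f i p = 0" if "p \<notin> C" for p
    proof (cases "p \<in> chart_dom c")
      case True
      then have "chart_map c p \<notin> cbox a b" using that chart_inv_map[OF c True] by (metis C_def image_eqI)
      then have "box_bump a b 1 (chart_map c p) = 0"
        using box_subset_cbox[of a b] by (intro box_bump_zero) auto
      then show ?thesis by (simp add: f_def i' \<beta>_def chart_ext_def)
    qed (simp add: f_def i' \<beta>_def chart_ext_def)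
    have e1: "f i p * \<Delta> w p = indicator (chart_dom c) p * (f i p * chart_laplace c w p)" for p
      using f0[of p] CU laplace_beltrami_chart[OF c _ w, of p] by (cases "p \<in> chart_dom c") auto
    have e2: "\<Gamma> (f i) w p = indicator (chart_dom c) p * chart_gam c (f i) w p" for p
    proof (cases "p \<in> chart_dom c")
      case True then show ?thesis using \<Gamma>_chart[OF c True f[OF i] w] by simp
    next
      case False
      then have "p \<notin> C" using CU by auto
      then show ?thesis
        using False chart_gam_eq_0[OF chart_at(1) chart_at(2) _ compact_imp_closed[OF C] f0] by (simp add: \<Gamma>_def)
    qed
    show ?thesis unfolding e1 e2 by (rule chart_green[OF c f[OF i] w C CU f0])
  qed
  have i1: "integrable \<nu> (\<lambda>p. f i p * \<Delta> w p)" if "i \<in> I" for i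
    using smooth_continuous[OF f[OF that]] laplace_continuous[OF w]
    by (intro continuous_integrable continuous_intros)
  have i2: "integrable \<nu> (\<Gamma> (f i) w)" if "i \<in> I" for i
    using \<Gamma>_continuous[OF f[OF that] w] by (rule continuous_integrable)
  have "L2_inner \<nu> v (\<lambda>p. - \<Delta> w p) = - (LINT p|\<nu>. (\<Sum>i\<in>I. f i p * \<Delta> w p))"
    unfolding L2_inner_def by (subst v_sum) (simp add: sum_distrib_right)
  also have "\<dots> = - (\<Sum>i\<in>I. LINT p|\<nu>. f i p * \<Delta> w p)" using i1 by simp
  also have "\<dots> = (\<Sum>i\<in>I. LINT p|\<nu>. \<Gamma> (f i) w p)" using local by (simp add: sum_negf)
  also have "\<dots> = (LINT p|\<nu>. (\<Sum>i\<in>I. \<Gamma> (f i) w p))" using i2 by simp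
  also have "\<dots> = (LINT p|\<nu>. \<Gamma> v w p)"
  proof -
    have "\<Gamma> v w p = (\<Sum>i\<in>I. \<Gamma> (f i) w p)" for p
      by (subst v_sum) (rule \<Gamma>_sum[OF f])
    then show ?thesis by simp
  qed
  finally show ?thesis .
qed

end

section \<open>Density of the smooth functions\<close>

text \<open>
  The positive and the negative part of \<open>F\<close> are densities of two measures that agree on boxes, hence on all
  Borel sets.
\<close>

lemma AE_eq_0_if_box_integrals_eq_0:
  fixes F :: "'a::euclidean_space \<Rightarrow> real"
  assumes F: "integrable lborel F" and box: "\<And>a b. (LINT x|lborel. indicator (box a b) x * F x) = 0"
  shows "AE x in lborel. F x = 0"
proof -
  have Fm[measurable]: "F \<in> borel_measurable borel" using borel_measurable_integrable[OF F] by simp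
  define p where "p x = ennreal (max 0 (F x))" for x
  define n where "n x = ennreal (max 0 (- F x))" for x
  have [measurable]: "p \<in> borel_measurable borel" "n \<in> borel_measurable borel"
    unfolding p_def n_def by measurable
  have int: "integrable lborel (\<lambda>x. indicator B x * max 0 (F x))" "integrable lborel (\<lambda>x. indicator B x * max 0 (- F x))"
    if [measurable]: "B \<in> sets borel" for B
    by (rule Bochner_Integration.integrable_bound[OF F], measurable, force simp: indicator_def)+
  have ep: "emeasure (density lborel p) B = ennreal (LINT x|lborel. indicator B x * max 0 (F x))"
    and en: "emeasure (density lborel n) B = ennreal (LINT x|lborel. indicator B x * max 0 (- F x))"
    if B[measurable]: "B \<in> sets borel" for B
  proof -
    have "emeasure (density lborel p) B = (\<integral>\<^sup>+x. ennreal (indicator B x * max 0 (F x)) \<partial>lborel)"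
      by (subst emeasure_density) (auto simp: p_def intro!: nn_integral_cong split: split_indicator)
    also have "\<dots> = ennreal (LINT x|lborel. indicator B x * max 0 (F x))"
      by (intro nn_integral_eq_integral int B) auto
    finally show "emeasure (density lborel p) B = ennreal (LINT x|lborel. indicator B x * max 0 (F x))" .
    have "emeasure (density lborel n) B = (\<integral>\<^sup>+x. ennreal (indicator B x * max 0 (- F x)) \<partial>lborel)"
      by (subst emeasure_density) (auto simp: n_def intro!: nn_integral_cong split: split_indicator)
    also have "\<dots> = ennreal (LINT x|lborel. indicator B x * max 0 (- F x))"
      by (intro nn_integral_eq_integral int B) auto
    finally show "emeasure (density lborel n) B = ennreal (LINT x|lborel. indicator B x * max 0 (- F x))" .
  qed
  have diff: "(LINT x|lborel. indicator B x * F x) =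
      (LINT x|lborel. indicator B x * max 0 (F x)) - (LINT x|lborel. indicator B x * max 0 (- F x))"
    if B: "B \<in> sets borel" for B
  proof -
    have "indicator B x * F x = indicator B x * max 0 (F x) - indicator B x * max 0 (- F x)" for x
      by (auto simp: max_def indicator_def)
    then show ?thesis using int[OF B] by simp
  qed
  have eq: "density lborel p = density lborel n"
  proof (rule measure_eqI_generator_eq)
    let ?E = "range (\<lambda>(a, b). box a b :: 'a set)"
    show "Int_stable ?E"
      by (auto simp: Int_stable_def box_Int_box)
    show "?E \<subseteq> Pow UNIV" "sets (density lborel p) = sigma_sets UNIV ?E" "sets (density lborel n) = sigma_sets UNIV ?E"
      by (simp_all add: borel_eq_box)
    let ?A = "\<lambda>k::nat. box (- (real k *\<^sub>R One)) (real k *\<^sub>R One) :: 'a set"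
    show "range ?A \<subseteq> ?E" "(\<Union>i. ?A i) = UNIV"
      unfolding UN_box_eq_UNIV by auto
    show "emeasure (density lborel p) (?A i) \<noteq> \<infinity>" for i by (simp add: ep)
    fix X assume "X \<in> ?E"
    then obtain a b where X: "X = box a b" by auto
    show "emeasure (density lborel p) X = emeasure (density lborel n) X"
      using diff[of X] box[of a b] by (simp add: X ep en)
  qed
  have zero: "(LINT x|lborel. indicator B x * F x) = 0" if B: "B \<in> sets borel" for B
  proof -
    have "ennreal (LINT x|lborel. indicator B x * max 0 (F x)) = ennreal (LINT x|lborel. indicator B x * max 0 (- F x))"
      using ep[OF B] en[OF B] by (simp add: eq)
    then show ?thesis using diff[OF B] by (subst (asm) ennreal_inj) (auto intro!: integral_nonneg)
  qed
  have half: "AE x in lborel. indicator B x * g x = 0"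
    if B[measurable]: "B \<in> sets borel" and g: "\<And>x. x \<in> B \<Longrightarrow> 0 \<le> g x" "integrable lborel g"
      and 0: "(LINT x|lborel. indicator B x * g x) = 0" for B and g :: "'a \<Rightarrow> real"
  proof -
    have "integrable lborel (\<lambda>x. indicator B x * g x)"
      using integrable_real_mult_indicator[of B lborel g] g(2) by (simp add: mult.commute)
    then show ?thesis
      using integral_nonneg_eq_0_iff_AE[of lborel "\<lambda>x. indicator B x * g x"] g(1) 0
      by (auto simp: indicator_def)
  qed
  have "AE x in lborel. indicator {x. 0 \<le> F x} x * F x = 0"
    using F zero[of "{x. 0 \<le> F x}"] by (intro half) auto
  moreover have "AE x in lborel. indicator {x. F x \<le> 0} x * (- F x) = 0"
    using F zero[of "{x. F x \<le> 0}"] by (intro half) auto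
  ultimately show ?thesis
    by eventually_elim (auto simp: indicator_def split: if_splits)
qed

lemma partial_deriv_lincomb:
  fixes f g :: "real^'n \<Rightarrow> real"
  assumes "f differentiable (at x)" "g differentiable (at x)"
  shows "partial_deriv i (\<lambda>y. a * f y + b * g y) x = a * partial_deriv i f x + b * partial_deriv i g x"
proof -
  have "((\<lambda>y. a * f y + b * g y) has_derivative
     (\<lambda>h. a * (\<Sum>i\<in>UNIV. partial_deriv i f x * h $ i) + b * (\<Sum>i\<in>UNIV. partial_deriv i g x * h $ i))) (at x)"
    using assms by (intro derivative_intros has_derivative_partial)
  from partial_deriv_eqI[OF this] show ?thesis by simp
qed

context weighted_manifold
begin

lemma laplace_lincomb:
  assumes u: "u \<in> smooth" and v: "v \<in> smooth"
  shows "\<Delta> (\<lambda>p. a * u p + b * v p) p = a * \<Delta> u p + b * \<Delta> v p"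
proof -
  let ?c = "chart_at p" and ?uv = "\<lambda>p. a * u p + b * v p"
  let ?x = "chart_map ?c p"
  note c = chart_at[of p]
  have V: "?x \<in> chart_image ?c" using c by simp
  have uv: "?uv \<in> smooth" by (intro smooth_add smooth_mult smooth_const u v)
  have rep_uv: "rep ?c ?uv = (\<lambda>y. a * rep ?c u y + b * rep ?c v y)" by (auto simp: rep_def)
  have fl: "flux ?c (rep ?c ?uv) i y = a * flux ?c (rep ?c u) i y + b * flux ?c (rep ?c v) i y"
    if y: "y \<in> chart_image ?c" for i y
    unfolding flux_def rep_uv
    by (simp add: partial_deriv_lincomb smooth_rep_differentiable c(1) u v y sum.distrib sum_distrib_left algebra_simps)
  have fd: "flux ?c (rep ?c w) i differentiable (at ?x)" if "w \<in> smooth" for w i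
    using flux_smooth[OF c(1) smooth_rep[OF c(1) that], of "Suc 0" i] V by simp
  have "partial_deriv i (flux ?c (rep ?c ?uv) i) ?x
      = a * partial_deriv i (flux ?c (rep ?c u) i) ?x + b * partial_deriv i (flux ?c (rep ?c v) i) ?x" for i
  proof -
    have "partial_deriv i (flux ?c (rep ?c ?uv) i) ?x
        = partial_deriv i (\<lambda>y. a * flux ?c (rep ?c u) i y + b * flux ?c (rep ?c v) i y) ?x"
      by (rule partial_deriv_cong_open[OF chart_open(2)[OF c(1)] V fl fd[OF uv]])
    then show ?thesis by (simp add: partial_deriv_lincomb fd u v)
  qed
  then have "chart_laplace ?c ?uv p = a * chart_laplace ?c u p + b * chart_laplace ?c v p"
    by (simp add: chart_laplace_def laplace_coord_flux sum.distrib sum_distrib_left[symmetric] add_divide_distrib)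
  then show ?thesis by (simp add: laplace_beltrami_chart[OF c] u v uv)
qed

lemma laplace_add: "u \<in> smooth \<Longrightarrow> v \<in> smooth \<Longrightarrow> \<Delta> (u + v) = \<Delta> u + \<Delta> v"
  using laplace_lincomb[of u v 1 1] by (auto simp: plus_fun_def)

lemma laplace_scale: "u \<in> smooth \<Longrightarrow> \<Delta> (a *\<^sub>R u) = a *\<^sub>R \<Delta> u"
  using laplace_lincomb[of u u a 0] by (auto simp: scaleR_fun_def)

text \<open>
  A function orthogonal to all smooth functions is orthogonal to all coordinate boxes, whose indicator
  functions are limits of bumps.
\<close>

lemma orthogonal_smooth_AE_0:
  assumes f: "f \<in> L2_space \<nu>" and orth: "\<And>v. v \<in> smooth \<Longrightarrow> L2_inner \<nu> f v = 0"
  shows "AE p in \<nu>. f p = 0"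
proof -
  obtain I where I: "box_cover I" using box_cover_exists by blast
  have fm[measurable]: "f \<in> borel_measurable borel" using L2_spaceD(1)[OF f] by simp
  have one: "(\<lambda>_. 1) \<in> L2_space \<nu>" by (intro continuous_L2 continuous_on_const)
  have fi: "integrable \<nu> f" using L2_mult_integrable[OF f one] by simp
  have local: "AE p in \<nu>. p \<in> chart_inv c ` box a b \<longrightarrow> f p = 0"
    if i: "c \<in> A" "cbox a b \<subseteq> chart_image c" for c a b
  proof -
    define g where "g x = chart_density c x * f (chart_inv c x)" for x
    have Um[measurable]: "chart_dom c \<in> sets borel" using chart_open(1)[OF i(1)] by simp
    have Ufm: "(\<lambda>p. indicator (chart_dom c) p * f p) \<in> borel_measurable borel" by measurable
    have "integrable \<nu> (\<lambda>p. indicator (chart_dom c) p * f p)"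
      using integrable_real_mult_indicator[of "chart_dom c" \<nu> f] fi chart_open(1)[OF i(1)] sets_nu
      by (simp add: mult.commute)
    then have gi: "integrable lborel g"
      unfolding g_def using chart_integral(1)[OF i(1) Ufm] by simp
    have gm[measurable]: "g \<in> borel_measurable borel" using borel_measurable_integrable[OF gi] by simp
    have bump0: "(LINT x|lborel. box_bump l u r x * g x) = 0" if lu: "cbox l u \<subseteq> chart_image c" and r: "r > 0" for l u r
    proof -
      let ?\<beta> = "chart_ext c (box_bump l u r)"
      have \<beta>: "?\<beta> \<in> smooth" by (rule chart_bump_smooth[OF i(1) lu r])
      have \<beta>m[measurable]: "?\<beta> \<in> borel_measurable borel"
        using smooth_continuous[OF \<beta>] by (rule borel_measurable_continuous_onI)
      have m: "(\<lambda>p. indicator (chart_dom c) p * (f p * ?\<beta> p)) \<in> borel_measurable borel"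
        by measurable
      have "0 = L2_inner \<nu> f ?\<beta>" using orth[OF \<beta>] by simp
      also have "\<dots> = (LINT p|\<nu>. indicator (chart_dom c) p * (f p * ?\<beta> p))"
        unfolding L2_inner_def by (intro Bochner_Integration.integral_cong refl) (auto simp: chart_ext_def)
      also have "\<dots> = (LINT x|lborel. chart_density c x * (f (chart_inv c x) * ?\<beta> (chart_inv c x)))"
        by (rule chart_integral(2)[OF i(1) m])
      also have "\<dots> = (LINT x|lborel. box_bump l u r x * g x)"
        by (intro Bochner_Integration.integral_cong refl)
          (auto simp: g_def chart_ext_def chart_density_def i(1) split: split_indicator)
      finally show ?thesis by simp
    qed
    have bump_m[measurable]: "box_bump l u r \<in> borel_measurable borel" for l u :: "real^'n" and r
      using Ck_on_continuous[OF Ck_on_box_bump[OF open_UNIV, of 0]] by (rule borel_measurable_continuous_onI)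
    have box0: "(LINT x|lborel. indicator (box l u) x * g x) = 0" if lu: "cbox l u \<subseteq> chart_image c" for l u
    proof -
      have "(\<lambda>n. LINT x|lborel. box_bump l u (real (Suc n)) x * g x) \<longlonglongrightarrow> (LINT x|lborel. indicator (box l u) x * g x)"
      proof (rule integral_dominated_convergence[where w = "\<lambda>x. \<bar>g x\<bar>"])
        show "AE x in lborel. (\<lambda>n. box_bump l u (real (Suc n)) x * g x) \<longlonglongrightarrow> indicator (box l u) x * g x"
          by (intro AE_I2 tendsto_mult box_bump_limit tendsto_const)
        show "AE x in lborel. norm (box_bump l u (real (Suc n)) x * g x) \<le> \<bar>g x\<bar>" for n
          using box_bump_bounds[of l u "real (Suc n)"] by (intro AE_I2) (simp add: abs_mult mult_left_le_one_le)
      qed (use gi in auto)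
      then show ?thesis using bump0[OF lu] by (simp add: LIMSEQ_const_iff)
    qed
    have "AE x in lborel. indicator (box a b) x * g x = 0"
    proof (rule AE_eq_0_if_box_integrals_eq_0)
      show "integrable lborel (\<lambda>x. indicator (box a b) x * g x)"
        using integrable_real_mult_indicator[of "box a b" lborel g] gi by (simp add: mult.commute)
      fix l u :: "real^'n"
      \<comment> \<open>intersecting with the box keeps all boxes inside the image of the chart\<close>
      obtain l' u' where lu: "box a b \<inter> box l u = box l' u'" "cbox a b \<inter> cbox l u = cbox l' u'"
        using box_Int_box[of a b l u] Int_interval[of a b l u] by blast
      have "(LINT x|lborel. indicator (box l u) x * (indicator (box a b) x * g x)) = (LINT x|lborel. indicator (box l' u') x * g x)"
        by (intro Bochner_Integration.integral_cong refl) (auto simp: lu(1)[symmetric] split: split_indicator)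
      also have "\<dots> = 0" using lu(2) i(2) by (intro box0) blast
      finally show "(LINT x|lborel. indicator (box l u) x * (indicator (box a b) x * g x)) = 0" .
    qed
    then have "AE x in lborel. x \<in> chart_image c \<longrightarrow> (chart_inv c x \<in> chart_inv c ` box a b \<longrightarrow> f (chart_inv c x) = 0)"
    proof eventually_elim
      case (elim x)
      show ?case
      proof (intro impI)
        assume x: "x \<in> chart_image c" "chart_inv c x \<in> chart_inv c ` box a b"
        then obtain y where y: "y \<in> box a b" "chart_inv c x = chart_inv c y" by auto
        then have "y \<in> chart_image c" using i(2) box_subset_cbox[of a b] by auto
        then have "x = y" using y(2) x(1) i(1) by (metis chart_map_inv)
        then show "f (chart_inv c x) = 0"
          using elim y(1) chart_density_pos[OF i(1) x(1)] by (simp add: g_def)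
      qed
    qed
    note ae = this
    have bV: "box a b \<subseteq> chart_image c" using i(2) box_subset_cbox[of a b] by blast
    then have "open (chart_inv c ` box a b)" by (intro open_chart_preimage i(1) open_box)
    then have [measurable]: "chart_inv c ` box a b \<in> sets borel" by simp
    have "Measurable.pred borel (\<lambda>p. p \<in> chart_inv c ` box a b \<longrightarrow> f p = 0)" by measurable
    then have "AE p in \<nu>. p \<in> chart_dom c \<longrightarrow> (p \<in> chart_inv c ` box a b \<longrightarrow> f p = 0)"
      using ae by (rule chart_AE[OF i(1)])
    then show ?thesis
      using bV i(1) by (auto elim!: eventually_mono)
  qed
  have "AE p in \<nu>. \<forall>i\<in>I. p \<in> chart_inv (fst i) ` box (fst (snd i)) (snd (snd i)) \<longrightarrow> f p = 0"
    using I local by (intro AE_finite_allI) (auto simp: box_cover_def)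
  then show ?thesis
  proof eventually_elim
    case (elim p)
    obtain c a b where cab: "(c, a, b) \<in> I" "p \<in> chart_dom c" "chart_map c p \<in> box a b"
      using I unfolding box_cover_def by blast
    have "c \<in> A" using I cab(1) by (auto simp: box_cover_def)
    then have "p \<in> chart_inv c ` box a b" using cab chart_inv_map by (metis image_eqI)
    then show ?case using elim cab(1) by force
  qed
qed

end

section \<open>Compactness of the embedding of the form domain\<close>

text \<open>
  The family may repeat members, which a sum over a set counts only once; the factor \<open>sqrt (card J)\<close>
  compensates for this.
\<close>

lemma (in semi_inner) finite_family_to_set:
  assumes J: "finite J" and \<phi>: "\<And>j. j \<in> J \<Longrightarrow> \<phi> j \<in> H"
  shows "\<exists>\<Phi>. finite \<Phi> \<and> \<Phi> \<subseteq> H \<and> (\<forall>v\<in>H. (\<Sum>j\<in>J. (ip (\<phi> j) v)\<^sup>2) \<le> (\<Sum>\<psi>\<in>\<Phi>. (ip \<psi> v)\<^sup>2))"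
proof (cases "J = {}")
  case True
  then show ?thesis by (intro exI[of _ "{}"]) simp
next
  case False
  define s where "s = sqrt (real (card J))"
  have s: "s > 0" "s\<^sup>2 = real (card J)" using J False by (auto simp: s_def card_gt_0_iff)
  have inj: "inj_on ((*\<^sub>R) s) (\<phi> ` J)" using s(1) by (auto intro: inj_onI)
  have "(\<Sum>j\<in>J. (ip (\<phi> j) v)\<^sup>2) \<le> (\<Sum>\<psi>\<in>(*\<^sub>R) s ` \<phi> ` J. (ip \<psi> v)\<^sup>2)" if v: "v \<in> H" for v
  proof -
    have "(\<Sum>j\<in>J. (ip (\<phi> j) v)\<^sup>2) = (\<Sum>y\<in>\<phi> ` J. \<Sum>j\<in>{j \<in> J. \<phi> j = y}. (ip (\<phi> j) v)\<^sup>2)"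
      by (rule sum.image_gen[OF J])
    also have "\<dots> = (\<Sum>y\<in>\<phi> ` J. real (card {j \<in> J. \<phi> j = y}) * (ip y v)\<^sup>2)"
      by (intro sum.cong) auto
    also have "\<dots> \<le> (\<Sum>y\<in>\<phi> ` J. s\<^sup>2 * (ip y v)\<^sup>2)"
      unfolding s(2) using J by (intro sum_mono mult_right_mono) (auto intro: card_mono)
    also have "\<dots> = (\<Sum>y\<in>\<phi> ` J. (ip (s *\<^sub>R y) v)\<^sup>2)"
      using \<phi> v by (intro sum.cong) (auto simp: ip_scale power_mult_distrib)
    also have "\<dots> = (\<Sum>\<psi>\<in>(*\<^sub>R) s ` \<phi> ` J. (ip \<psi> v)\<^sup>2)"
      by (simp add: sum.reindex[OF inj])
    finally show ?thesis .
  qed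
  then show ?thesis
    using J \<phi> by (intro exI[of _ "(*\<^sub>R) s ` \<phi> ` J"]) auto
qed

lemma lebesgue_integral_compact:
  fixes f :: "'a::euclidean_space \<Rightarrow> real"
  assumes "compact K" "continuous_on K f"
  shows "(LINT x|lborel. indicator K x * f x) = integral K f" "f integrable_on K"
proof -
  have "set_integrable lborel K f" unfolding set_integrable_def by (rule borel_integrable_compact[OF assms])
  from set_borel_integral_eq_integral[OF this]
  show "(LINT x|lborel. indicator K x * f x) = integral K f" "f integrable_on K"
    by (simp_all add: set_lebesgue_integral_def)
qed

text \<open>
  The Poincare inequality is applied to the pieces of a subdivision into boxes of diameter at most \<open>d\<close>. The
  subdivision depends on \<open>d\<close> but not on \<open>u\<close>, so the mean values on its pieces are finitely many functionals.
\<close>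

lemma poincare_subdivision:
  fixes a b :: "real^'n"
  assumes d: "d > 0"
  shows "\<exists>\<K>. finite \<K> \<and> (\<forall>K\<in>\<K>. compact K \<and> K \<subseteq> cbox a b) \<and>
    (\<forall>S u. open S \<longrightarrow> cbox a b \<subseteq> S \<longrightarrow> Ck_on (Suc 0) S u \<longrightarrow>
      (LINT x|lborel. indicator (cbox a b) x * (u x)\<^sup>2) \<le>
        (\<Sum>K\<in>\<K>. (1 / measure lborel K) * (LINT x|lborel. indicator K x * u x)\<^sup>2)
        + 2 ^ CARD('n) * d\<^sup>2 * (LINT x|lborel. indicator (cbox a b) x * grad_sq u x))"
proof -
  obtain p where p: "p tagged_division_of (cbox a b)" "(\<lambda>x. ball x (d / 2)) fine p"
    using fine_division_exists[of "\<lambda>x. ball x (d / 2)" a b] d by (auto simp: gauge_def)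
  define \<K> where "\<K> = snd ` p"
  have div: "\<K> division_of (cbox a b)" unfolding \<K>_def by (rule division_of_tagged_division[OF p(1)])
  have small: "norm (x - y) \<le> d" if K: "K \<in> \<K>" and xy: "x \<in> K" "y \<in> K" for K x y
  proof -
    obtain z where "(z, K) \<in> p" using K by (auto simp: \<K>_def)
    then have "K \<subseteq> ball z (d / 2)" using p(2) by (auto simp: fine_def)
    then have "dist z x < d / 2" "dist z y < d / 2" using xy by auto
    then show ?thesis using dist_triangle_half_r[of z x d y] by (simp add: dist_norm)
  qed
  have K: "\<exists>l r. K = cbox l r" "K \<subseteq> cbox a b" if "K \<in> \<K>" for K
    using division_ofD[OF div] that by blast+
  have "(LINT x|lborel. indicator (cbox a b) x * (u x)\<^sup>2) \<le>
        (\<Sum>K\<in>\<K>. (1 / measure lborel K) * (LINT x|lborel. indicator K x * u x)\<^sup>2)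
        + 2 ^ CARD('n) * d\<^sup>2 * (LINT x|lborel. indicator (cbox a b) x * grad_sq u x)"
    if S: "open S" "cbox a b \<subseteq> S" and u: "Ck_on (Suc 0) S u" for S u
  proof -
    have uc: "continuous_on T (\<lambda>x. (u x)\<^sup>2)" if "T \<subseteq> cbox a b" for T
      using Ck_on_continuous[OF u] S(2) that by (auto intro!: continuous_intros intro: continuous_on_subset)
    have "continuous_on S (grad_sq u)"
      unfolding grad_sq_def[abs_def] using u by (auto intro!: continuous_intros)
    then have gc: "continuous_on T (grad_sq u)" if "T \<subseteq> cbox a b" for T
      by (rule continuous_on_subset) (use that S(2) in blast)
    have Kc: "compact K" if "K \<in> \<K>" for K using K(1)[OF that] by auto
    have piece: "integral K (\<lambda>x. (u x)\<^sup>2) \<le> (1 / measure lborel K) * (LINT x|lborel. indicator K x * u x)\<^sup>2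
        + 2 ^ CARD('n) * d\<^sup>2 * integral K (grad_sq u)" if Kin: "K \<in> \<K>" for K
    \<comment> \<open>a degenerate piece contributes nothing; there the quotient \<open>1 / measure lborel K\<close> is 0\<close>
    proof (cases "measure lborel K = 0")
      case True
      obtain l r where lr: "K = cbox l r" using K(1)[OF Kin] by blast
      have "negligible K" using True unfolding lr
        by (simp add: negligible_iff_measure0 lmeasurable_cbox)
      then have "integral K (\<lambda>x. (u x)\<^sup>2) = 0" "integral K (grad_sq u) = 0"
        by (auto intro!: integral_unique has_integral_negligible[of K])
      then show ?thesis using True by simp
    next
      case False
      then have V: "measure lborel K > 0" using measure_nonneg[of lborel K] by linarith
      have "convex K" using K(1)[OF Kin] by auto
      from poincare_inequality[OF S(1) u Kc[OF Kin] this order_trans[OF K(2)[OF Kin] S(2)] small[OF Kin]]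
      have "measure lborel K * integral K (\<lambda>x. (u x)\<^sup>2) \<le> (LINT x|lborel. indicator K x * u x)\<^sup>2
          + measure lborel K * (2 ^ CARD('n) * d\<^sup>2 * integral K (grad_sq u))"
        by (simp add: lebesgue_integral_compact Kc[OF Kin] uc gc K(2)[OF Kin])
      then show ?thesis using V by (simp add: field_simps)
    qed
    have "integral (cbox a b) (\<lambda>x. (u x)\<^sup>2) = (\<Sum>K\<in>\<K>. integral K (\<lambda>x. (u x)\<^sup>2))"
      using lebesgue_integral_compact(2)[OF compact_cbox uc] by (intro integral_combine_division_topdown div) auto
    also have "\<dots> \<le> (\<Sum>K\<in>\<K>. (1 / measure lborel K) * (LINT x|lborel. indicator K x * u x)\<^sup>2
        + 2 ^ CARD('n) * d\<^sup>2 * integral K (grad_sq u))"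
      by (intro sum_mono piece)
    also have "\<dots> = (\<Sum>K\<in>\<K>. (1 / measure lborel K) * (LINT x|lborel. indicator K x * u x)\<^sup>2)
        + 2 ^ CARD('n) * d\<^sup>2 * (\<Sum>K\<in>\<K>. integral K (grad_sq u))"
      by (simp add: sum.distrib sum_distrib_left)
    also have "(\<Sum>K\<in>\<K>. integral K (grad_sq u)) = integral (cbox a b) (grad_sq u)"
      using lebesgue_integral_compact(2)[OF compact_cbox gc]
      by (intro integral_combine_division_topdown[symmetric] div) auto
    finally show ?thesis by (simp add: lebesgue_integral_compact uc gc)
  qed
  moreover have "finite \<K>" using div by auto
  moreover have "compact K \<and> K \<subseteq> cbox a b" if "K \<in> \<K>" for K using K[OF that] by auto
  ultimately show ?thesis by (intro exI[of _ \<K>]) blast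
qed

lemma norm_grad_sq: "grad_sq u x = (norm (\<chi> i. partial_deriv i u x))\<^sup>2"
  unfolding power2_norm_eq_inner grad_sq_def by (simp add: inner_vec_def power2_eq_square)

context weighted_manifold
begin

text \<open>
  On a compact part of a chart, the volume density and the metric are comparable to the Euclidean ones, by
  compactness of \<open>Q\<close> and of the unit sphere.
\<close>

lemma chart_bounds:
  assumes c: "c \<in> A" and Q: "compact Q" "Q \<subseteq> chart_image c"
  obtains w1 w2 e where "w1 > 0" "w2 > 0" "e > 0"
    "\<And>x. x \<in> Q \<Longrightarrow> w1 \<le> chart_density c x" "\<And>x. x \<in> Q \<Longrightarrow> chart_density c x \<le> w2"
    "\<And>x \<xi>. x \<in> Q \<Longrightarrow> (norm \<xi>)\<^sup>2 \<le> e * (\<xi> \<bullet> (matrix_inv (G c x) *v \<xi>))"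
proof (cases "Q = {}")
  case True
  then show ?thesis using that[of 1 1 1] by simp
next
  case False
  have dc: "continuous_on Q (chart_density c)"
  proof (rule continuous_on_eq)
    show "continuous_on Q (\<lambda>x. \<kappa> * wt c x)"
      using Ck_on_continuous[OF wt_smooth[OF c]] Q(2) by (auto intro!: continuous_intros intro: continuous_on_subset)
    show "\<kappa> * wt c x = chart_density c x" if "x \<in> Q" for x using that Q(2) by (auto simp: chart_density_def)
  qed
  obtain x1 where x1: "x1 \<in> Q" "\<forall>y\<in>Q. chart_density c x1 \<le> chart_density c y"
    using continuous_attains_inf[OF Q(1) False dc] by blast
  obtain x2 where x2: "x2 \<in> Q" "\<forall>y\<in>Q. chart_density c y \<le> chart_density c x2"
    using continuous_attains_sup[OF Q(1) False dc] by blast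
  define h where "h z = snd z \<bullet> (matrix_inv (G c (fst z)) *v snd z)" for z :: "(real^'n) \<times> (real^'n)"
  let ?T = "Q \<times> sphere (0::real^'n) 1"
  have entry: "continuous_on ?T (\<lambda>z. matrix_inv (G c (fst z)) $ i $ j)" for i j
  proof -
    have "continuous_on Q (\<lambda>x. matrix_inv (G c x) $ i $ j)"
      using Ck_on_continuous[OF metric_inv_smooth[OF c]] Q(2) by (rule continuous_on_subset)
    then show ?thesis by (rule continuous_on_compose2[OF _ continuous_on_fst[OF continuous_on_id]]) auto
  qed
  have hc: "continuous_on ?T h"
    unfolding h_def inner_vec_def matrix_vector_mult_def
    by (simp add: inner_real_def) (intro continuous_intros entry)
  have cT: "compact ?T" using Q(1) by (intro compact_Times compact_sphere)
  have neT: "?T \<noteq> {}"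
  proof -
    have "axis undefined 1 \<in> sphere (0::real^'n) 1" by simp
    then show ?thesis using False by blast
  qed
  obtain z where z: "z \<in> ?T" "\<forall>y\<in>?T. h z \<le> h y"
    using continuous_attains_inf[OF cT neT hc] by blast
  have hz: "h z > 0"
  proof -
    have "fst z \<in> chart_image c" "snd z \<noteq> 0" using z(1) Q(2) by auto
    then show ?thesis unfolding h_def by (intro pos_def_matrix_inv_pos metric_pos_def c)
  qed
  have ell: "(norm \<xi>)\<^sup>2 \<le> (1 / h z) * (\<xi> \<bullet> (matrix_inv (G c x) *v \<xi>))" if x: "x \<in> Q" for x \<xi>
  proof (cases "\<xi> = 0")
    case False
    define \<eta> where "\<eta> = (1 / norm \<xi>) *\<^sub>R \<xi>"
    have "(x, \<eta>) \<in> ?T" using x False by (simp add: \<eta>_def)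
    then have "h z \<le> \<eta> \<bullet> (matrix_inv (G c x) *v \<eta>)" using z(2) by (auto simp: h_def)
    also have "\<dots> = (\<xi> \<bullet> (matrix_inv (G c x) *v \<xi>)) / (norm \<xi>)\<^sup>2"
      by (simp add: \<eta>_def matrix_vector_mult_scaleR power2_eq_square)
    finally show ?thesis using hz False by (simp add: field_simps)
  qed simp
  show ?thesis
  proof (rule that[of "chart_density c x1" "chart_density c x2" "1 / h z"])
    show "chart_density c x1 > 0" "chart_density c x2 > 0"
      using chart_density_pos[OF c] x1(1) x2(1) Q(2) by auto
  qed (use x1 x2 hz ell in auto)
qed

text \<open>
  \<open>poincare_subdivision\<close> carried over to the manifold by means of \<open>chart_bounds\<close>. The functions \<open>\<phi> K\<close> are
  indicator functions of the pieces, divided by the density so that pairing with them yields Euclidean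
  integrals over the pieces.
\<close>

lemma box_compactness:
  assumes c: "c \<in> A" and ab: "cbox a b \<subseteq> chart_image c" and \<delta>: "\<delta> > 0"
  shows "\<exists>(J :: (real^'n) set set) \<phi>. finite J \<and> (\<forall>j\<in>J. \<phi> j \<in> L2_space \<nu>) \<and>
    (\<forall>v\<in>smooth. (LINT p|\<nu>. indicator (chart_inv c ` cbox a b) p * (v p)\<^sup>2)
        \<le> \<delta> * (LINT p|\<nu>. \<Gamma> v v p) + (\<Sum>j\<in>J. (L2_inner \<nu> (\<phi> j) v)\<^sup>2))"
proof -
  let ?Q = "cbox a b" and ?U = "chart_dom c"
  obtain w1 w2 e where w: "w1 > 0" "w2 > 0" "e > 0"
    and b1: "\<And>x. x \<in> ?Q \<Longrightarrow> w1 \<le> chart_density c x" and b2: "\<And>x. x \<in> ?Q \<Longrightarrow> chart_density c x \<le> w2"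
    and b3: "\<And>x \<xi>. x \<in> ?Q \<Longrightarrow> (norm \<xi>)\<^sup>2 \<le> e * (\<xi> \<bullet> (matrix_inv (G c x) *v \<xi>))"
    using chart_bounds[OF c compact_cbox ab] by blast
  \<comment> \<open>small enough for the gradient term to end up with the factor \<open>\<delta>\<close>\<close>
  define d where "d = sqrt (\<delta> * w1 / (w2 * 2 ^ CARD('n) * e))"
  have d: "d > 0" "w2 * (2 ^ CARD('n) * d\<^sup>2 * (e / w1)) = \<delta>"
    using w \<delta> by (auto simp: d_def field_simps)
  obtain \<K> where \<K>: "finite \<K>" "\<And>K. K \<in> \<K> \<Longrightarrow> compact K \<and> K \<subseteq> ?Q"
    and P: "\<And>S u. open S \<Longrightarrow> ?Q \<subseteq> S \<Longrightarrow> Ck_on (Suc 0) S u \<Longrightarrow>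
      (LINT x|lborel. indicator ?Q x * (u x)\<^sup>2) \<le>
        (\<Sum>K\<in>\<K>. (1 / measure lborel K) * (LINT x|lborel. indicator K x * u x)\<^sup>2)
        + 2 ^ CARD('n) * d\<^sup>2 * (LINT x|lborel. indicator ?Q x * grad_sq u x)"
    using poincare_subdivision[OF d(1), of a b] by (elim exE conjE) blast
  have KV: "K \<subseteq> chart_image c" if "K \<in> \<K>" for K using \<K>(2)[OF that] ab by blast
  have closed_img: "closed (chart_inv c ` K)" if "compact K" "K \<subseteq> chart_image c" for K
    by (rule compact_imp_closed[OF compact_chart_inv[OF c that]])
  have img_iff: "p \<in> chart_inv c ` K \<longleftrightarrow> p \<in> ?U \<and> chart_map c p \<in> K" if "K \<subseteq> chart_image c" for K p
    using that c by (auto simp: image_iff) force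
  define \<phi> where "\<phi> K p = sqrt (w2 / measure lborel K) * (indicator (chart_inv c ` K) p / chart_density c (chart_map c p))" for K p
  have Um[measurable]: "?U \<in> sets borel" using chart_open(1)[OF c] by simp
  have \<phi>m: "\<phi> K \<in> borel_measurable borel" if "K \<in> \<K>" for K
  proof -
    have [measurable]: "chart_inv c ` K \<in> sets borel"
      using closed_img[OF _ KV[OF that]] \<K>(2)[OF that] by simp
    have "continuous_on ?U (\<lambda>p. 1 / chart_density c (chart_map c p))"
    proof -
      have "continuous_on (chart_image c) (\<lambda>x. 1 / (\<kappa> * wt c x))"
        using Ck_on_continuous[OF wt_smooth[OF c]] wt_pos[OF c] kappa_pos
        by (intro continuous_intros) force+
      then have "continuous_on ?U (\<lambda>p. 1 / (\<kappa> * wt c (chart_map c p)))"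
        using chart_cont(1)[OF c] by (rule continuous_on_compose2) (use chart_map_image[OF c] in auto)
      then show ?thesis by (rule continuous_on_eq) (simp add: chart_density_def c)
    qed
    then have [measurable]: "(\<lambda>p. indicator ?U p * (1 / chart_density c (chart_map c p))) \<in> borel_measurable borel"
      by (rule borel_measurable_indicator_continuous[OF chart_open(1)[OF c]])
    have eq: "\<phi> K = (\<lambda>p. sqrt (w2 / measure lborel K) * (indicator (chart_inv c ` K) p * (indicator ?U p * (1 / chart_density c (chart_map c p)))))"
      by (auto simp: \<phi>_def fun_eq_iff img_iff[OF KV[OF that]] indicator_def)
    show ?thesis unfolding eq by measurable
  qed
  have \<phi>L: "\<phi> K \<in> L2_space \<nu>" if K: "K \<in> \<K>" for K
  proof -
    interpret finite_measure \<nu> by (rule finite_nu)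
    have "\<bar>\<phi> K p\<bar> \<le> sqrt (w2 / measure lborel K) * (1 / w1)" for p
    proof -
      have "indicator (chart_inv c ` K) p / chart_density c (chart_map c p) \<le> 1 / w1"
      proof (cases "p \<in> chart_inv c ` K")
        case True
        then have "w1 \<le> chart_density c (chart_map c p)"
          using \<K>(2)[OF K] by (intro b1) (auto simp: img_iff[OF KV[OF K]])
        then show ?thesis using True w by (simp add: frac_le)
      qed (use w in simp)
      moreover have "0 \<le> indicator (chart_inv c ` K) p / chart_density c (chart_map c p)"
        using chart_density_nonneg[OF c] by simp
      moreover have "0 \<le> sqrt (w2 / measure lborel K)" using w by simp
      ultimately show ?thesis unfolding \<phi>_def abs_mult by (simp only: abs_of_nonneg mult_left_mono)
    qed
    then have "norm ((\<phi> K p)\<^sup>2) \<le> (sqrt (w2 / measure lborel K) * (1 / w1))\<^sup>2" for p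
      using power_mono[of "\<bar>\<phi> K p\<bar>" _ 2] by simp
    then have "integrable \<nu> (\<lambda>p. (\<phi> K p)\<^sup>2)"
      using \<phi>m[OF K] by (intro integrable_const_bound) auto
    then show ?thesis using \<phi>m[OF K] by (simp add: L2_space_def)
  qed
  have main: "(LINT p|\<nu>. indicator (chart_inv c ` ?Q) p * (v p)\<^sup>2)
        \<le> \<delta> * (LINT p|\<nu>. \<Gamma> v v p) + (\<Sum>K\<in>\<K>. (L2_inner \<nu> (\<phi> K) v)\<^sup>2)" if v: "v \<in> smooth" for v
  proof -
    define u where "u = rep c v"
    have u: "Ck_on k (chart_image c) u" for k unfolding u_def by (rule smooth_rep[OF c v])
    have vm[measurable]: "v \<in> borel_measurable borel" using smooth_continuous[OF v] by (rule borel_measurable_continuous_onI)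
    have gm[measurable]: "\<Gamma> v v \<in> borel_measurable borel" using \<Gamma>_continuous[OF v v] by (rule borel_measurable_continuous_onI)
    have [measurable]: "chart_inv c ` ?Q \<in> sets borel" using closed_img[OF compact_cbox ab] by simp
    have Qc: "continuous_on ?Q f" if "continuous_on (chart_image c) f" for f :: "real^'n \<Rightarrow> real"
      using that ab by (rule continuous_on_subset)
    have int: "integrable lborel (\<lambda>x. indicator ?Q x * f x)" if "continuous_on ?Q f" for f :: "real^'n \<Rightarrow> real"
      using borel_integrable_compact[OF compact_cbox that] by simp
    have transfer: "(LINT p|\<nu>. indicator (chart_inv c ` K) p * F p)
        = (LINT x|lborel. chart_density c x * (indicator K x * F (chart_inv c x)))"
      if K: "compact K" "K \<subseteq> chart_image c" and F[measurable]: "F \<in> borel_measurable borel" for F K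
    proof -
      have [measurable]: "chart_inv c ` K \<in> sets borel" using closed_img[OF K] by simp
      have m: "(\<lambda>p. indicator ?U p * (indicator (chart_inv c ` K) p * F p)) \<in> borel_measurable borel" by measurable
      have "(LINT p|\<nu>. indicator (chart_inv c ` K) p * F p) = (LINT p|\<nu>. indicator ?U p * (indicator (chart_inv c ` K) p * F p))"
        by (intro Bochner_Integration.integral_cong refl) (auto simp: img_iff[OF K(2)] indicator_def)
      also have "\<dots> = (LINT x|lborel. chart_density c x * (indicator (chart_inv c ` K) (chart_inv c x) * F (chart_inv c x)))"
        by (rule chart_integral(2)[OF c m])
      also have "\<dots> = (LINT x|lborel. chart_density c x * (indicator K x * F (chart_inv c x)))"
        using img_iff[OF K(2)] c
        by (intro Bochner_Integration.integral_cong refl) (auto simp: chart_density_def indicator_def)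
      finally show ?thesis .
    qed
    have dens_c: "continuous_on ?Q (\<lambda>x. chart_density c x * f x)" if "continuous_on (chart_image c) f" for f
    proof (rule continuous_on_eq)
      show "continuous_on ?Q (\<lambda>x. (\<kappa> * wt c x) * f x)"
        using Ck_on_continuous[OF wt_smooth[OF c]] that by (intro Qc continuous_intros)
      show "(\<kappa> * wt c x) * f x = chart_density c x * f x" if "x \<in> ?Q" for x using that ab by (auto simp: chart_density_def)
    qed
    have gcont: "continuous_on (chart_image c) (gam c u u)" by (rule gam_continuous[OF c u u])
    have gcont': "continuous_on (chart_image c) (grad_sq u)"
      unfolding grad_sq_def[abs_def] using u[of "Suc 0"] by (auto intro!: continuous_intros)
    have ucont: "continuous_on (chart_image c) u" using u by (rule Ck_on_continuous)
    have gn: "0 \<le> gam c u u x" if "x \<in> ?Q" for x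
      unfolding gam_def using that ab by (intro pos_def_matrix_inv_nonneg metric_pos_def c) auto
    have "(LINT p|\<nu>. indicator (chart_inv c ` ?Q) p * (v p)\<^sup>2)
        = (LINT x|lborel. indicator ?Q x * (chart_density c x * (u x)\<^sup>2))"
      by (subst transfer[OF compact_cbox ab]) (auto simp: u_def rep_def mult_ac)
    also have "\<dots> \<le> (LINT x|lborel. w2 * (indicator ?Q x * (u x)\<^sup>2))"
    proof (rule integral_mono)
      show "integrable lborel (\<lambda>x. indicator ?Q x * (chart_density c x * (u x)\<^sup>2))"
        using ucont by (intro int dens_c continuous_intros)
      show "integrable lborel (\<lambda>x. w2 * (indicator ?Q x * (u x)\<^sup>2))"
        using ucont by (intro integrable_mult_right int Qc continuous_intros)
      show "indicator ?Q x * (chart_density c x * (u x)\<^sup>2) \<le> w2 * (indicator ?Q x * (u x)\<^sup>2)" for x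
        using b2[of x] by (auto simp: indicator_def intro!: mult_right_mono)
    qed
    also have "\<dots> = w2 * (LINT x|lborel. indicator ?Q x * (u x)\<^sup>2)" by simp
    also have "\<dots> \<le> w2 * ((\<Sum>K\<in>\<K>. (1 / measure lborel K) * (LINT x|lborel. indicator K x * u x)\<^sup>2)
        + 2 ^ CARD('n) * d\<^sup>2 * (LINT x|lborel. indicator ?Q x * grad_sq u x))"
      using w by (intro mult_left_mono P[OF chart_open(2)[OF c] ab u]) auto
    also have "\<dots> \<le> w2 * ((\<Sum>K\<in>\<K>. (1 / measure lborel K) * (LINT x|lborel. indicator K x * u x)\<^sup>2)
        + 2 ^ CARD('n) * d\<^sup>2 * ((e / w1) * (LINT p|\<nu>. \<Gamma> v v p)))"
    proof -
      have e1: "(LINT x|lborel. indicator ?Q x * grad_sq u x) \<le> (LINT x|lborel. (e / w1) * (indicator ?Q x * (chart_density c x * gam c u u x)))"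
      proof (rule integral_mono)
        show "integrable lborel (\<lambda>x. indicator ?Q x * grad_sq u x)" using gcont' by (intro int Qc)
        show "integrable lborel (\<lambda>x. (e / w1) * (indicator ?Q x * (chart_density c x * gam c u u x)))"
          using gcont by (intro integrable_mult_right int dens_c)
        show "indicator ?Q x * grad_sq u x \<le> (e / w1) * (indicator ?Q x * (chart_density c x * gam c u u x))" for x
        proof (cases "x \<in> ?Q")
          case True
          have "grad_sq u x \<le> e * gam c u u x"
            unfolding norm_grad_sq gam_def grad_def by (rule b3[OF True])
          also have "\<dots> = (e / w1) * (w1 * gam c u u x)" using w by simp
          also have "\<dots> \<le> (e / w1) * (chart_density c x * gam c u u x)"
            using w b1[OF True] gn[OF True] by (intro mult_left_mono mult_right_mono) auto
          finally show ?thesis using True by simp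
        qed simp
      qed
      have e2: "(LINT x|lborel. (e / w1) * (indicator ?Q x * (chart_density c x * gam c u u x)))
          = (e / w1) * (LINT x|lborel. chart_density c x * (indicator ?Q x * gam c u u x))" by (simp add: mult_ac)
      have "(LINT x|lborel. chart_density c x * (indicator ?Q x * gam c u u x))
          = (LINT x|lborel. chart_density c x * (indicator ?Q x * \<Gamma> v v (chart_inv c x)))"
        using \<Gamma>_chart[OF c _ v v] ab c
        by (intro Bochner_Integration.integral_cong refl) (auto simp: chart_gam_def u_def indicator_def)
      also have "\<dots> = (LINT p|\<nu>. indicator (chart_inv c ` ?Q) p * \<Gamma> v v p)"
        by (rule transfer[OF compact_cbox ab gm, symmetric])
      also have "\<dots> \<le> (LINT p|\<nu>. \<Gamma> v v p)"
      proof (rule integral_mono)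
        show "integrable \<nu> (\<Gamma> v v)" using \<Gamma>_continuous[OF v v] by (rule continuous_integrable)
        then show "integrable \<nu> (\<lambda>p. indicator (chart_inv c ` ?Q) p * \<Gamma> v v p)"
          using integrable_real_mult_indicator[of "chart_inv c ` ?Q" \<nu> "\<Gamma> v v"] sets_nu closed_img[OF compact_cbox ab]
          by (simp add: mult.commute)
        show "indicator (chart_inv c ` ?Q) p * \<Gamma> v v p \<le> \<Gamma> v v p" for p
          using \<Gamma>_nonneg[of v p] by (simp add: indicator_def)
      qed
      finally have "(e / w1) * (LINT x|lborel. chart_density c x * (indicator ?Q x * gam c u u x))
          \<le> (e / w1) * (LINT p|\<nu>. \<Gamma> v v p)"
        using w by (intro mult_left_mono) auto
      then have "(LINT x|lborel. indicator ?Q x * grad_sq u x) \<le> (e / w1) * (LINT p|\<nu>. \<Gamma> v v p)"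
        using e1 unfolding e2 by linarith
      then show ?thesis using w by (intro mult_left_mono add_left_mono) auto
    qed
    also have "\<dots> = (\<Sum>K\<in>\<K>. (w2 / measure lborel K) * (LINT x|lborel. indicator K x * u x)\<^sup>2)
        + (w2 * (2 ^ CARD('n) * d\<^sup>2 * (e / w1))) * (LINT p|\<nu>. \<Gamma> v v p)"
      by (simp add: distrib_left sum_distrib_left mult_ac)
    also have "(\<Sum>K\<in>\<K>. (w2 / measure lborel K) * (LINT x|lborel. indicator K x * u x)\<^sup>2) = (\<Sum>K\<in>\<K>. (L2_inner \<nu> (\<phi> K) v)\<^sup>2)"
    proof (rule sum.cong[OF refl])
      fix K assume K: "K \<in> \<K>"
      have Kc: "compact K" using \<K>(2)[OF K] by simp
      let ?s = "sqrt (w2 / measure lborel K)"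
      note [measurable] = \<phi>m[OF K]
      have m: "(\<lambda>p. \<phi> K p * v p) \<in> borel_measurable borel" by measurable
      have "L2_inner \<nu> (\<phi> K) v = (LINT p|\<nu>. indicator (chart_inv c ` K) p * (\<phi> K p * v p))"
        unfolding L2_inner_def by (intro Bochner_Integration.integral_cong refl) (auto simp: \<phi>_def indicator_def)
      also have "\<dots> = (LINT x|lborel. chart_density c x * (indicator K x * (\<phi> K (chart_inv c x) * v (chart_inv c x))))"
        by (rule transfer[OF Kc KV[OF K] m])
      also have "\<dots> = (LINT x|lborel. ?s * (indicator K x * u x))"
      proof (intro Bochner_Integration.integral_cong refl)
        fix x
        show "chart_density c x * (indicator K x * (\<phi> K (chart_inv c x) * v (chart_inv c x))) = ?s * (indicator K x * u x)"
        proof (cases "x \<in> K")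
          case True
          then have x: "x \<in> chart_image c" using KV[OF K] by auto
          have "chart_inv c x \<in> chart_inv c ` K" using True by auto
          then show ?thesis
            using True chart_density_pos[OF c x] c x by (simp add: \<phi>_def u_def rep_def)
        qed simp
      qed
      also have "\<dots> = ?s * (LINT x|lborel. indicator K x * u x)" by simp
      finally show "(w2 / measure lborel K) * (LINT x|lborel. indicator K x * u x)\<^sup>2 = (L2_inner \<nu> (\<phi> K) v)\<^sup>2"
        using w by (simp add: power_mult_distrib)
    qed
    finally show ?thesis unfolding d(2) by linarith
  qed
  show ?thesis
    by (intro exI[of _ \<K>] exI[of _ \<phi>] conjI ballI \<K>(1) \<phi>L main)
qed

text \<open>
  A quantitative form of Rellich's theorem: the estimates for finitely many boxes that cover the manifold are
  added up.
\<close>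

lemma smooth_compactness:
  assumes e: "\<epsilon> > 0"
  shows "\<exists>\<Phi>. finite \<Phi> \<and> \<Phi> \<subseteq> L2_space \<nu> \<and>
    (\<forall>v\<in>smooth. L2_inner \<nu> v v \<le> \<epsilon> * L2_inner \<nu> v (\<lambda>p. - \<Delta> v p) + (\<Sum>\<phi>\<in>\<Phi>. (L2_inner \<nu> \<phi> v)\<^sup>2))"
proof -
  obtain I where I: "box_cover I" using box_cover_exists by blast
  have fin: "finite I" using I by (simp add: box_cover_def)
  define \<delta> where "\<delta> = \<epsilon> / (real (card I) + 1)"
  have \<delta>: "\<delta> > 0" "real (card I) * \<delta> \<le> \<epsilon>" using e by (auto simp: \<delta>_def field_simps)
  define C where "C = (\<lambda>(c :: ('a, 'n) chart, a, b). chart_inv c ` cbox a b)"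
  have "\<exists>P :: (real^'n) set set \<times> ((real^'n) set \<Rightarrow> 'a \<Rightarrow> real). finite (fst P) \<and> (\<forall>j\<in>fst P. snd P j \<in> L2_space \<nu>) \<and>
    (\<forall>v\<in>smooth. (LINT p|\<nu>. indicator (C i) p * (v p)\<^sup>2)
        \<le> \<delta> * (LINT p|\<nu>. \<Gamma> v v p) + (\<Sum>j\<in>fst P. (L2_inner \<nu> (snd P j) v)\<^sup>2))" if i: "i \<in> I" for i
  proof -
    obtain c a b where cab: "i = (c, a, b)" by (cases i)
    then have "c \<in> A" "cbox a b \<subseteq> chart_image c" using I i by (auto simp: box_cover_def)
    from box_compactness[OF this \<delta>(1)] show ?thesis unfolding cab C_def by simp
  qed
  then have "\<forall>i\<in>I. \<exists>P :: (real^'n) set set \<times> ((real^'n) set \<Rightarrow> 'a \<Rightarrow> real). finite (fst P) \<and> (\<forall>j\<in>fst P. snd P j \<in> L2_space \<nu>) \<and>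
    (\<forall>v\<in>smooth. (LINT p|\<nu>. indicator (C i) p * (v p)\<^sup>2)
        \<le> \<delta> * (LINT p|\<nu>. \<Gamma> v v p) + (\<Sum>j\<in>fst P. (L2_inner \<nu> (snd P j) v)\<^sup>2))" by (rule ballI)
  from bchoice[OF this] obtain P where P: "\<forall>i\<in>I. finite (fst (P i) :: (real^'n) set set) \<and> (\<forall>j\<in>fst (P i). snd (P i) j \<in> L2_space \<nu>) \<and>
    (\<forall>v\<in>smooth. (LINT p|\<nu>. indicator (C i) p * (v p)\<^sup>2)
        \<le> \<delta> * (LINT p|\<nu>. \<Gamma> v v p) + (\<Sum>j\<in>fst (P i). (L2_inner \<nu> (snd (P i) j) v)\<^sup>2))" ..
  define J where "J i = fst (P i)" for i
  define \<phi> where "\<phi> i = snd (P i)" for i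
  have J: "finite (J i)" if "i \<in> I" for i using P that by (simp add: J_def)
  have \<phi>: "\<phi> i j \<in> L2_space \<nu>" if "i \<in> I" "j \<in> J i" for i j using P that by (simp add: J_def \<phi>_def)
  have ineq: "(LINT p|\<nu>. indicator (C i) p * (v p)\<^sup>2)
        \<le> \<delta> * (LINT p|\<nu>. \<Gamma> v v p) + (\<Sum>j\<in>J i. (L2_inner \<nu> (\<phi> i j) v)\<^sup>2)" if "i \<in> I" "v \<in> smooth" for i v
    using P that by (simp add: J_def \<phi>_def)
  have "finite (Sigma I J)" using fin J by auto
  then obtain \<Phi> where \<Phi>: "finite \<Phi>" "\<Phi> \<subseteq> L2_space \<nu>"
    "\<And>v. v \<in> L2_space \<nu> \<Longrightarrow> (\<Sum>ij\<in>Sigma I J. (L2_inner \<nu> (case ij of (i, j) \<Rightarrow> \<phi> i j) v)\<^sup>2) \<le> (\<Sum>\<psi>\<in>\<Phi>. (L2_inner \<nu> \<psi> v)\<^sup>2)"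
    using L2.finite_family_to_set[of "Sigma I J" "\<lambda>(i, j). \<phi> i j" \<nu>] \<phi> by auto
  have "L2_inner \<nu> v v \<le> \<epsilon> * L2_inner \<nu> v (\<lambda>p. - \<Delta> v p) + (\<Sum>\<phi>\<in>\<Phi>. (L2_inner \<nu> \<phi> v)\<^sup>2)" if v: "v \<in> smooth" for v
  proof -
    have v2: "integrable \<nu> (\<lambda>p. (v p)\<^sup>2)" using smooth_L2[OF v] by (rule L2_spaceD)
    have Cm: "C i \<in> sets borel" if "i \<in> I" for i
    proof -
      obtain c a b where i: "i = (c, a, b)" by (cases i)
      then have "c \<in> A" "cbox a b \<subseteq> chart_image c" using I that by (auto simp: box_cover_def)
      then show ?thesis
        using compact_imp_closed[OF compact_chart_inv[OF _ compact_cbox]] by (simp add: i C_def)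
    qed
    have vi: "integrable \<nu> (\<lambda>p. indicator (C i) p * (v p)\<^sup>2)" if "i \<in> I" for i
      using integrable_real_mult_indicator[of "C i" \<nu>, OF _ v2] Cm[OF that] sets_nu by (simp add: mult.commute)
    have "L2_inner \<nu> v v = (LINT p|\<nu>. (v p)\<^sup>2)" by (rule L2_inner_sq)
    also have "\<dots> \<le> (LINT p|\<nu>. (\<Sum>i\<in>I. indicator (C i) p * (v p)\<^sup>2))"
    proof (rule integral_mono[OF v2])
      show "integrable \<nu> (\<lambda>p. \<Sum>i\<in>I. indicator (C i) p * (v p)\<^sup>2)" using vi by auto
      fix p
      obtain c a b where i: "(c, a, b) \<in> I" "p \<in> chart_dom c" "chart_map c p \<in> box a b"
        using I unfolding box_cover_def by blast
      have "c \<in> A" using I i(1) by (auto simp: box_cover_def)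
      then have "p \<in> C (c, a, b)"
        using i(2,3) box_subset_cbox[of a b] chart_inv_map[of c p] by (auto simp: C_def image_iff intro!: bexI[of _ "chart_map c p"])
      then have "(v p)\<^sup>2 = indicator (C (c, a, b)) p * (v p)\<^sup>2" by simp
      also have "\<dots> \<le> (\<Sum>i\<in>I. indicator (C i) p * (v p)\<^sup>2)"
        by (rule member_le_sum[OF i(1)]) (use fin in auto)
      finally show "(v p)\<^sup>2 \<le> (\<Sum>i\<in>I. indicator (C i) p * (v p)\<^sup>2)" .
    qed
    also have "\<dots> = (\<Sum>i\<in>I. LINT p|\<nu>. indicator (C i) p * (v p)\<^sup>2)" using vi by simp
    also have "\<dots> \<le> (\<Sum>i\<in>I. \<delta> * (LINT p|\<nu>. \<Gamma> v v p) + (\<Sum>j\<in>J i. (L2_inner \<nu> (\<phi> i j) v)\<^sup>2))"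
      using ineq v by (intro sum_mono) auto
    also have "\<dots> = real (card I) * \<delta> * (LINT p|\<nu>. \<Gamma> v v p) + (\<Sum>ij\<in>Sigma I J. (L2_inner \<nu> (case ij of (i, j) \<Rightarrow> \<phi> i j) v)\<^sup>2)"
      using fin J by (simp add: sum.distrib sum.Sigma split_beta)
    also have "\<dots> \<le> \<epsilon> * (LINT p|\<nu>. \<Gamma> v v p) + (\<Sum>\<phi>\<in>\<Phi>. (L2_inner \<nu> \<phi> v)\<^sup>2)"
      using \<delta>(2) \<Phi>(3)[OF smooth_L2[OF v]] \<Gamma>_nonneg by (intro add_mono mult_right_mono integral_nonneg) auto
    finally show ?thesis by (simp add: green_formula v)
  qed
  then show ?thesis using \<Phi>(1,2) by blast
qed

section \<open>The spectral truncation\<close>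

lemma form_operator_laplace: "form_operator (L2_space \<nu>) (L2_inner \<nu>) smooth (\<lambda>u p. - \<Delta> u p)"
proof
  show "subspace smooth" by (rule subspace_smooth)
  show "smooth \<subseteq> L2_space \<nu>" using smooth_L2 by blast
  show "(\<lambda>p. - \<Delta> v p) \<in> L2_space \<nu>" if "v \<in> smooth" for v
    using laplace_continuous[OF that] by (intro continuous_L2 continuous_intros)
  show "(\<lambda>p. - \<Delta> (u + v) p) = (\<lambda>p. - \<Delta> u p) + (\<lambda>p. - \<Delta> v p)" if "u \<in> smooth" "v \<in> smooth" for u v
    by (simp add: laplace_add that fun_eq_iff)
  show "(\<lambda>p. - \<Delta> (c *\<^sub>R v) p) = c *\<^sub>R (\<lambda>p. - \<Delta> v p)" if "v \<in> smooth" for c v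
    by (simp add: laplace_scale that fun_eq_iff)
  show "L2_inner \<nu> u (\<lambda>p. - \<Delta> v p) = L2_inner \<nu> v (\<lambda>p. - \<Delta> u p)" if "u \<in> smooth" "v \<in> smooth" for u v
    using \<Gamma>_symmetric[OF that] by (simp add: green_formula that)
  show "0 \<le> L2_inner \<nu> v (\<lambda>p. - \<Delta> v p)" if "v \<in> smooth" for v
    using \<Gamma>_nonneg by (simp add: green_formula that)
  show "\<exists>y\<in>L2_space \<nu>. (\<lambda>n. L2.nrm \<nu> (x n - y)) \<longlonglongrightarrow> 0"
    if "\<And>n. x n \<in> L2_space \<nu>" "\<And>e. e > 0 \<Longrightarrow> \<exists>N. \<forall>m\<ge>N. \<forall>n\<ge>N. L2.nrm \<nu> (x m - x n) < e" for x
    using L2_complete[OF finite_nu, of x] that by (simp add: L2_nrm)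
  show "L2_inner \<nu> f f = 0" if "f \<in> L2_space \<nu>" "\<And>v. v \<in> smooth \<Longrightarrow> L2_inner \<nu> f v = 0" for f
    using orthogonal_smooth_AE_0[OF that] L2_norm_zero_AE[OF that(1)] by (simp add: L2_norm_def)
  show "\<exists>\<Phi>. finite \<Phi> \<and> \<Phi> \<subseteq> L2_space \<nu> \<and>
      (\<forall>v\<in>smooth. L2_inner \<nu> v v \<le> \<epsilon> * L2_inner \<nu> v (\<lambda>p. - \<Delta> v p) + (\<Sum>\<phi>\<in>\<Phi>. (L2_inner \<nu> \<phi> v)\<^sup>2))"
    if "\<epsilon> > 0" for \<epsilon> using that by (rule smooth_compactness)
qed

lemma laplace_graph_eq: "laplace_graph A G \<nu> = form_operator.graph (L2_space \<nu>) (L2_inner \<nu>) smooth (\<lambda>u p. - \<Delta> u p)"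
  by (simp add: fun_eq_iff laplace_graph_def form_operator.graph_def[OF form_operator_laplace] L2_nrm fun_diff_def)

lemma laplace_eigenspace_eq:
  "laplace_eigenspace A G \<nu> = form_operator.espace (L2_space \<nu>) (L2_inner \<nu>) smooth (\<lambda>u p. - \<Delta> u p)"
  by (simp add: fun_eq_iff laplace_eigenspace_def form_operator.espace_def[OF form_operator_laplace] laplace_graph_eq scaleR_fun_def)

text \<open>
  Since \<open>1 + \<Lambda> \<le> 1 + \<mu> j\<close> for the omitted eigenvalues, each omitted norm \<open>\<parallel>P j f\<parallel>\<close> is at most
  \<open>(1 + \<Lambda>)\<^bsup>-s/2\<^esup>\<close> times the \<open>j\<close>-th term of the spectral norm.
\<close>

lemma spectral_truncation:
  assumes ev: "laplace_eigenvalues A G \<nu> \<mu>" and s: "s > 0"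
  shows "finite {j. \<mu> j \<le> \<Lambda>}"
    and "f \<in> L2_space \<nu> \<Longrightarrow> spec_norm A G \<nu> \<mu> s f < \<infinity> \<Longrightarrow> \<Lambda> \<ge> 0 \<Longrightarrow>
      L2_norm \<nu> (\<lambda>x. f x - spec_trunc A G \<nu> \<mu> \<Lambda> f x) \<le> enn2real (spec_norm A G \<nu> \<mu> s f) * (1 + \<Lambda>) powr (- s / 2)"
    and "L2_dim \<nu> (spec_trunc A G \<nu> \<mu> \<Lambda> ` L2_space \<nu>) \<le> spec_count A G \<nu> \<mu> \<Lambda>"
proof -
  interpret L: form_operator "L2_space \<nu>" "L2_inner \<nu>" smooth "\<lambda>u p. - laplace_beltrami A G u p"
    by (rule form_operator_laplace)
  have mono: "strict_mono \<mu>" and mu0: "\<mu> 0 = 0" using ev by (auto simp: laplace_eigenvalues_def)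
  have ran: "range \<mu> = {l. \<exists>u\<in>L.espace l. L2.nrm \<nu> u \<noteq> 0}"
    using ev by (auto simp: laplace_eigenvalues_def laplace_eigenvalue_def laplace_eigenspace_eq L2_nrm)
  have mu_nonneg: "0 \<le> \<mu> j" for j using strict_mono_less_eq[OF mono, of 0 j] mu0 by simp
  show fin: "finite {j. \<mu> j \<le> \<Lambda>}" for \<Lambda> by (rule L.finite_spectrum_le[OF mono ran])
  define P where "P j f = eig_proj A G \<nu> \<mu> j f" for j f
  have P: "P j f \<in> L.espace (\<mu> j) \<and> (\<forall>h\<in>L.espace (\<mu> j). L2_inner \<nu> (f - P j f) h = 0)"
    if f: "f \<in> L2_space \<nu>" for j f
  proof -
    have "\<exists>g. g \<in> L.espace (\<mu> j) \<and> (\<forall>h\<in>L.espace (\<mu> j). L2_inner \<nu> (\<lambda>x. f x - g x) h = 0)"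
      using L.espace_projection[OF f, of "\<mu> j"] by (auto simp: fun_diff_def)
    from someI_ex[OF this] show ?thesis
      by (simp add: P_def eig_proj_def L2_proj_def laplace_eigenspace_eq fun_diff_def)
  qed
  have trunc: "spec_trunc A G \<nu> \<mu> \<Lambda> f = (\<Sum>j | \<mu> j \<le> \<Lambda>. P j f)" for \<Lambda> f
    by (simp add: spec_trunc_def P_def fun_eq_iff sum_fun_apply)
  show "L2_norm \<nu> (\<lambda>x. f x - spec_trunc A G \<nu> \<mu> \<Lambda> f x) \<le> enn2real (spec_norm A G \<nu> \<mu> s f) * (1 + \<Lambda>) powr (- s / 2)"
    if f: "f \<in> L2_space \<nu>" and sn: "spec_norm A G \<nu> \<mu> s f < \<infinity>" and \<Lambda>: "\<Lambda> \<ge> 0"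
  proof -
    define t where "t j = (1 + \<mu> j) powr (s / 2) * L2_norm \<nu> (P j f)" for j
    have PL: "P j f \<in> L2_space \<nu>" for j using P[OF f, of j] L.espace_H by blast
    have n0: "0 \<le> L2_norm \<nu> (P j f)" for j using L2.nrm_nonneg[OF PL] by (simp add: L2_nrm)
    have t0: "0 \<le> t j" for j by (simp add: t_def n0)
    have sn_eq: "spec_norm A G \<nu> \<mu> s f = (\<Sum>j. ennreal (t j))" by (simp add: spec_norm_def t_def P_def)
    have st: "summable t" using sn t0 unfolding sn_eq by (intro summable_suminf_not_top) auto
    have T: "enn2real (spec_norm A G \<nu> \<mu> s f) = suminf t"
      unfolding sn_eq using suminf_ennreal2[OF t0 st] suminf_nonneg[OF st t0] by simp
    have Pt: "L2_norm \<nu> (P j f) \<le> t j" for j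
    proof -
      have "1 \<le> (1 + \<mu> j) powr (s / 2)" using mu_nonneg[of j] s by (intro ge_one_powr_ge_zero) auto
      then show ?thesis using mult_right_mono[OF _ n0[of j]] by (force simp: t_def)
    qed
    have sP: "summable (\<lambda>j. L2_norm \<nu> (P j f))"
      using Pt n0 by (intro summable_comparison_test'[OF st, of 0]) auto
    have tail_le: "(if \<mu> j \<le> \<Lambda> then 0 else L2_norm \<nu> (P j f)) \<le> (1 + \<Lambda>) powr (- s / 2) * t j" for j
    proof (cases "\<mu> j \<le> \<Lambda>")
      case False
      have "1 = (1 + \<Lambda>) powr (- s / 2) * (1 + \<Lambda>) powr (s / 2)" using \<Lambda> by (simp flip: powr_add)
      also have "\<dots> \<le> (1 + \<Lambda>) powr (- s / 2) * (1 + \<mu> j) powr (s / 2)"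
        using False \<Lambda> s by (intro mult_left_mono powr_mono2) auto
      finally show ?thesis using False mult_right_mono[OF _ n0[of j]] by (force simp: t_def mult.assoc[symmetric])
    qed (simp add: t0)
    have "L2_norm \<nu> (f - (\<Sum>j | \<mu> j \<le> \<Lambda>. P j f)) \<le> (\<Sum>j. if \<mu> j \<le> \<Lambda> then 0 else L2_norm \<nu> (P j f))"
      using L.spectral_tail[OF f mono ran, of "\<lambda>j. P j f" \<Lambda>] P[OF f] sP unfolding L2_nrm by simp
    also have "\<dots> \<le> (\<Sum>j. (1 + \<Lambda>) powr (- s / 2) * t j)"
    proof (rule suminf_le[OF tail_le])
      show "summable (\<lambda>j. if \<mu> j \<le> \<Lambda> then 0 else L2_norm \<nu> (P j f))"
        using n0 by (intro summable_comparison_test'[OF sP, of 0]) auto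
      show "summable (\<lambda>j. (1 + \<Lambda>) powr (- s / 2) * t j)" using st by (rule summable_mult)
    qed
    also have "\<dots> = suminf t * (1 + \<Lambda>) powr (- s / 2)" using st by (simp add: suminf_mult)
    finally show ?thesis by (simp add: T trunc fun_diff_def)
  qed
  show "L2_dim \<nu> (spec_trunc A G \<nu> \<mu> \<Lambda> ` L2_space \<nu>) \<le> spec_count A G \<nu> \<mu> \<Lambda>"
  proof -
    let ?J = "{j. \<mu> j \<le> \<Lambda>}"
    obtain N :: "nat \<Rightarrow> nat" where N1: "\<forall>j. \<exists>B. finite B \<and> B \<subseteq> L.espace (\<mu> j) \<and> L2.indep \<nu> B \<and> card B = N j"
      and N2: "\<forall>J C. finite J \<longrightarrow> finite C \<longrightarrow> C \<subseteq> {\<Sum>j\<in>J. p j | p. \<forall>j. p j \<in> L.espace (\<mu> j)} \<longrightarrow> L2.indep \<nu> C \<longrightarrow>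
       card C \<le> (\<Sum>j\<in>J. N j)"
      using L.truncation_dim[of \<mu>] by (elim exE conjE) (rule that)
    have indep_eq: "L2_independent \<nu> C \<longleftrightarrow> L2.indep \<nu> C" if "finite C" "C \<subseteq> L2_space \<nu>" for C
    proof -
      have "(AE x in \<nu>. (\<Sum>b\<in>C. a b * b x) = 0) \<longleftrightarrow> L2.nrm \<nu> (\<Sum>b\<in>C. a b *\<^sub>R b) = 0" for a
      proof -
        have "(\<Sum>b\<in>C. a b *\<^sub>R b) \<in> L2_space \<nu>" using that(2) by (intro L2.H_closed(4,5)) auto
        then show ?thesis by (simp add: L2_nrm L2_norm_zero_AE sum_fun_apply)
      qed
      then show ?thesis by (simp add: L2_independent_def L2.indep_def)
    qed
    have dim_ge: "enat (N j) \<le> L2_dim \<nu> (laplace_eigenspace A G \<nu> (\<mu> j))" for j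
    proof -
      obtain B where B: "finite B" "B \<subseteq> L.espace (\<mu> j)" "L2.indep \<nu> B" "card B = N j" using N1 by blast
      have "B \<subseteq> L2_space \<nu>" using B(2) L.espace_H by blast
      then have "B \<in> {B. finite B \<and> B \<subseteq> laplace_eigenspace A G \<nu> (\<mu> j) \<and> L2_independent \<nu> B}"
        using B indep_eq by (simp add: laplace_eigenspace_eq)
      then show ?thesis unfolding L2_dim_def B(4)[symmetric] by (rule SUP_upper)
    qed
    have "enat (card C) \<le> spec_count A G \<nu> \<mu> \<Lambda>"
      if C: "finite C" "C \<subseteq> spec_trunc A G \<nu> \<mu> \<Lambda> ` L2_space \<nu>" "L2_independent \<nu> C" for C
    proof -
      have sub: "C \<subseteq> {\<Sum>j\<in>?J. p j | p. \<forall>j. p j \<in> L.espace (\<mu> j)}"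
      proof
        fix c assume "c \<in> C"
        then obtain f where f: "f \<in> L2_space \<nu>" "c = (\<Sum>j\<in>?J. P j f)" using C(2) trunc by auto
        then show "c \<in> {\<Sum>j\<in>?J. p j | p. \<forall>j. p j \<in> L.espace (\<mu> j)}"
          using P[OF f(1)] by (intro CollectI exI[of _ "\<lambda>j. P j f"]) auto
      qed
      have CL: "C \<subseteq> L2_space \<nu>"
      proof
        fix c assume "c \<in> C"
        then obtain p where "c = (\<Sum>j\<in>?J. p j)" "\<forall>j. p j \<in> L.espace (\<mu> j)" using sub by blast
        then show "c \<in> L2_space \<nu>" using L2.H_closed(5)[of ?J p \<nu>] L.espace_H by blast
      qed
      have "card C \<le> (\<Sum>j\<in>?J. N j)"
        using N2 fin C(1,3) sub indep_eq[OF C(1) CL] by blast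
      then have "enat (card C) \<le> enat (\<Sum>j\<in>?J. N j)" by simp
      also have "\<dots> = (\<Sum>j\<in>?J. enat (N j))"
        by (induction rule: finite_induct[OF fin]) (simp_all add: zero_enat_def plus_enat_simps(1)[symmetric] del: plus_enat_simps(1))
      also have "\<dots> \<le> spec_count A G \<nu> \<mu> \<Lambda>" unfolding spec_count_def by (intro sum_mono dim_ge)
      finally show ?thesis .
    qed
    then show ?thesis unfolding L2_dim_def[of _ "spec_trunc A G \<nu> \<mu> \<Lambda> ` L2_space \<nu>"] by (intro SUP_least) auto
  qed
qed

end

lemma L2_norm_null_measure:
  assumes "emeasure M (space M) = 0" shows "L2_norm M f = 0"
proof -
  have "AE x in M. f x * f x = 0" using assms by (intro AE_I'[of "space M"]) auto
  then show ?thesis by (simp add: L2_norm_def L2_inner_def integral_eq_zero_AE)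
qed

text \<open>
  Normalizing a volume that is zero or infinite would give the zero measure, for which all norms vanish. A function
  of non-zero norm rules this out.
\<close>

lemma normalized_volume_weighted_manifold:
  assumes M: "compact_connected_riemannian_manifold A G" and \<nu>: "normalized_riemannian_volume A G \<nu>"
    and nontrivial: "L2_norm \<nu> u \<noteq> 0"
  shows "\<exists>\<kappa>. weighted_manifold A G \<nu> \<kappa>"
proof -
  obtain vol where vol: "riemannian_volume A G vol" and nu: "\<nu> = uniform_measure vol UNIV"
    using \<nu> by (auto simp: normalized_riemannian_volume_def)
  have sv: "sets vol = sets borel" using vol by (simp add: riemannian_volume_def)
  then have spv: "space vol = UNIV" using sets_eq_imp_space_eq[OF sv] by simp
  define V where "V = emeasure vol UNIV"
  have em: "emeasure \<nu> B = emeasure vol B / V" if "B \<in> sets borel" for B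
    unfolding nu V_def using that sv by (subst emeasure_uniform_measure) auto
  have sp: "space \<nu> = UNIV" by (simp add: nu spv)
  have tot: "emeasure \<nu> UNIV \<noteq> 0" using L2_norm_null_measure[of \<nu> u] nontrivial sp by auto
  have V: "V \<noteq> 0" "V \<noteq> \<infinity>" using tot em[of UNIV] by (auto simp: V_def[symmetric])
  then obtain r where r: "V = ennreal r" "r > 0"
    by (cases V) (auto simp: top_unique)
  have "weighted_manifold A G \<nu> (1 / r)"
  proof (rule weighted_manifold.intro)
    show "compact (UNIV :: 'a set)" "smooth_atlas A" "riemannian_metric A G"
      using M by (auto simp: compact_connected_riemannian_manifold_def)
    show "sets \<nu> = sets borel" by (simp add: nu sv)
    show "finite_measure \<nu>" using em[of UNIV] r by (simp add: finite_measureI sp V_def[symmetric] divide_ennreal)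
    show "1 / r > 0" using r by simp
    show "emeasure \<nu> B = ennreal (1 / r) * (\<integral>\<^sup>+x\<in>chart_map c ` B. ennreal (sqrt (det (G c x))) \<partial>lborel)"
      if "c \<in> A" "B \<in> sets borel" "B \<subseteq> chart_dom c" for c B
    proof -
      have "emeasure \<nu> B = emeasure vol B * inverse V" using em[OF that(2)] by (simp add: divide_ennreal_def)
      also have "inverse V = ennreal (1 / r)" using r by (simp add: inverse_ennreal inverse_eq_divide)
      finally show ?thesis using vol that by (simp add: riemannian_volume_def mult.commute)
    qed
  qed
  then show ?thesis by blast
qed

theorem proposition2p6:
  fixes A :: "('a::t2_space, 'n::finite) chart set"
    and G :: "('a, 'n) metric"
    and \<nu> :: "'a measure"
    and \<mu> :: "nat \<Rightarrow> real"
    and C\<^sub>W s :: real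
  assumes "compact_connected_riemannian_manifold A G"
    and "normalized_riemannian_volume A G \<nu>"
    and "laplace_eigenvalues A G \<nu> \<mu>"
    and "\<And>\<Lambda>. \<Lambda> \<ge> 0 \<Longrightarrow>
           ereal_of_enat (spec_count A G \<nu> \<mu> \<Lambda>) \<le> ereal (C\<^sub>W * (1 + \<Lambda>) powr (real CARD('n) / 2))"
    and "s > 0"
  shows "(\<forall>f\<in>spec_space A G \<nu> \<mu> s. \<forall>\<Lambda>\<ge>0.
           ennreal (L2_norm \<nu> (\<lambda>x. f x - spec_trunc A G \<nu> \<mu> \<Lambda> f x))
             \<le> spec_norm A G \<nu> \<mu> s f * ennreal ((1 + \<Lambda>) powr (- s / 2))) \<and>
         (\<forall>R>0. \<forall>f\<in>L2_space \<nu>. spec_norm A G \<nu> \<mu> s f \<le> ennreal R \<longrightarrow> (\<forall>\<Lambda>\<ge>0.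
           (L2_norm \<nu> (\<lambda>x. f x - spec_trunc A G \<nu> \<mu> \<Lambda> f x))\<^sup>2 \<le> R\<^sup>2 * (1 + \<Lambda>) powr (- s))) \<and>
         (\<forall>R \<epsilon>. 0 < \<epsilon> \<and> \<epsilon> < R \<longrightarrow> (let \<Lambda>\<^sub>\<epsilon> = (R / \<epsilon>) powr (2 / s) - 1 in
           (\<forall>f\<in>L2_space \<nu>. spec_norm A G \<nu> \<mu> s f \<le> ennreal R \<longrightarrow>
              L2_norm \<nu> (\<lambda>x. f x - spec_trunc A G \<nu> \<mu> \<Lambda>\<^sub>\<epsilon> f x) \<le> \<epsilon>) \<and>
           L2_dim \<nu> (spec_trunc A G \<nu> \<mu> \<Lambda>\<^sub>\<epsilon> ` L2_space \<nu>) \<le> spec_count A G \<nu> \<mu> \<Lambda>\<^sub>\<epsilon> \<and>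
           ereal_of_enat (spec_count A G \<nu> \<mu> \<Lambda>\<^sub>\<epsilon>) \<le> ereal (C\<^sub>W * (R / \<epsilon>) powr (real CARD('n) / s))))"
proof -
  note s = \<open>s > 0\<close>
  \<comment> \<open>an eigenfunction for the eigenvalue \<open>\<mu> 0 = 0\<close> has non-zero norm, so the volume is finite and positive\<close>
  have "0 \<in> range \<mu>" using assms(3) unfolding laplace_eigenvalues_def by (metis rangeI)
  then have "laplace_eigenvalue A G \<nu> 0" using assms(3) by (simp add: laplace_eigenvalues_def)
  then obtain u where "L2_norm \<nu> u \<noteq> 0" by (auto simp: laplace_eigenvalue_def)
  then obtain \<kappa> where "weighted_manifold A G \<nu> \<kappa>"
    using normalized_volume_weighted_manifold[OF assms(1,2)] by blast
  then interpret weighted_manifold A G \<nu> \<kappa> .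
  let ?err = "\<lambda>\<Lambda> f. L2_norm \<nu> (\<lambda>x. f x - spec_trunc A G \<nu> \<mu> \<Lambda> f x)"
  note tail = spectral_truncation(2)[OF assms(3) s]
  have err_nonneg: "0 \<le> L2_norm \<nu> h" for h by (simp add: L2_norm_def L2_inner_def)
  have bound: "?err \<Lambda> f \<le> R * (1 + \<Lambda>) powr (- s / 2)"
    if "f \<in> L2_space \<nu>" "spec_norm A G \<nu> \<mu> s f \<le> ennreal R" "\<Lambda> \<ge> 0" "R > 0" for f R \<Lambda>
  proof -
    have lt: "spec_norm A G \<nu> \<mu> s f < \<infinity>" using that(2) by (auto simp: less_top[symmetric] top_unique)
    have "enn2real (spec_norm A G \<nu> \<mu> s f) \<le> R" using that(2,4) by (intro enn2real_leI) auto
    then have "enn2real (spec_norm A G \<nu> \<mu> s f) * (1 + \<Lambda>) powr (- s / 2) \<le> R * (1 + \<Lambda>) powr (- s / 2)"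
      by (intro mult_right_mono) auto
    then show ?thesis using tail[OF that(1) lt that(3)] by linarith
  qed
  show ?thesis
  proof (intro conjI ballI allI impI)
    fix f \<Lambda> assume f: "f \<in> spec_space A G \<nu> \<mu> s" and \<Lambda>: "0 \<le> (\<Lambda>::real)"
    have fL: "f \<in> L2_space \<nu>" "spec_norm A G \<nu> \<mu> s f < \<infinity>" using f by (auto simp: spec_space_def)
    have "ennreal (?err \<Lambda> f) \<le> ennreal (enn2real (spec_norm A G \<nu> \<mu> s f) * (1 + \<Lambda>) powr (- s / 2))"
      using tail[OF fL \<Lambda>] by (rule ennreal_leI)
    also have "\<dots> = spec_norm A G \<nu> \<mu> s f * ennreal ((1 + \<Lambda>) powr (- s / 2))"
      using fL(2) by (simp add: ennreal_mult)
    finally show "ennreal (?err \<Lambda> f) \<le> spec_norm A G \<nu> \<mu> s f * ennreal ((1 + \<Lambda>) powr (- s / 2))" .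
  next
    fix R f \<Lambda> assume R: "0 < (R::real)" and f: "f \<in> L2_space \<nu>" "spec_norm A G \<nu> \<mu> s f \<le> ennreal R" and \<Lambda>: "0 \<le> (\<Lambda>::real)"
    have "(?err \<Lambda> f)\<^sup>2 \<le> (R * (1 + \<Lambda>) powr (- s / 2))\<^sup>2"
      using bound[OF f \<Lambda> R] err_nonneg by (rule power_mono)
    also have "\<dots> = R\<^sup>2 * (1 + \<Lambda>) powr (- s)"
      by (simp add: power_mult_distrib power2_eq_square flip: powr_add)
    finally show "(?err \<Lambda> f)\<^sup>2 \<le> R\<^sup>2 * (1 + \<Lambda>) powr (- s)" .
  next
    fix R \<epsilon> :: real assume Re: "0 < \<epsilon> \<and> \<epsilon> < R"
    define \<Lambda> where "\<Lambda> = (R / \<epsilon>) powr (2 / s) - 1"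
    have q: "R / \<epsilon> \<ge> 1" "R > 0" using Re by auto
    have L0: "\<Lambda> \<ge> 0" unfolding \<Lambda>_def using ge_one_powr_ge_zero[OF q(1), of "2 / s"] s by simp
    have L1: "1 + \<Lambda> = (R / \<epsilon>) powr (2 / s)" by (simp add: \<Lambda>_def)
    \<comment> \<open>the threshold is chosen to make the error bound equal to \<open>\<epsilon>\<close>\<close>
    have e: "R * (1 + \<Lambda>) powr (- s / 2) = \<epsilon>"
    proof -
      have "(1 + \<Lambda>) powr (- s / 2) = (R / \<epsilon>) powr (- 1)" unfolding L1 powr_powr using s by simp
      also have "\<dots> = \<epsilon> / R" using Re by (simp add: powr_minus)
      finally show ?thesis using Re by simp
    qed
    have c: "(1 + \<Lambda>) powr (real CARD('n) / 2) = (R / \<epsilon>) powr (real CARD('n) / s)"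
      unfolding L1 powr_powr by simp
    show "let \<Lambda>\<^sub>\<epsilon> = (R / \<epsilon>) powr (2 / s) - 1 in
           (\<forall>f\<in>L2_space \<nu>. spec_norm A G \<nu> \<mu> s f \<le> ennreal R \<longrightarrow> ?err \<Lambda>\<^sub>\<epsilon> f \<le> \<epsilon>) \<and>
           L2_dim \<nu> (spec_trunc A G \<nu> \<mu> \<Lambda>\<^sub>\<epsilon> ` L2_space \<nu>) \<le> spec_count A G \<nu> \<mu> \<Lambda>\<^sub>\<epsilon> \<and>
           ereal_of_enat (spec_count A G \<nu> \<mu> \<Lambda>\<^sub>\<epsilon>) \<le> ereal (C\<^sub>W * (R / \<epsilon>) powr (real CARD('n) / s))"
      unfolding Let_def \<Lambda>_def[symmetric]
    proof (intro conjI ballI impI)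
      show "?err \<Lambda> f \<le> \<epsilon>" if "f \<in> L2_space \<nu>" "spec_norm A G \<nu> \<mu> s f \<le> ennreal R" for f
        using bound[OF that L0 q(2)] by (simp only: e)
      show "L2_dim \<nu> (spec_trunc A G \<nu> \<mu> \<Lambda> ` L2_space \<nu>) \<le> spec_count A G \<nu> \<mu> \<Lambda>"
        by (rule spectral_truncation(3)[OF assms(3) s])
      show "ereal_of_enat (spec_count A G \<nu> \<mu> \<Lambda>) \<le> ereal (C\<^sub>W * (R / \<epsilon>) powr (real CARD('n) / s))"
        using assms(4)[OF L0] by (simp only: c)
    qed
  qed
qed

end
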